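(* Let $a<b$, $\Omega:=(a,b)$, $1<p<\infty$, $p':=p/(p-1)$, and let $m\in L^{p'}(\Omega)$ (possibly sign-changing). For $\gamma>0$ consider the problem $$(\mathrm{P}_\gamma)\qquad -\left(|u'|^{p-2}u'\right)'=m(x)u^{-\gamma}\ \text{ in }\Omega,\qquad u>0\ \text{ in }\Omega,\qquad u=0\ \text{ on }\partial\Omega .$$ (i) Suppose $\mathcal{S}(m)\in P^{\circ}$. Then there exists $\gamma_0>0$ such that for all $\gamma\in(0,\gamma_0]$ the problem $(\mathrm{P}_\gamma)$ has a solution $u\in P^{\circ}$. (ii) Let $\gamma>0$ and suppose $m^{-}\delta_\Omega^{-\gamma}\in L^q(\Omega)$ with $q>1$. If for some $I=(x_0,x_1)\subseteq\Omega$ it holds that $$\frac{\left(\inf_I m^+\right)^{p-1+\gamma}}{\left(\int_a^b m^+\right)^{\gamma}}\ \ge\ c_{\gamma,p,\Omega,I}\,\left[\max\left(\int_a^{x_0}m^-\delta_\Omega^{-\gamma},\ \int_{x_1}^b m^-\delta_\Omega^{-\gamma}\right)\right]^{p-1},$$ where $$c_{\gamma,p,\Omega,I}:=\left(\frac{p-1}{\gamma}\right)^{\gamma}\left(\frac{p-1+\gamma}{p-1}\right)^{p-1+\gamma}\left(\frac{b-a}{2}\right)^{\gamma(p-1)}\left(c_I^{\,p-1}\lambda_1(I)\right)^{p-1+\gamma},$$ then $(\mathrm{P}_\gamma)$ has a solution $u\in C^1(\Omega)\cap C(\overline\Omega)$, and $u\in P^{\circ}$ whenever $m^+\delta_\Omega^{-\gamma}\in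 L^r(\Omega)$ with $r>1$.
   Context: Notation. $h^+:=\max(h,0)$, $h^-:=\max(-h,0)$, so $h=h^+-h^-$. $\delta_\Omega(x):=\mathrm{dist}(x,\partial\Omega)=\min(x-a,b-x)$. $\inf_I$ of a function defined almost everywhere denotes its essential infimum on $I$. For $h\in L^q(\Omega)$ with $q>1$, $\mathcal{S}(h)$ denotes the unique $v\in C^1(\overline\Omega)$ such that $|v'|^{p-2}v'$ is absolutely continuous, $-(|v'|^{p-2}v')'=h$ a.e. in $\Omega$, and $v(a)=v(b)=0$. $P^{\circ}$ is the interior of the positive cone of $C^1_0(\overline\Omega)$, i.e. the set of $v\in C^1(\overline\Omega)$ with $v(a)=v(b)=0$, $v>0$ in $\Omega$, $v'(a)>0$ and $v'(b)<0$. For an open interval $I=(x_0,x_1)\subseteq\Omega$: $x_I:=\frac{x_0+x_1}{2}$, $c_I:=\max(x_I-a,\,b-x_I)$, and $\lambda_1(I)$ is the first Dirichlet eigenvalue of the $p$-Laplacian on $I$ (the problem $-(|\Phi'|^{p-2}\Phi')'=\lambda_1(I)\Phi^{p-1}$ in $I$, $\Phi>0$ in $I$, $\Phi=0$ on $\partial I$), explicitly $$\lambda_1(I)=\left(\frac{\pi_p}{x_1-x_0}\right)^p,\qquad \pi_p:=\frac{2\pi(p-1)^{1/p}}{p\sin(\pi/p)}.$$ A solution of $(\mathrm{P}_\gamma)$ is a function $u\in C^1(\Omega)\cap C(\overline\Omega)$ with $u>0$ in $\Omega$, $u=0$ on $\partial\Omega$, satisfying the equation in the sense of distributions: $\int_a^b|u'|^{p-2}u'\phi'=\int_a^b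 m\,u^{-\gamma}\phi$ for all $\phi\in C_c^\infty(\Omega)$.
   Formalization: Part (ii) additionally assumes that the integral of m^+ over (a,b) is positive and that m ≥ 0 a.e. on I; both are automatic if inf_I m^+ > 0. If inf_I m^+ = 0, the claim as stated fails, e.g. for m = 1 off I and m = -M on I with M large. *)

theory Defs
  imports "HOL-Analysis.Analysis"
begin

text \<open>Functions on subsets of the line are total functions \<open>real \<Rightarrow> real\<close>; only their values on
  the set in question matter.\<close>

definition Lp_on :: "real \<Rightarrow> real set \<Rightarrow> (real \<Rightarrow> real) \<Rightarrow> bool" where
  "Lp_on q S f \<longleftrightarrow> f \<in> borel_measurable (lebesgue_on S)
      \<and> integrable (lebesgue_on S) (\<lambda>x. \<bar>f x\<bar> powr q)"

text \<open>Derivative relative to \<open>S\<close>: the ordinary derivative in the interior, one-sided at the end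
  points of a nondegenerate closed interval.\<close>

definition deriv_on :: "real set \<Rightarrow> (real \<Rightarrow> real) \<Rightarrow> real \<Rightarrow> real" where
  "deriv_on S f x = vector_derivative f (at x within S)"

definition C1_on :: "real set \<Rightarrow> (real \<Rightarrow> real) \<Rightarrow> bool" where
  "C1_on S f \<longleftrightarrow> f differentiable_on S \<and> continuous_on S (deriv_on S f)"

definition abs_cont_on :: "real \<Rightarrow> real \<Rightarrow> (real \<Rightarrow> real) \<Rightarrow> bool" where
  "abs_cont_on a b f \<longleftrightarrow>
     (\<forall>\<epsilon>>0. \<exists>\<eta>>0. \<forall>(n::nat) l r.
        (\<forall>i<n. a \<le> l i \<and> l i \<le> r i \<and> r i \<le> b)
        \<and> disjoint_family_on (\<lambda>i. {l i<..<r i}) {..<n}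
        \<and> (\<Sum>i<n. r i - l i) < \<eta>
        \<longrightarrow> (\<Sum>i<n. \<bar>f (r i) - f (l i)\<bar>) < \<epsilon>)"

text \<open>The map \<open>t \<mapsto> |t|\<^sup>p\<^sup>-\<^sup>2 t\<close>; at \<open>t = 0\<close> it is \<open>0\<close> for every \<open>p\<close>, since \<open>0 powr s = 0\<close>.\<close>

definition phi_p :: "real \<Rightarrow> real \<Rightarrow> real" where
  "phi_p p t = \<bar>t\<bar> powr (p - 2) * t"

definition dirichlet_sol :: "real \<Rightarrow> real \<Rightarrow> real \<Rightarrow> (real \<Rightarrow> real) \<Rightarrow> (real \<Rightarrow> real) \<Rightarrow> bool" where
  "dirichlet_sol p a b h v \<longleftrightarrow>
     C1_on {a..b} v
     \<and> abs_cont_on a b (\<lambda>x. phi_p p (deriv_on {a..b} v x))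
     \<and> (AE x in lebesgue_on {a<..<b}.
          ((\<lambda>x. phi_p p (deriv_on {a..b} v x)) has_real_derivative - h x) (at x))
     \<and> v a = 0 \<and> v b = 0"

text \<open>The solution operator \<open>\<S>\<close>. Extension by zero outside \<open>[a, b]\<close> makes the solution unique as a
  total function.\<close>

definition sol_op :: "real \<Rightarrow> real \<Rightarrow> real \<Rightarrow> (real \<Rightarrow> real) \<Rightarrow> real \<Rightarrow> real" where
  "sol_op p a b h = (THE v. dirichlet_sol p a b h v \<and> (\<forall>x. x \<notin> {a..b} \<longrightarrow> v x = 0))"

definition P_interior :: "real \<Rightarrow> real \<Rightarrow> (real \<Rightarrow> real) set" where
  "P_interior a b = {v. C1_on {a..b} v \<and> v a = 0 \<and> v b = 0 \<and> (\<forall>x\<in>{a<..<b}. v x > 0)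
      \<and> deriv_on {a..b} v a > 0 \<and> deriv_on {a..b} v b < 0}"

definition bdist :: "real \<Rightarrow> real \<Rightarrow> real \<Rightarrow> real" where
  "bdist a b x = min (x - a) (b - x)"

text \<open>Essential infimum, as a real number; meaningful for functions that are essentially bounded
  below on a set \<open>I\<close> of positive measure and finite-valued there.\<close>

definition ess_inf_on :: "real set \<Rightarrow> (real \<Rightarrow> real) \<Rightarrow> real" where
  "ess_inf_on I f = Sup {c. AE x in lebesgue_on I. c \<le> f x}"

text \<open>The first Dirichlet eigenvalue is the one with a positive eigenfunction. The right-hand side
  of the equation being continuous, it is required to hold at every interior point.\<close>

definition lambda1 :: "real \<Rightarrow> real \<Rightarrow> real \<Rightarrow> real" where
  "lambda1 p x0 x1 = (THE l. \<exists>\<Phi>. C1_on {x0..x1} \<Phi> \<and> \<Phi> x0 = 0 \<and> \<Phi> x1 = 0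
      \<and> (\<forall>x\<in>{x0<..<x1}. \<Phi> x > 0
           \<and> ((\<lambda>x. phi_p p (deriv \<Phi> x)) has_real_derivative - (l * \<Phi> x powr (p - 1))) (at x)))"

definition c_I :: "real \<Rightarrow> real \<Rightarrow> real \<Rightarrow> real \<Rightarrow> real" where
  "c_I a b x0 x1 = max ((x0 + x1) / 2 - a) (b - (x0 + x1) / 2)"

definition c_const :: "real \<Rightarrow> real \<Rightarrow> real \<Rightarrow> real \<Rightarrow> real \<Rightarrow> real \<Rightarrow> real" where
  "c_const \<gamma> p a b x0 x1 =
     ((p - 1) / \<gamma>) powr \<gamma> * ((p - 1 + \<gamma>) / (p - 1)) powr (p - 1 + \<gamma>)
     * ((b - a) / 2) powr (\<gamma> * (p - 1))
     * (c_I a b x0 x1 powr (p - 1) * lambda1 p x0 x1) powr (p - 1 + \<gamma>)"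

definition test_functions :: "real \<Rightarrow> real \<Rightarrow> (real \<Rightarrow> real) set" where
  "test_functions a b = {\<phi>. (\<forall>k. (deriv ^^ k) \<phi> differentiable_on UNIV)
      \<and> compact (closure {x. \<phi> x \<noteq> 0}) \<and> closure {x. \<phi> x \<noteq> 0} \<subseteq> {a<..<b}}"

text \<open>Solutions of \<open>(P\<^sub>\<gamma>)\<close>. Both integrands are automatically integrable when \<open>m\<close> is locally
  integrable: on the support of \<open>\<phi>\<close> the functions \<open>deriv u\<close> and \<open>u powr (- \<gamma>)\<close> are continuous.\<close>

definition solves_P :: "real \<Rightarrow> real \<Rightarrow> real \<Rightarrow> (real \<Rightarrow> real) \<Rightarrow> real \<Rightarrow> (real \<Rightarrow> real) \<Rightarrow> bool" where
  "solves_P p a b m \<gamma> u \<longleftrightarrow>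
     C1_on {a<..<b} u \<and> continuous_on {a..b} u
     \<and> (\<forall>x\<in>{a<..<b}. u x > 0) \<and> u a = 0 \<and> u b = 0
     \<and> (\<forall>\<phi>\<in>test_functions a b.
          (LINT x:{a<..<b}|lebesgue. phi_p p (deriv u x) * deriv \<phi> x)
          = (LINT x:{a<..<b}|lebesgue. m x * u x powr (- \<gamma>) * \<phi> x))"

end

theory Submission
  imports Defs "HOL-Complex_Analysis.Great_Picard"
begin

text \<open>The equation is written as a first-order system for \<open>u\<close> and the flux \<open>D = |u'|\<^sup>p\<^sup>-\<^sup>2 u'\<close>. If the
  right-hand side is dominated by an integrable function, shooting in Tonelli's delayed system (which has
  unique solutions), followed by compactness, solves the Dirichlet problem. So the singular term
  is truncated, and it remains to show that the truncation is inactive.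

  In part (i) the truncated right-hand side is \<open>L\<^sup>1\<close>-close to \<open>m\<close>, hence its solution is \<open>C\<^sup>1\<close>-close to
  \<open>S(m)\<close>, which lies in the interior of the cone.

  In part (ii) one shows \<open>u \<ge> k \<delta>\<close>. Outside \<open>I\<close> the flux increases by at most \<open>k\<^sup>-\<^sup>\<gamma> M\<close>, where \<open>M\<close> is the
  maximum in the hypothesis, so if \<open>u\<close> fell below \<open>k \<delta>\<close>, its slope would be at most
  \<open>\<sigma> = (k\<^sup>p\<^sup>-\<^sup>1 + k\<^sup>-\<^sup>\<gamma> M)\<^sup>1\<^sup>/\<^sup>(\<^sup>p\<^sup>-\<^sup>1\<^sup>)\<close> between that point and the midpoint of \<open>I\<close>; but there \<open>u\<close> is at least \<open>c\<^sub>I \<sigma>\<close>,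
  because on \<open>I\<close> the flux decreases at rate at least \<open>\<lambda>\<^sub>1(I) (c\<^sub>I \<sigma>)\<^sup>p\<^sup>-\<^sup>1\<close> as long as \<open>u \<le> c\<^sub>I \<sigma>\<close>. Only the bound
  \<open>\<lambda>\<^sub>1(I) \<ge> (2 / |I|)\<^sup>p (p / (p - 1))\<^sup>p\<^sup>-\<^sup>1\<close> is needed; its proof requires existence and uniqueness of the
  first eigenvalue. The truncation is removed with the bound \<open>u\<^sup>\<gamma> |D| \<le> \<integral>|m|\<close>, which makes \<open>u\<^sup>q\<close>,
  \<open>q = 1 + \<gamma> / (p - 1)\<close>, uniformly Lipschitz.\<close>

section \<open>Absolute continuity and the fundamental theorem of calculus\<close>

text \<open>\<open>psi_p\<close> is not Lipschitz at 0 for p > 2, and neither is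
  \<open>phi_p\<close> for p < 2, so uniqueness for initial value problems cannot be relied on and
  the end value is not a function of the initial slope. The delay restores this at the price of a
  limit. The operator S is defined through absolute continuity and an a.e. derivative, whereas every
  estimate uses integrals; both halves of Lebesgue's fundamental theorem form the bridge. In part
  (ii) the truncation has two floors. The floor k \<delta> is the expected barrier and tames the
  negative part of m, since m^- \<delta>^(-\<gamma>) is integrable. The same is not assumed of m^+,
  so a constant floor \<epsilon> supplies the integrable bound, and the barrier has to be uniform in
  \<epsilon>. The eigenvalue stands on the smaller side of the hypothesis, which is why a lower
  bound for it is the useful direction. If M = 0, the optimal k would be 0; then m is nonnegative
  and concavity replaces the barrier argument.\<close>

lemma abs_cont_on_finite:
  assumes "abs_cont_on a b F" "\<epsilon> > 0"
  obtains \<eta> where "\<eta> > 0"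
    "\<And>S l r. \<lbrakk>finite S; \<And>i. i \<in> S \<Longrightarrow> a \<le> l i \<and> l i \<le> r i \<and> r i \<le> b;
        disjoint_family_on (\<lambda>i. {l i<..<r i}) S; (\<Sum>i\<in>S. r i - l i) < \<eta>\<rbrakk>
      \<Longrightarrow> (\<Sum>i\<in>S. \<bar>F (r i) - F (l i)\<bar>) < \<epsilon>"
proof -
  obtain \<eta> where "\<eta> > 0" and \<eta>: "\<forall>(n::nat) l r. (\<forall>i<n. a \<le> l i \<and> l i \<le> r i \<and> r i \<le> b)
      \<and> disjoint_family_on (\<lambda>i. {l i<..<r i}) {..<n} \<and> (\<Sum>i<n. r i - l i) < \<eta>
      \<longrightarrow> (\<Sum>i<n. \<bar>F (r i) - F (l i)\<bar>) < \<epsilon>"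
    using assms(1)[unfolded abs_cont_on_def, rule_format, OF assms(2)] by (elim exE conjE)
  show thesis
  proof (rule that[OF \<open>\<eta> > 0\<close>])
    fix S :: "'a set" and l r :: "'a \<Rightarrow> real"
    assume S: "finite S" and lr: "\<And>i. i \<in> S \<Longrightarrow> a \<le> l i \<and> l i \<le> r i \<and> r i \<le> b"
      and dj: "disjoint_family_on (\<lambda>i. {l i<..<r i}) S" and sm: "(\<Sum>i\<in>S. r i - l i) < \<eta>"
    obtain h where h: "bij_betw h {..<card S} S"
      using ex_bij_betw_nat_finite[OF S] by (auto simp: lessThan_atLeast0)
    have "(\<Sum>i<card S. \<bar>F (r (h i)) - F (l (h i))\<bar>) < \<epsilon>"
    proof (rule \<eta>[rule_format], intro conjI)
      show "\<forall>i<card S. a \<le> l (h i) \<and> l (h i) \<le> r (h i) \<and> r (h i) \<le> b"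
        using h lr by (auto simp: bij_betw_def)
      show "disjoint_family_on (\<lambda>i. {l (h i)<..<r (h i)}) {..<card S}"
        using h dj unfolding disjoint_family_on_def bij_betw_def inj_on_def by blast
      show "(\<Sum>i<card S. r (h i) - l (h i)) < \<eta>"
        using sm sum.reindex_bij_betw[OF h, of "\<lambda>i. r i - l i"] by simp
    qed
    then show "(\<Sum>i\<in>S. \<bar>F (r i) - F (l i)\<bar>) < \<epsilon>"
      using sum.reindex_bij_betw[OF h, of "\<lambda>i. \<bar>F (r i) - F (l i)\<bar>"] by simp
  qed
qed

lemma has_real_derivative_local:
  assumes "(F has_real_derivative f) (at x)" "e > 0"
  obtains d where "d > 0" "\<And>y. \<bar>y - x\<bar> < d \<Longrightarrow> \<bar>F y - F x - f * (y - x)\<bar> \<le> e * \<bar>y - x\<bar>"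
  using assms unfolding has_field_derivative_def has_derivative_at_alt real_norm_def
  by (meson that)

text \<open>Since x lies between u and v, the one-sided errors \<open>e * (v - x)\<close> and
  \<open>e * (x - u)\<close> add up to exactly \<open>e * (v - u)\<close>.\<close>

lemma has_real_derivative_straddle:
  fixes F :: "real \<Rightarrow> real"
  assumes "\<And>y. \<bar>y - x\<bar> < d \<Longrightarrow> \<bar>F y - F x - f * (y - x)\<bar> \<le> e * \<bar>y - x\<bar>"
    and "u \<le> x" "x \<le> v" "\<bar>u - x\<bar> < d" "\<bar>v - x\<bar> < d"
  shows "\<bar>(v - u) * f - (F v - F u)\<bar> \<le> e * (v - u)"
proof -
  have "\<bar>F v - F x - f * (v - x)\<bar> \<le> e * (v - x)" "\<bar>F u - F x - f * (u - x)\<bar> \<le> e * (x - u)"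
    using assms(1)[of u] assms(1)[of v] assms(2-5) by (simp_all add: abs_of_nonneg abs_of_nonpos)
  then show ?thesis
    by (simp add: algebra_simps abs_le_iff)
qed

text \<open>Off the null set the gauge comes from differentiability; on it the tagged intervals are forced
  into an open set of small measure, where absolute continuity controls the increments.\<close>

lemma abs_cont_on_has_integral:
  fixes F f :: "real \<Rightarrow> real"
  assumes ab: "a \<le> b" and AC: "abs_cont_on a b F" and N: "negligible N"
    and der: "\<And>x. x \<in> {a<..<b} - N \<Longrightarrow> (F has_real_derivative f x) (at x)"
  shows "(f has_integral F b - F a) {a..b}"
proof -
  \<comment> \<open>No derivative is assumed at the end points, so they join the exceptional
    set.\<close>
  define N' where "N' = N \<union> {a, b}"
  have N': "negligible N'"
    unfolding N'_def using N by (simp add: negligible_Un)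
  \<comment> \<open>With the value 0 on the exceptional set, tags there contribute only increments
    of \<open>F\<close> to the error of the Riemann sum.\<close>
  define f0 where "f0 = (\<lambda>x. if x \<in> N' then 0 else f x)"
  have "(f0 has_integral F b - F a) (cbox a b)"
    unfolding has_integral
  proof (intro allI impI)
    fix e :: real assume "e > 0"
    \<comment> \<open>The summand 1 covers the degenerate case \<open>a = b\<close> and makes the
      second bound strict.\<close>
    define e1 where "e1 = e / (2 * (b - a + 1))"
    have "e1 > 0" "e1 * (b - a) < e / 2"
      using \<open>e > 0\<close> ab by (auto simp: e1_def field_simps)
    obtain \<eta> where "\<eta> > 0" and \<eta>: "\<And>S l r. \<lbrakk>finite (S :: (real \<times> real set) set);
        \<And>i. i \<in> S \<Longrightarrow> a \<le> l i \<and> l i \<le> r i \<and> r i \<le> b;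
        disjoint_family_on (\<lambda>i. {l i<..<r i}) S; (\<Sum>i\<in>S. r i - l i) < \<eta>\<rbrakk>
      \<Longrightarrow> (\<Sum>i\<in>S. \<bar>F (r i) - F (l i)\<bar>) < e / 2"
      using abs_cont_on_finite[OF AC half_gt_zero[OF \<open>e > 0\<close>], where 'a="real \<times> real set"] by blast
    obtain T where T: "open T" "N' \<subseteq> T" "T \<in> lmeasurable" "measure lebesgue T < \<eta>"
    proof -
      obtain T0 where T0: "open T0" "N' \<subseteq> T0" "T0 - N' \<in> lmeasurable" "emeasure lebesgue (T0 - N') < ennreal \<eta>"
        using sets_lebesgue_outer_open[OF negligible_imp_sets[OF N'] \<open>\<eta> > 0\<close>] by blast
      have "measure lebesgue (T0 - N') < \<eta>"
        using T0(3,4) \<open>\<eta> > 0\<close> by (metis emeasure_eq_measure2 ennreal_less_iff measure_nonneg)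
      moreover have T0_eq: "T0 = (T0 - N') \<union> N'" using T0 by blast
      have "T0 \<in> lmeasurable"
        by (subst T0_eq) (intro fmeasurable.Un T0(3) negligible_imp_measurable N')
      moreover have "measure lebesgue T0 = measure lebesgue (T0 - N')"
        using N' T0(3) measure_Un_null_set[of "T0 - N'" lebesgue N'] T0_eq
        by (auto simp: negligible_iff_null_sets)
      ultimately show thesis
        using that T0 by simp
    qed
    have "\<exists>d>0. \<forall>y. \<bar>y - x\<bar> < d \<longrightarrow> \<bar>F y - F x - f x * (y - x)\<bar> \<le> e1 * \<bar>y - x\<bar>"
      if "x \<in> {a<..<b} - N'" for x
      using has_real_derivative_local[OF der[of x] \<open>e1 > 0\<close>] that unfolding N'_def
      by (metis Diff_iff UnCI)
    then obtain d where d: "\<And>x. x \<in> {a<..<b} - N' \<Longrightarrow> d x > 0"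
      "\<And>x y. \<lbrakk>x \<in> {a<..<b} - N'; \<bar>y - x\<bar> < d x\<rbrakk> \<Longrightarrow> \<bar>F y - F x - f x * (y - x)\<bar> \<le> e1 * \<bar>y - x\<bar>"
      by metis
    define \<gamma> where "\<gamma> = (\<lambda>x. if x \<in> N' then T else if x \<in> {a<..<b} then ball x (d x) else ball x 1)"
    have "gauge \<gamma>"
      using T d(1) by (auto simp: gauge_def \<gamma>_def)
    moreover have "norm ((\<Sum>(x, k)\<in>p. measure lborel k *\<^sub>R f0 x) - (F b - F a)) < e"
      if p: "p tagged_division_of cbox a b" and fine: "\<gamma> fine p" for p
    proof -
      note pD = tagged_division_ofD[OF p]
      have K: "K = {Inf K..Sup K} \<and> x \<in> K \<and> a \<le> Inf K \<and> Inf K \<le> Sup K \<and> Sup K \<le> b"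
        if xK: "(x, K) \<in> p" for x K
      proof -
        obtain u v where uv: "K = cbox u v" using pD(4)[OF xK] by blast
        have "x \<in> K" "K \<subseteq> cbox a b" using pD(2,3)[OF xK] by auto
        then show ?thesis using uv by auto
      qed
      have F_sum: "(\<Sum>(x,K)\<in>p. F (Sup K) - F (Inf K)) = F b - F a"
        using additive_tagged_division_1[OF ab] p by auto
      define p1 where "p1 = {(x,K)\<in>p. x \<notin> N'}"
      define p2 where "p2 = {(x,K)\<in>p. x \<in> N'}"
      have p12: "p = p1 \<union> p2" "p1 \<inter> p2 = {}" "finite p1" "finite p2"
        using pD(1) by (auto simp: p1_def p2_def intro: finite_subset)
      let ?g = "\<lambda>(x,K). measure lborel K * f0 x - (F (Sup K) - F (Inf K))"
      have "(\<Sum>(x, k)\<in>p. measure lborel k *\<^sub>R f0 x) - (F b - F a) = sum ?g p"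
        unfolding F_sum[symmetric] by (simp add: sum_subtractf split_def)
      also have "\<dots> = sum ?g p1 + sum ?g p2"
        using p12 by (simp add: sum.union_disjoint)
      finally have eq: "(\<Sum>(x, k)\<in>p. measure lborel k *\<^sub>R f0 x) - (F b - F a) = sum ?g p1 + sum ?g p2" .
      have "\<bar>sum ?g p1\<bar> \<le> (\<Sum>(x,K)\<in>p1. e1 * measure lborel K)"
      proof (rule order_trans[OF sum_abs sum_mono], clarify)
        fix x K assume xK: "(x, K) \<in> p1"
        then have xKp: "(x,K) \<in> p" and xN: "x \<notin> N'" by (auto simp: p1_def)
        note k = K[OF xKp]
        have xI: "x \<in> {a<..<b} - N'" using k xN unfolding N'_def
          by (metis Diff_iff UnCI atLeastAtMost_iff greaterThanLessThan_iff insertCI le_less order.trans)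
        have "K \<subseteq> ball x (d x)" using fineD[OF fine xKp] xI xN by (simp add: \<gamma>_def)
        moreover have "Inf K \<in> K" "Sup K \<in> K" "Inf K \<le> x" "x \<le> Sup K"
          using k by (metis atLeastAtMost_iff order_refl)+
        ultimately have "\<bar>(Sup K - Inf K) * f x - (F (Sup K) - F (Inf K))\<bar> \<le> e1 * (Sup K - Inf K)"
          by (intro has_real_derivative_straddle[OF d(2)[OF xI]]) (auto simp: dist_real_def)
        moreover have "measure lborel K = Sup K - Inf K"
          using k by (metis measure_lborel_Icc)
        ultimately show "\<bar>measure lborel K * f0 x - (F (Sup K) - F (Inf K))\<bar> \<le> e1 * measure lborel K"
          using xN by (simp add: f0_def)
      qed
      also have "\<dots> \<le> (\<Sum>(x,K)\<in>p. e1 * measure lborel K)"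
        using pD(1) \<open>e1 > 0\<close> by (intro sum_mono2) (auto simp: p12(1))
      also have "\<dots> = e1 * (b - a)"
        using additive_content_tagged_division[OF p] ab
        by (simp add: split_def sum_distrib_left[symmetric])
      finally have b1: "\<bar>sum ?g p1\<bar> \<le> e1 * (b - a)" .
      have "(\<Sum>i\<in>p2. \<bar>F (Sup (snd i)) - F (Inf (snd i))\<bar>) < e / 2"
      proof (rule \<eta>)
        show "finite p2" by fact
        show "a \<le> Inf (snd i) \<and> Inf (snd i) \<le> Sup (snd i) \<and> Sup (snd i) \<le> b" if "i \<in> p2" for i
          using K that by (auto simp: p2_def)
        have int: "interior (snd i) = {Inf (snd i)<..<Sup (snd i)}" if "i \<in> p" for i
          using K[of "fst i" "snd i"] that by (metis interior_atLeastAtMost_real prod.collapse)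
        show dj: "disjoint_family_on (\<lambda>i. {Inf (snd i)<..<Sup (snd i)}) p2"
          unfolding disjoint_family_on_def using int pD(5) p12(1) by (metis UnI2 prod.collapse)
        have "(\<Sum>i\<in>p2. Sup (snd i) - Inf (snd i)) = (\<Sum>i\<in>p2. measure lebesgue {Inf (snd i)<..<Sup (snd i)})"
          using K by (intro sum.cong) (auto simp: p2_def)
        also have "\<dots> = measure lebesgue (\<Union>i\<in>p2. {Inf (snd i)<..<Sup (snd i)})"
          using dj p12(4) K by (intro measure_finite_Union[symmetric]) (auto simp: p2_def)
        also have "\<dots> \<le> measure lebesgue T"
        proof (rule measure_mono_fmeasurable)
          show "(\<Union>i\<in>p2. {Inf (snd i)<..<Sup (snd i)}) \<subseteq> T"
          proof clarify
            fix y x K assume "(x,K) \<in> p2" "y \<in> {Inf (snd (x,K))<..<Sup (snd (x,K))}"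
            then have "y \<in> K" "K \<subseteq> T"
              using K[of x K] fineD[OF fine, of x K] by (auto simp: p2_def \<gamma>_def)
            then show "y \<in> T" by blast
          qed
        qed (use T p12 in auto)
        finally show "(\<Sum>i\<in>p2. Sup (snd i) - Inf (snd i)) < \<eta>" using T by linarith
      qed
      moreover have "\<bar>sum ?g p2\<bar> \<le> (\<Sum>i\<in>p2. \<bar>F (Sup (snd i)) - F (Inf (snd i))\<bar>)"
        by (rule order_trans[OF sum_abs sum_mono]) (auto simp: p2_def f0_def)
      ultimately show ?thesis
        using b1 eq \<open>e1 * (b - a) < e / 2\<close> by simp
    qed
    ultimately show "\<exists>\<gamma>. gauge \<gamma> \<and> (\<forall>\<D>. \<D> tagged_division_of cbox a b \<and> \<gamma> fine \<D> \<longrightarrow>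
        norm ((\<Sum>(x, k)\<in>\<D>. measure lborel k *\<^sub>R f0 x) - (F b - F a)) < e)"
      by (intro exI[of _ \<gamma>]) auto
  qed
  then show ?thesis
    using has_integral_spike[OF N', of "{a..b}" f f0] by (auto simp: f0_def)
qed

text \<open>Lebesgue differentiation through a Vitali covering. At a bad point there are arbitrarily
  short intervals, starting or ending there, that violate the derivative estimate by at least
  \<open>e\<close> times their length. Henstock's lemma bounds the total violation of disjoint ones
  by \<open>e * \<epsilon>\<close>, hence their total length by \<epsilon>.\<close>

lemma integral_differentiable_ae:
  fixes h :: "real \<Rightarrow> real"
  assumes h: "h integrable_on {a..b}"
  obtains N where "negligible N"
    "\<And>x. x \<in> {a<..<b} - N \<Longrightarrow> ((\<lambda>x. integral {a..x} h) has_real_derivative h x) (at x)"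
proof -
  define F where "F = (\<lambda>x. integral {a..x} h)"
  have F_diff: "integral {x..y} h = F y - F x" if "a \<le> x" "x \<le> y" "y \<le> b" for x y
    unfolding F_def using Henstock_Kurzweil_Integration.integral_combine[of a x y h]
      integrable_on_subinterval[OF h, of a y] that by simp
  define E where "E = (\<lambda>e. {x \<in> {a<..<b}. \<forall>d>0. \<exists>y\<in>{a..b}. 0 < \<bar>y - x\<bar> \<and> \<bar>y - x\<bar> < d
      \<and> \<bar>F y - F x - h x * (y - x)\<bar> \<ge> e * \<bar>y - x\<bar>})"
  have E_neg: "negligible (E e)" if "e > 0" for e
    unfolding negligible_outer_le
  proof (intro allI impI)
    fix \<epsilon> :: real assume "\<epsilon> > 0"
    obtain \<gamma> where g: "gauge \<gamma>" and hen: "\<And>p. \<lbrakk>p tagged_partial_division_of (cbox a b); \<gamma> fine p\<rbrakk> \<Longrightarrow>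
             sum (\<lambda>(x,k). norm(measure lborel k *\<^sub>R h x - integral k h)) p < e * \<epsilon>"
      using Henstock_lemma[of h a b "e * \<epsilon>"] h \<open>e > 0\<close> \<open>\<epsilon> > 0\<close> by (auto simp: box_real)
    \<comment> \<open>The interval with end points x and y is encoded as a closed ball, the form
      that the covering theorem takes; its tag x is an end point, not the centre.\<close>
    define mid where "mid = (\<lambda>(x::real,y::real). (x + y) / 2)"
    define rad where "rad = (\<lambda>(x::real,y::real). \<bar>y - x\<bar> / 2)"
    define J where "J = (\<lambda>i. cball (mid i) (rad i))"
    have J: "J (x,y) = {min x y..max x y}" for x y
      by (auto simp: J_def mid_def rad_def cball_eq_atLeastAtMost min_def max_def abs_if field_simps)
    define K where "K = {(x,y). x \<in> E e \<and> y \<in> {a..b} \<and> y \<noteq> x \<and> J (x,y) \<subseteq> \<gamma> x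
        \<and> \<bar>F y - F x - h x * (y - x)\<bar> \<ge> e * \<bar>y - x\<bar>}"
    have rpos: "0 < rad i" if "i \<in> K" for i
      using that by (auto simp: K_def rad_def)
    have vit: "\<exists>i. i \<in> K \<and> x \<in> cball (mid i) (rad i) \<and> rad i < d" if x: "x \<in> E e" and "0 < d" for x d
    proof -
      obtain d1 where "d1 > 0" and d1: "ball x d1 \<subseteq> \<gamma> x"
        using g unfolding gauge_def by (meson open_contains_ball)
      obtain y where y: "y \<in> {a..b}" "0 < \<bar>y - x\<bar>" "\<bar>y - x\<bar> < min d d1"
        "\<bar>F y - F x - h x * (y - x)\<bar> \<ge> e * \<bar>y - x\<bar>"
        using x \<open>d1 > 0\<close> \<open>d > 0\<close> unfolding E_def by (auto dest!: spec[of _ "min d d1"])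
      have "J (x,y) \<subseteq> ball x d1"
        unfolding J using y(3) by (auto simp: dist_real_def min_def max_def abs_if split: if_splits)
      then have "(x,y) \<in> K" using x y d1 by (auto simp: K_def)
      moreover have "x \<in> cball (mid (x,y)) (rad (x,y))" using J[of x y] by (auto simp: J_def)
      moreover have "rad (x,y) < d" using y(3) \<open>0 < d\<close> by (simp add: rad_def)
      ultimately show ?thesis by blast
    qed
    obtain C where C: "countable C" "C \<subseteq> K"
      "pairwise (\<lambda>i j. disjnt (cball (mid i) (rad i)) (cball (mid j) (rad j))) C"
      "negligible (E e - (\<Union>i \<in> C. cball (mid i) (rad i)))"
      using Vitali_covering_theorem_cballs[of K rad "E e" mid, OF rpos vit] by blast
    have meas: "measure lebesgue (\<Union>i\<in>C'. J i) \<le> \<epsilon>" if C': "C' \<subseteq> C" "finite C'" for C'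
    proof -
      \<comment> \<open>Disjoint nonempty intervals are distinct, so the sum over tagged intervals
        can be reindexed by \<open>C'\<close>.\<close>
      have inj: "inj_on (\<lambda>i. (fst i, J i)) C'"
      proof (rule inj_onI)
        fix i j assume ij: "i \<in> C'" "j \<in> C'" "(fst i, J i) = (fst j, J j)"
        show "i = j"
        proof (rule ccontr)
          assume "i \<noteq> j"
          then have "disjnt (J i) (J j)" using C(3) C' ij unfolding pairwise_def J_def by blast
          moreover have "i \<in> K" using ij(1) C' C(2) by blast
          then have "mid i \<in> J i" using rpos[of i] by (simp add: J_def)
          ultimately show False using ij by (auto simp: disjnt_def)
        qed
      qed
      define p where "p = (\<lambda>i. (fst i, J i)) ` C'"
      have Kin: "i \<in> K" if "i \<in> C'" for i using that C' C(2) by blast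
      have "p tagged_partial_division_of (cbox a b)"
        unfolding tagged_partial_division_of_def
      proof (intro conjI allI impI)
        show "finite p" using C' by (simp add: p_def)
        fix x k assume "(x,k) \<in> p"
        then obtain y where xy: "(x,y) \<in> C'" "k = J (x,y)" by (auto simp: p_def)
        then have "(x,y) \<in> K" using Kin by blast
        then have "x \<in> {a..b}" "y \<in> {a..b}" by (auto simp: K_def E_def)
        then show "x \<in> k" "k \<subseteq> cbox a b" "\<exists>u v. k = cbox u v"
          unfolding xy(2) J by (auto simp: min_def max_def)
      next
        fix x1 K1 x2 K2 assume as: "(x1, K1) \<in> p \<and> (x2, K2) \<in> p \<and> (x1, K1) \<noteq> (x2, K2)"
        then obtain i j where ij: "i \<in> C'" "j \<in> C'" "K1 = J i" "K2 = J j" "i \<noteq> j" by (auto simp: p_def)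
        then have "disjnt (J i) (J j)" using C(3) C' unfolding pairwise_def J_def by blast
        then show "interior K1 \<inter> interior K2 = {}"
          using ij interior_subset unfolding disjnt_def by blast
      qed
      moreover have "\<gamma> fine p"
        unfolding p_def fine_def using Kin by (fastforce simp: K_def)
      ultimately have "sum (\<lambda>(x,k). norm(measure lborel k *\<^sub>R h x - integral k h)) p < e * \<epsilon>"
        by (rule hen)
      then have A: "(\<Sum>i\<in>C'. \<bar>measure lborel (J i) * h (fst i) - integral (J i) h\<bar>) < e * \<epsilon>"
        unfolding p_def using inj by (simp add: sum.reindex)
      \<comment> \<open>Up to sign, \<open>F y - F x\<close> is the integral over
        \<open>J i\<close>, so membership in \<open>K\<close> bounds each Henstock error from
        below.\<close>
      have B: "e * measure lebesgue (J i) \<le> \<bar>measure lborel (J i) * h (fst i) - integral (J i) h\<bar>"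
        if "i \<in> C'" for i
      proof -
        obtain x y where i: "i = (x,y)" by (cases i)
        have K: "(x,y) \<in> K" using Kin that i by blast
        then have xy: "x \<in> {a..b}" "y \<in> {a..b}" "e * \<bar>y - x\<bar> \<le> \<bar>F y - F x - h x * (y - x)\<bar>"
          by (auto simp: K_def E_def)
        show ?thesis
        proof (cases "x \<le> y")
          case True
          then show ?thesis using xy F_diff[of x y] unfolding i J
            by (simp add: abs_minus_commute mult.commute)
        next
          case False
          then show ?thesis using xy F_diff[of y x] unfolding i J
            by (simp add: min_def max_def abs_if algebra_simps split: if_splits)
        qed
      qed
      have "e * measure lebesgue (\<Union>i\<in>C'. J i) \<le> e * (\<Sum>i\<in>C'. measure lebesgue (J i))"
        using \<open>e > 0\<close> by (intro mult_left_mono measure_UNION_le) (use C' in \<open>auto simp: J_def\<close>)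
      also have "\<dots> = (\<Sum>i\<in>C'. e * measure lebesgue (J i))" by (simp add: sum_distrib_left)
      also have "\<dots> \<le> (\<Sum>i\<in>C'. \<bar>measure lborel (J i) * h (fst i) - integral (J i) h\<bar>)"
        by (intro sum_mono B)
      also have "\<dots> \<le> e * \<epsilon>" using A by simp
      finally show ?thesis using \<open>e > 0\<close> by simp
    qed
    have lm: "J i \<in> lmeasurable" for i by (simp add: J_def)
    have U: "(\<Union>i\<in>C. J i) \<in> lmeasurable" "measure lebesgue (\<Union>i\<in>C. J i) \<le> \<epsilon>"
      using fmeasurable_UN_bound[OF C(1) lm meas] measure_UN_bound[OF C(1) lm meas] by auto
    let ?R = "E e - (\<Union>i \<in> C. cball (mid i) (rad i))"
    have "E e \<subseteq> (\<Union>i\<in>C. J i) \<union> ?R" by (auto simp: J_def)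
    moreover have "(\<Union>i\<in>C. J i) \<union> ?R \<in> lmeasurable"
      using U(1) negligible_imp_measurable[OF C(4)] by (rule fmeasurable.Un)
    moreover have "measure lebesgue ((\<Union>i\<in>C. J i) \<union> ?R) \<le> \<epsilon>"
      using U C(4) measure_Un_null_set[of "\<Union>i\<in>C. J i" lebesgue ?R]
      by (simp add: negligible_iff_null_sets fmeasurableD)
    ultimately show "\<exists>T. E e \<subseteq> T \<and> T \<in> lmeasurable \<and> measure lebesgue T \<le> \<epsilon>" by blast
  qed
  define N where "N = (\<Union>n. E (1 / real (Suc n)))"
  show thesis
  proof (rule that)
    show "negligible N" unfolding N_def by (intro negligible_countable_Union) (auto simp: E_neg)
    fix x assume x: "x \<in> {a<..<b} - N"
    show "((\<lambda>x. integral {a..x} h) has_real_derivative h x) (at x)"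
      unfolding has_field_derivative_def has_derivative_at_alt F_def[symmetric]
    proof (intro conjI allI impI)
      show "bounded_linear ((*) (h x))" by (rule bounded_linear_mult_right)
      fix e :: real assume "e > 0"
      obtain n where n: "1 / real (Suc n) < e" using \<open>e > 0\<close> by (metis nat_approx_posE)
      have "x \<notin> E (1 / real (Suc n))" using x by (auto simp: N_def)
      then obtain d where "d > 0" and d: "\<And>y. \<lbrakk>y \<in> {a..b}; 0 < \<bar>y - x\<bar>; \<bar>y - x\<bar> < d\<rbrakk> \<Longrightarrow>
          \<bar>F y - F x - h x * (y - x)\<bar> < 1 / real (Suc n) * \<bar>y - x\<bar>"
        using x unfolding E_def mem_Collect_eq by (meson Diff_iff not_le)
      \<comment> \<open>The neighbourhood must also stay inside \<open>{a..b}\<close>, the only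
        place where the set \<open>E\<close> tests increments.\<close>
      define d' where "d' = min d (min (x - a) (b - x))"
      have "\<bar>F y - F x - h x * (y - x)\<bar> \<le> e * \<bar>y - x\<bar>" if "\<bar>y - x\<bar> < d'" for y
      proof (cases "y = x")
        case False
        have "y \<in> {a..b}" "\<bar>y - x\<bar> < d" using that by (auto simp: d'_def abs_if split: if_splits)
        then have "\<bar>F y - F x - h x * (y - x)\<bar> < 1 / real (Suc n) * \<bar>y - x\<bar>" using d False by simp
        also have "\<dots> \<le> e * \<bar>y - x\<bar>" using n by (intro mult_right_mono) auto
        finally show ?thesis by simp
      qed simp
      moreover have "d' > 0" using \<open>d > 0\<close> x by (auto simp: d'_def)
      ultimately show "\<exists>d>0. \<forall>y. norm (y - x) < d \<longrightarrow> norm (F y - F x - h x * (y - x)) \<le> e * norm (y - x)"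
        by (intro exI[of _ d']) auto
    qed
  qed
qed

lemma sum_integral_disjoint_le:
  fixes g :: "real \<Rightarrow> real"
  assumes g: "g integrable_on {a..b}" "\<And>x. x \<in> {a..b} \<Longrightarrow> 0 \<le> g x"
    and S: "finite S" "\<And>i. i \<in> S \<Longrightarrow> a \<le> l i \<and> l i \<le> r i \<and> r i \<le> b"
    and dj: "disjoint_family_on (\<lambda>i. {l i<..<r i}) S"
  shows "(\<Sum>i\<in>S. integral {l i..r i} g) \<le> integral {a..b} g"
proof -
  have 1: "(g has_integral integral {l i..r i} g) {l i<..<r i}" if "i \<in> S" for i
    using integrable_on_subinterval[OF g(1), of "l i" "r i"] S(2)[OF that]
    by (simp add: has_integral_Icc_iff_Ioo[symmetric] integrable_integral)
  have "(g has_integral (\<Sum>i\<in>S. integral {l i..r i} g)) (\<Union>i\<in>S. {l i<..<r i})"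
    using dj by (intro has_integral_UN S 1) (auto simp: pairwise_def disjoint_family_on_def)
  moreover have "(\<Union>i\<in>S. {l i<..<r i}) \<subseteq> {a..b}"
    using S(2) by fastforce
  ultimately show ?thesis
    using integrable_integral[OF g(1)] g(2) by (metis has_integral_subset_le)
qed

text \<open>Cutting \<open>g\<close> at a height k leaves a remainder of integral below \<epsilon>/2
  by dominated convergence, whatever intervals are chosen; the bounded part contributes at most k
  times their total length.\<close>

lemma abs_cont_on_integral_bound:
  fixes F g :: "real \<Rightarrow> real"
  assumes g: "g integrable_on {a..b}" "\<And>x. x \<in> {a..b} \<Longrightarrow> 0 \<le> g x"
    and F: "\<And>x y. \<lbrakk>a \<le> x; x \<le> y; y \<le> b\<rbrakk> \<Longrightarrow> \<bar>F y - F x\<bar> \<le> integral {x..y} g"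
  shows "abs_cont_on a b F"
  unfolding abs_cont_on_def
proof (intro allI impI)
  fix \<epsilon> :: real assume "\<epsilon> > 0"
  define G where "G = (\<lambda>k x. min (g x) (real k))"
  have Gi: "G k integrable_on {a..b}" for k
  proof -
    have "g absolutely_integrable_on {a..b}"
      using g by (intro nonnegative_absolutely_integrable_1) auto
    then show ?thesis unfolding G_def
      by (intro set_lebesgue_integral_eq_integral(1) absolutely_integrable_min_1) auto
  qed
  have "(\<lambda>k. integral {a..b} (G k)) \<longlonglongrightarrow> integral {a..b} g"
  proof (rule dominated_convergence(2)[OF Gi g(1)])
    show "norm (G k x) \<le> g x" if "x \<in> {a..b}" for k x
      using g(2)[OF that] by (auto simp: G_def)
    show "(\<lambda>k. G k x) \<longlonglongrightarrow> g x" if "x \<in> {a..b}" for x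
    proof (rule tendsto_eventually)
      obtain n where "g x \<le> real n" using real_arch_simple by blast
      then show "\<forall>\<^sub>F k in sequentially. G k x = g x"
        by (intro eventually_sequentiallyI[of n]) (simp add: G_def min_def)
    qed
  qed
  then obtain k where "norm (integral {a..b} (G k) - integral {a..b} g) < \<epsilon> / 2"
    using LIMSEQ_D[of _ _ "\<epsilon> / 2"] \<open>\<epsilon> > 0\<close> by (metis half_gt_zero order_refl)
  then have k: "integral {a..b} g - integral {a..b} (G k) < \<epsilon> / 2" by (simp add: abs_if split: if_splits)
  define \<eta> where "\<eta> = \<epsilon> / (2 * (real k + 1))"
  have "\<eta> > 0" using \<open>\<epsilon> > 0\<close> by (simp add: \<eta>_def)
  have "(\<Sum>i<n. \<bar>F (r i) - F (l i)\<bar>) < \<epsilon>"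
    if lr: "\<And>i. i < n \<Longrightarrow> a \<le> l i \<and> l i \<le> r i \<and> r i \<le> b"
      and dj: "disjoint_family_on (\<lambda>i. {l i<..<r i}) {..<n}" and sm: "(\<Sum>i<n. r i - l i) < \<eta>"
    for n :: nat and l r
  proof -
    have gs: "g integrable_on {l i..r i}" "G k integrable_on {l i..r i}" if "i < n" for i
      using lr[OF that] integrable_on_subinterval[OF g(1)] integrable_on_subinterval[OF Gi[of k]] by auto
    have le: "\<bar>F (r i) - F (l i)\<bar> \<le> integral {l i..r i} (\<lambda>x. g x - G k x) + real k * (r i - l i)"
      if "i < n" for i
    proof -
      have "\<bar>F (r i) - F (l i)\<bar> \<le> integral {l i..r i} g" using F lr[OF that] by auto
      also have "\<dots> = integral {l i..r i} (\<lambda>x. g x - G k x) + integral {l i..r i} (G k)"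
        using gs[OF that] by (simp add: Henstock_Kurzweil_Integration.integral_diff)
      also have "integral {l i..r i} (G k) \<le> integral {l i..r i} (\<lambda>x. real k)"
        by (intro integral_le gs that) (auto simp: G_def)
      also have "\<dots> = real k * (r i - l i)" using lr[OF that] by simp
      finally show ?thesis by simp
    qed
    have "(\<Sum>i<n. \<bar>F (r i) - F (l i)\<bar>)
        \<le> (\<Sum>i<n. integral {l i..r i} (\<lambda>x. g x - G k x)) + real k * (\<Sum>i<n. r i - l i)"
      using sum_mono[OF le, of "{..<n}" "\<lambda>i. i"] by (simp add: sum.distrib sum_distrib_left)
    also have "(\<Sum>i<n. integral {l i..r i} (\<lambda>x. g x - G k x)) \<le> integral {a..b} (\<lambda>x. g x - G k x)"
      using lr dj g Gi
      by (intro sum_integral_disjoint_le Henstock_Kurzweil_Integration.integrable_diff) (auto simp: G_def)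
    also have "\<dots> < \<epsilon> / 2"
      using k g(1) Gi by (simp add: Henstock_Kurzweil_Integration.integral_diff)
    also have "real k * (\<Sum>i<n. r i - l i) \<le> real k * \<eta>"
      using sm by (intro mult_left_mono) auto
    also have "\<dots> \<le> \<epsilon> / 2"
      using \<open>\<epsilon> > 0\<close> by (simp add: \<eta>_def field_simps)
    finally show ?thesis by simp
  qed
  then show "\<exists>\<eta>>0. \<forall>(n::nat) l r. (\<forall>i<n. a \<le> l i \<and> l i \<le> r i \<and> r i \<le> b)
        \<and> disjoint_family_on (\<lambda>i. {l i<..<r i}) {..<n} \<and> (\<Sum>i<n. r i - l i) < \<eta>
        \<longrightarrow> (\<Sum>i<n. \<bar>F (r i) - F (l i)\<bar>) < \<epsilon>"
    using \<open>\<eta> > 0\<close> by (intro exI[of _ \<eta>]) auto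
qed

section \<open>The equation as a first-order system\<close>

text \<open>The inverse of \<open>phi_p p\<close>, and at the same time \<open>phi_p\<close> for the
  conjugate exponent p / (p - 1).\<close>

definition psi_p :: "real \<Rightarrow> real \<Rightarrow> real" where
  "psi_p p t = sgn t * \<bar>t\<bar> powr (1 / (p - 1))"

lemma psi_p_nonneg: "0 \<le> t \<Longrightarrow> psi_p p t = t powr (1 / (p - 1))"
  by (cases "t = 0") (auto simp: psi_p_def)

lemma psi_p_0 [simp]: "psi_p p 0 = 0"
  by (simp add: psi_p_def)

lemma psi_p_minus [simp]: "psi_p p (- t) = - psi_p p t"
  by (simp add: psi_p_def sgn_minus)

lemma phi_p_0 [simp]: "phi_p p 0 = 0"
  by (simp add: phi_p_def)

lemma phi_p_minus [simp]: "phi_p p (- t) = - phi_p p t"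
  by (simp add: phi_p_def)

lemma phi_p_nonneg:
  assumes "0 \<le> t"
  shows "phi_p p t = t powr (p - 1)"
proof (cases "t = 0")
  case False
  then have "t powr (p - 2) * t powr 1 = t powr (p - 1)"
    by (subst powr_add[symmetric]) simp
  then show ?thesis using assms False by (simp add: phi_p_def)
qed simp

lemma psi_phi_p [simp]:
  assumes "1 < p"
  shows "psi_p p (phi_p p t) = t"
proof -
  have "psi_p p (phi_p p s) = s" if "0 \<le> s" for s
    using assms that by (simp add: phi_p_nonneg psi_p_nonneg powr_powr)
  from this[of t] this[of "- t"] show ?thesis by (cases "0 \<le> t") auto
qed

lemma phi_psi_p [simp]:
  assumes "1 < p"
  shows "phi_p p (psi_p p t) = t"
proof -
  have "phi_p p (psi_p p s) = s" if "0 \<le> s" for s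
    using assms that by (simp add: phi_p_nonneg psi_p_nonneg powr_powr)
  from this[of t] this[of "- t"] show ?thesis by (cases "0 \<le> t") auto
qed

lemma psi_p_strict_mono:
  assumes "1 < p" "s < t"
  shows "psi_p p s < psi_p p t"
proof -
  have pos: "psi_p p s < psi_p p t" if "0 \<le> s" "s < t" for s t
    using that assms by (simp add: psi_p_nonneg powr_less_mono2)
  consider "0 \<le> s" | "s < 0" "0 < t" | "t \<le> 0" by linarith
  then show ?thesis
  proof cases
    case 2
    then have "psi_p p s < 0" "0 < psi_p p t"
      using pos[of 0 "- s"] pos[of 0 t] by auto
    then show ?thesis by simp
  next
    case 3
    then show ?thesis using pos[of "- t" "- s"] assms by simp
  qed (use pos assms in auto)
qed

lemma psi_p_less_iff [simp]: "1 < p \<Longrightarrow> psi_p p s < psi_p p t \<longleftrightarrow> s < t"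
  using psi_p_strict_mono by (metis linorder_neqE not_less_iff_gr_or_eq)

lemma psi_p_le_iff [simp]: "1 < p \<Longrightarrow> psi_p p s \<le> psi_p p t \<longleftrightarrow> s \<le> t"
  using psi_p_less_iff by (metis linorder_not_less)

lemma psi_p_nonneg_iff [simp]: "1 < p \<Longrightarrow> 0 \<le> psi_p p t \<longleftrightarrow> 0 \<le> t"
  using psi_p_le_iff[of p 0 t] by simp

lemma psi_p_pos_iff [simp]: "1 < p \<Longrightarrow> 0 < psi_p p t \<longleftrightarrow> 0 < t"
  using psi_p_less_iff[of p 0 t] by simp

lemma psi_p_eq_0_iff [simp]: "psi_p p t = 0 \<longleftrightarrow> t = 0"
  by (auto simp: psi_p_def sgn_if)

lemma psi_p_abs: "\<bar>psi_p p t\<bar> = psi_p p \<bar>t\<bar>"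
  by (simp add: psi_p_def abs_mult sgn_if)

lemma phi_p_less_iff [simp]: "1 < p \<Longrightarrow> phi_p p s < phi_p p t \<longleftrightarrow> s < t"
  by (metis psi_p_less_iff psi_phi_p)

lemma phi_p_le_iff [simp]: "1 < p \<Longrightarrow> phi_p p s \<le> phi_p p t \<longleftrightarrow> s \<le> t"
  by (metis psi_p_le_iff psi_phi_p)

lemma isCont_psi_p:
  assumes "1 < p"
  shows "isCont (psi_p p) t"
proof -
  consider "t < 0" | "t = 0" | "0 < t" by linarith
  then show ?thesis
  proof cases
    case 1
    have "isCont (\<lambda>t. - ((- t) powr (1 / (p - 1)))) t"
      using 1 by (intro continuous_intros) auto
    moreover have ev: "\<forall>\<^sub>F s in nhds t. - ((- s) powr (1 / (p - 1))) = psi_p p s"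
      by (rule eventually_nhds_in_open[OF open_lessThan[of 0], THEN eventually_mono])
        (use 1 in \<open>auto simp: psi_p_def\<close>)
    ultimately show ?thesis using isCont_cong[OF ev] by simp
  next
    case 2
    have "((\<lambda>s. \<bar>s\<bar> powr (1 / (p - 1))) \<longlongrightarrow> 0) (at 0)"
      using assms by (intro tendsto_zero_powrI[of "\<lambda>s. \<bar>s\<bar>" _ "\<lambda>_. 1 / (p - 1)" "1 / (p - 1)"]
          tendsto_rabs_zero tendsto_ident_at tendsto_const) (auto intro: always_eventually)
    then have "((\<lambda>s. psi_p p s) \<longlongrightarrow> 0) (at 0)"
      by (rule Lim_null_comparison[rotated]) (auto intro!: always_eventually simp: psi_p_def abs_mult sgn_if)
    then show ?thesis using 2 by (simp add: isCont_def)
  next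
    case 3
    have "isCont (\<lambda>t. t powr (1 / (p - 1))) t"
      using 3 by (intro continuous_intros) auto
    moreover have ev: "\<forall>\<^sub>F s in nhds t. s powr (1 / (p - 1)) = psi_p p s"
      by (rule eventually_nhds_in_open[OF open_greaterThan[of 0], THEN eventually_mono])
        (use 3 in \<open>auto simp: psi_p_def\<close>)
    ultimately show ?thesis using isCont_cong[OF ev] by simp
  qed
qed

lemma continuous_on_psi_p [continuous_intros]:
  "1 < p \<Longrightarrow> continuous_on S f \<Longrightarrow> continuous_on S (\<lambda>x. psi_p p (f x))"
  by (rule continuous_on_compose2[of UNIV "psi_p p"])
    (auto intro: continuous_at_imp_continuous_on isCont_psi_p)

text \<open>\<open>D\<close> plays the role of \<open>phi_p p u'\<close>, so that both equations can be kept in integrated form.\<close>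

definition plap_sys ::
    "real \<Rightarrow> real \<Rightarrow> real \<Rightarrow> (real \<Rightarrow> real) \<Rightarrow> (real \<Rightarrow> real) \<Rightarrow> (real \<Rightarrow> real) \<Rightarrow> bool" where
  "plap_sys p a b u D f \<longleftrightarrow> f absolutely_integrable_on {a..b}
     \<and> (\<forall>x y. a \<le> x \<and> x \<le> y \<and> y \<le> b \<longrightarrow> D x - D y = integral {x..y} f)
     \<and> (\<forall>x y. a \<le> x \<and> x \<le> y \<and> y \<le> b \<longrightarrow> u y - u x = integral {x..y} (\<lambda>t. psi_p p (D t)))"

lemma plap_sysD:
  assumes "plap_sys p a b u D f"
  shows "f absolutely_integrable_on {a..b}" "f integrable_on {a..b}"
    "\<And>x y. \<lbrakk>a \<le> x; x \<le> y; y \<le> b\<rbrakk> \<Longrightarrow> D x - D y = integral {x..y} f"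
    "\<And>x y. \<lbrakk>a \<le> x; x \<le> y; y \<le> b\<rbrakk> \<Longrightarrow> u y - u x = integral {x..y} (\<lambda>t. psi_p p (D t))"
  using assms by (auto simp: plap_sys_def intro: set_lebesgue_integral_eq_integral(1))

lemma plap_sys_subinterval:
  assumes "plap_sys p a b u D f" "a \<le> c" "d \<le> b"
  shows "plap_sys p c d u D f"
  unfolding plap_sys_def
proof (intro conjI)
  show "f absolutely_integrable_on {c..d}"
    using plap_sysD(1)[OF assms(1)] by (rule absolutely_integrable_on_subinterval) (use assms in auto)
qed (use assms in \<open>auto simp: plap_sys_def\<close>)

lemma plap_sys_continuous_D:
  assumes "plap_sys p a b u D f"
  shows "continuous_on {a..b} D"
proof -
  have "continuous_on {a..b} (\<lambda>x. D a - integral {a..x} f)"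
    using plap_sysD(2)[OF assms] by (intro continuous_intros indefinite_integral_continuous_1)
  then show ?thesis
    by (rule continuous_on_eq) (use plap_sysD(3)[OF assms, of a] in fastforce)
qed

lemma plap_sys_has_derivative:
  assumes "1 < p" "plap_sys p a b u D f" "x \<in> {a..b}"
  shows "(u has_real_derivative psi_p p (D x)) (at x within {a..b})"
proof -
  have "((\<lambda>y. u a + integral {a..y} (\<lambda>t. psi_p p (D t))) has_real_derivative psi_p p (D x)) (at x within {a..b})"
    using assms plap_sys_continuous_D[OF assms(2)]
    by (auto intro!: derivative_eq_intros integral_has_real_derivative continuous_intros)
  then show ?thesis
    by (rule has_field_derivative_transform_within[OF _ zero_less_one assms(3)])
      (use plap_sysD(4)[OF assms(2), of a] in fastforce)
qed

lemma plap_sys_has_derivative_at: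
  assumes "1 < p" "plap_sys p a b u D f" "x \<in> {a<..<b}"
  shows "(u has_real_derivative psi_p p (D x)) (at x)"
  using plap_sys_has_derivative[OF assms(1,2), of x] assms(3)
    at_within_Icc_at[of a x b] by auto

lemma plap_sys_continuous_u:
  assumes "1 < p" "plap_sys p a b u D f"
  shows "continuous_on {a..b} u"
  using plap_sys_has_derivative[OF assms] by (meson DERIV_continuous continuous_on_eq_continuous_within)

lemma plap_sys_integrable_psi:
  assumes "1 < p" "plap_sys p a b u D f" "a \<le> x" "y \<le> b"
  shows "(\<lambda>t. psi_p p (D t)) integrable_on {x..y}"
  by (intro integrable_continuous_real continuous_intros assms
      continuous_on_subset[OF plap_sys_continuous_D[OF assms(2)]]) (use assms in auto)

section \<open>Reflection, change of representatives and gluing\<close>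

lemma has_integral_reflect_about:
  fixes h :: "real \<Rightarrow> real"
  shows "((\<lambda>t. h (c - t)) has_integral I) {c - y..c - x} \<longleftrightarrow> (h has_integral I) {x..y}"
  using has_integral_shift_real_ivl_iff[of "\<lambda>t. h (c - t)" I "c - y" "c - x" c] by simp

lemma integral_reflect_about:
  fixes h :: "real \<Rightarrow> real"
  shows "integral {x..y} (\<lambda>t. h (c - t)) = integral {c - y..c - x} h"
  using has_integral_reflect_about[of h c _ "c - x" "c - y"] by (simp add: integral_def integrable_on_def)

lemma integrable_reflect_about:
  fixes h :: "real \<Rightarrow> real"
  shows "(\<lambda>t. h (c - t)) integrable_on {x..y} \<longleftrightarrow> h integrable_on {c - y..c - x}"
  using has_integral_reflect_about[of h c _ "c - x" "c - y"] by (simp add: integrable_on_def)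

text \<open>Reflection reverses slopes and hence the sign of the flux, but it keeps the sign of the
  right-hand side. Every estimate proved at the left end is carried to the right end in this
  way.\<close>

lemma plap_sys_reflect:
  assumes "plap_sys p a b u D f"
  shows "plap_sys p (c - b) (c - a) (\<lambda>x. u (c - x)) (\<lambda>x. - D (c - x)) (\<lambda>x. f (c - x))"
  unfolding plap_sys_def
proof (intro conjI allI impI)
  show "(\<lambda>x. f (c - x)) absolutely_integrable_on {c - b..c - a}"
    using plap_sysD(1)[OF assms] by (simp add: absolutely_integrable_on_def integrable_reflect_about
        integrable_reflect_about[of "\<lambda>x. \<bar>f x\<bar>"])
next
  fix x y assume xy: "c - b \<le> x \<and> x \<le> y \<and> y \<le> c - a"
  show "- D (c - x) - - D (c - y) = integral {x..y} (\<lambda>x. f (c - x))"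
    unfolding integral_reflect_about using plap_sysD(3)[OF assms, of "c - y" "c - x"] xy by simp
  have "integral {x..y} (\<lambda>t. psi_p p (- D (c - t))) = - integral {c - y..c - x} (\<lambda>t. psi_p p (D t))"
    using integral_reflect_about[of x y "\<lambda>t. psi_p p (D t)"] by (simp add: Henstock_Kurzweil_Integration.integral_neg)
  then show "u (c - y) - u (c - x) = integral {x..y} (\<lambda>t. psi_p p (- D (c - t)))"
    using plap_sysD(4)[OF assms, of "c - y" "c - x"] xy by simp
qed

lemma plap_sys_cong:
  assumes "plap_sys p a b u D f"
    and "\<And>x. x \<in> {a..b} \<Longrightarrow> u x = u' x" "\<And>x. x \<in> {a..b} \<Longrightarrow> D x = D' x" "\<And>x. x \<in> {a..b} \<Longrightarrow> f x = f' x"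
  shows "plap_sys p a b u' D' f'"
  unfolding plap_sys_def
proof (intro conjI allI impI)
  show "f' absolutely_integrable_on {a..b}"
    using set_integrable_cong[of lebesgue lebesgue "{a..b}" "{a..b}" f f'] plap_sysD(1)[OF assms(1)] assms(4) by simp
next
  fix x y assume xy: "a \<le> x \<and> x \<le> y \<and> y \<le> b"
  have "integral {x..y} f = integral {x..y} f'"
    by (rule Henstock_Kurzweil_Integration.integral_cong) (use assms(4) xy in auto)
  then show "D' x - D' y = integral {x..y} f'"
    using plap_sysD(3)[OF assms(1), of x y] assms(3)[of x] assms(3)[of y] xy by simp
  have "integral {x..y} (\<lambda>t. psi_p p (D t)) = integral {x..y} (\<lambda>t. psi_p p (D' t))"
    by (rule Henstock_Kurzweil_Integration.integral_cong) (use assms(3) xy in auto)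
  then show "u' y - u' x = integral {x..y} (\<lambda>t. psi_p p (D' t))"
    using plap_sysD(4)[OF assms(1), of x y] assms(2)[of x] assms(2)[of y] xy by simp
qed

lemma plap_sys_glue:
  assumes p: "1 < p" and L: "plap_sys p a c u D f" and R: "plap_sys p c b u D f" and c: "a \<le> c" "c \<le> b"
  shows "plap_sys p a b u D f"
  unfolding plap_sys_def
proof (intro conjI allI impI)
  have "f absolutely_integrable_on {a..c} \<union> {c..b}"
    using plap_sysD(1)[OF L] plap_sysD(1)[OF R] by (rule absolutely_integrable_Un)
  then show fi: "f absolutely_integrable_on {a..b}"
    using c by (simp add: ivl_disj_un_two_touch(4))
  have "continuous_on ({a..c} \<union> {c..b}) D"
    by (intro continuous_on_closed_Un plap_sys_continuous_D[OF L] plap_sys_continuous_D[OF R]) auto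
  then have "continuous_on {a..b} D"
    using c by (simp add: ivl_disj_un_two_touch(4))
  then have psi: "(\<lambda>t. psi_p p (D t)) integrable_on {a..b}"
    by (intro integrable_continuous_real continuous_intros p)
  fix x y assume xy: "a \<le> x \<and> x \<le> y \<and> y \<le> b"
  have f: "f integrable_on {x..y}" "(\<lambda>t. psi_p p (D t)) integrable_on {x..y}"
    using xy integrable_on_subinterval[OF psi] integrable_on_subinterval[OF set_lebesgue_integral_eq_integral(1)[OF fi]]
    by auto
  consider "y \<le> c" | "c \<le> x" | "x \<le> c" "c \<le> y" by linarith
  then have "D x - D y = integral {x..y} f \<and> u y - u x = integral {x..y} (\<lambda>t. psi_p p (D t))"
  proof cases
    case 3
    then show ?thesis
      using plap_sysD(3,4)[OF L, of x c] plap_sysD(3,4)[OF R, of c y] xy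
        Henstock_Kurzweil_Integration.integral_combine[OF 3 f(1)]
        Henstock_Kurzweil_Integration.integral_combine[OF 3 f(2)] by auto
  qed (use plap_sysD(3,4)[OF L, of x y] plap_sysD(3,4)[OF R, of x y] xy in auto)
  then show "D x - D y = integral {x..y} f" "u y - u x = integral {x..y} (\<lambda>t. psi_p p (D t))" by auto
qed

section \<open>Increments and comparison with constant right-hand sides\<close>

lemma integral_const_bounds:
  fixes f :: "real \<Rightarrow> real"
  assumes "f integrable_on {x..y}" "x \<le> y"
  shows "(\<And>t. t \<in> {x..y} \<Longrightarrow> f t \<le> M) \<Longrightarrow> integral {x..y} f \<le> M * (y - x)"
    and "(\<And>t. t \<in> {x..y} \<Longrightarrow> M \<le> f t) \<Longrightarrow> M * (y - x) \<le> integral {x..y} f"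
  using integral_le[OF assms(1) integrable_const_ivl[of M x y]]
    integral_le[OF integrable_const_ivl[of M x y] assms(1)] assms(2)
  by (auto simp: mult.commute)

lemma plap_sys_D_diff_bounds:
  assumes "plap_sys p a b u D f" "a \<le> x" "x \<le> y" "y \<le> b"
  shows "(\<And>t. t \<in> {x..y} \<Longrightarrow> f t \<le> M) \<Longrightarrow> D x - D y \<le> M * (y - x)"
    and "(\<And>t. t \<in> {x..y} \<Longrightarrow> M \<le> f t) \<Longrightarrow> M * (y - x) \<le> D x - D y"
  using plap_sysD(3)[OF assms] integral_const_bounds[of f x y M] assms(2-4)
    integrable_on_subinterval[OF plap_sysD(2)[OF assms(1)], of x y] by auto

lemma plap_sys_u_diff_bounds:
  assumes "1 < p" "plap_sys p a b u D f" "a \<le> x" "x \<le> y" "y \<le> b"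
  shows "(\<And>t. t \<in> {x..y} \<Longrightarrow> D t \<le> M) \<Longrightarrow> u y - u x \<le> psi_p p M * (y - x)"
    and "(\<And>t. t \<in> {x..y} \<Longrightarrow> M \<le> D t) \<Longrightarrow> psi_p p M * (y - x) \<le> u y - u x"
  using plap_sysD(4)[OF assms(2-5)] integral_const_bounds[of "\<lambda>t. psi_p p (D t)" x y "psi_p p M"] assms(1,4)
    plap_sys_integrable_psi[OF assms(1,2,3,5)] by auto

lemma plap_sys_u_mono:
  assumes "1 < p" "plap_sys p a b u D f" "a \<le> x" "x \<le> y" "y \<le> b"
    and "\<And>t. t \<in> {x..y} \<Longrightarrow> 0 \<le> D t"
  shows "u x \<le> u y"
  using plap_sys_u_diff_bounds(2)[OF assms(1-5), of 0] assms(6) by simp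

text \<open>For negative r the integrand is singular at c, but its primitive is continuous there;
  the fundamental theorem is used in the form that asks for a derivative only in the
  interior.\<close>

lemma has_integral_reverse_powr:
  fixes r :: real
  assumes "- 1 < r" "x \<le> c"
  shows "((\<lambda>t. (c - t) powr r) has_integral (c - x) powr (r + 1) / (r + 1)) {x..c}"
proof -
  have "((\<lambda>t. (c - t) powr r) has_integral (- ((c - c) powr (r + 1) / (r + 1))) - (- ((c - x) powr (r + 1) / (r + 1)))) {x..c}"
  proof (rule fundamental_theorem_of_calculus_interior[OF assms(2)])
    show "continuous_on {x..c} (\<lambda>t. - ((c - t) powr (r + 1) / (r + 1)))"
      using assms(1) by (intro continuous_intros continuous_on_powr') auto
    fix t assume t: "t \<in> {x<..<c}"
    have "((\<lambda>t. c - t) has_real_derivative - 1) (at t)"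
      by (auto intro!: derivative_eq_intros)
    from DERIV_minus[OF DERIV_cdivide[OF DERIV_fun_powr[OF this, of "r + 1"], of "r + 1"]]
    show "((\<lambda>t. - ((c - t) powr (r + 1) / (r + 1))) has_vector_derivative (c - t) powr r) (at t)"
      using t assms(1) unfolding has_real_derivative_iff_has_vector_derivative[symmetric] by simp
  qed
  then show ?thesis using assms(1) by simp
qed

lemma psi_p_mult:
  assumes "0 \<le> K" "0 \<le> t"
  shows "psi_p p (K * t) = psi_p p K * t powr (1 / (p - 1))"
  using assms by (simp add: psi_p_nonneg powr_mult)

text \<open>The comparison function has constant right-hand side \<open>K\<close> and zero slope at
  c. Its slope is \<open>psi_p p (K * (c - t))\<close>, whose integration raises the exponent 1 / (p
  - 1) to p / (p - 1).\<close>

lemma plap_sys_growth: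
  assumes p: "1 < p" and sys: "plap_sys p x c u D f" and xc: "x \<le> c" and K: "0 \<le> K"
  shows "(\<And>t. t \<in> {x..c} \<Longrightarrow> K * (c - t) \<le> D t) \<Longrightarrow>
      psi_p p K * ((c - x) powr (p / (p - 1)) / (p / (p - 1))) \<le> u c - u x"
    and "(\<And>t. t \<in> {x..c} \<Longrightarrow> D t \<le> K * (c - t)) \<Longrightarrow>
      u c - u x \<le> psi_p p K * ((c - x) powr (p / (p - 1)) / (p / (p - 1)))"
proof -
  have r: "1 / (p - 1) + 1 = p / (p - 1)" using p by (simp add: field_simps)
  have "0 < 1 / (p - 1)" using p by simp
  then have r0: "- 1 < 1 / (p - 1)" by linarith
  have I: "((\<lambda>t. psi_p p (K * (c - t))) has_integral psi_p p K * ((c - x) powr (p / (p - 1)) / (p / (p - 1)))) {x..c}"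
    using has_integral_mult_right[OF has_integral_reverse_powr[OF r0 xc], of "psi_p p K"] p xc K r
    by (subst has_integral_cong[where g="\<lambda>t. psi_p p K * (c - t) powr (1 / (p - 1))"]) (auto simp: psi_p_mult)
  have J: "((\<lambda>t. psi_p p (D t)) has_integral u c - u x) {x..c}"
    using plap_sysD(4)[OF sys, of x c] plap_sys_integrable_psi[OF p sys, of x c] xc
    by (simp add: integrable_integral)
  show "psi_p p K * ((c - x) powr (p / (p - 1)) / (p / (p - 1))) \<le> u c - u x"
    if "\<And>t. t \<in> {x..c} \<Longrightarrow> K * (c - t) \<le> D t"
    using has_integral_le[OF I J] that p by simp
  show "u c - u x \<le> psi_p p K * ((c - x) powr (p / (p - 1)) / (p / (p - 1)))"
    if "\<And>t. t \<in> {x..c} \<Longrightarrow> D t \<le> K * (c - t)"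
    using has_integral_le[OF J I] that p by simp
qed

section \<open>Limits of systems and compactness\<close>

lemma plap_sys_D_bound:
  assumes "plap_sys p c d u D f" "h integrable_on {c..d}" "\<And>x. x \<in> {c..d} \<Longrightarrow> \<bar>f x\<bar> \<le> h x"
    and "x \<in> {c..d}" "y \<in> {c..d}"
  shows "\<bar>D x - D y\<bar> \<le> integral {c..d} h"
proof -
  have *: "\<bar>D x - D y\<bar> \<le> integral {c..d} h" if "c \<le> x" "x \<le> y" "y \<le> d" for x y
  proof -
    have sub: "{x..y} \<subseteq> {c..d}" using that by auto
    have "\<bar>D x - D y\<bar> = \<bar>integral {x..y} f\<bar>"
      using plap_sysD(3)[OF assms(1) that] by simp
    also have "\<dots> \<le> integral {x..y} h"
      using integral_norm_bound_integral[of f "{x..y}" h] assms(3) sub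
        integrable_on_subinterval[OF plap_sysD(2)[OF assms(1)] sub] integrable_on_subinterval[OF assms(2) sub]
      by auto
    also have "\<dots> \<le> integral {c..d} h"
      using sub assms(3) by (intro integral_subset_le integrable_on_subinterval[OF assms(2) sub] assms(2))
        (use order_trans[OF abs_ge_zero assms(3)] in auto)
    finally show ?thesis .
  qed
  show ?thesis
    using *[of x y] *[of y x] assms(4,5) by (cases "x \<le> y") (auto simp: abs_minus_commute)
qed

text \<open>Differences of fluxes are integrals of the dominated functions \<open>f n\<close>, so
  convergence of the flux at the single point z spreads to the whole interval. The resulting uniform
  flux bound dominates the slopes in the second equation.\<close>

lemma plap_sys_limit:
  assumes p: "1 < p" and sys: "\<And>n::nat. plap_sys p c d (u n) (D n) (f n)"
    and h: "h integrable_on {c..d}" and bound: "\<And>n x. x \<in> {c..d} \<Longrightarrow> \<bar>f n x\<bar> \<le> h x"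
    and f: "\<And>x. x \<in> {c..d} \<Longrightarrow> (\<lambda>n. f n x) \<longlonglongrightarrow> F x"
    and u: "\<And>x. x \<in> {c..d} \<Longrightarrow> (\<lambda>n. u n x) \<longlonglongrightarrow> U x"
    and z: "z \<in> {c..d}" "(\<lambda>n. D n z) \<longlonglongrightarrow> L"
  shows "plap_sys p c d U (\<lambda>x. lim (\<lambda>n. D n x)) F"
    and "\<And>x. x \<in> {c..d} \<Longrightarrow> (\<lambda>n. D n x) \<longlonglongrightarrow> lim (\<lambda>n. D n x)"
proof -
  have fint: "f n integrable_on {x..y}" if "c \<le> x" "y \<le> d" for n x y
    using integrable_on_subinterval[OF plap_sysD(2)[OF sys[of n]]] that by auto
  have hint: "h integrable_on {x..y}" if "c \<le> x" "y \<le> d" for x y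
    using integrable_on_subinterval[OF h] that by auto
  have I: "F integrable_on {x..y}" "(\<lambda>n. integral {x..y} (f n)) \<longlonglongrightarrow> integral {x..y} F"
    if "c \<le> x" "y \<le> d" for x y
    using dominated_convergence[of f "{x..y}" h F] fint[OF that] hint[OF that] bound f that by auto
  show D: "(\<lambda>n. D n x) \<longlonglongrightarrow> lim (\<lambda>n. D n x)" if x: "x \<in> {c..d}" for x
  proof -
    have "convergent (\<lambda>n. D n x)"
    proof (cases "x \<le> z")
      case True
      have "(\<lambda>n. D n z + integral {x..z} (f n)) \<longlonglongrightarrow> L + integral {x..z} F"
        using x z True by (intro tendsto_add z(2) I) auto
      moreover have "D n z + integral {x..z} (f n) = D n x" for n
        using plap_sysD(3)[OF sys, of x z n] x z True by simp
      ultimately show ?thesis unfolding convergent_def by auto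
    next
      case False
      have "(\<lambda>n. D n z - integral {z..x} (f n)) \<longlonglongrightarrow> L - integral {z..x} F"
        using x z False by (intro tendsto_diff z(2) I) auto
      moreover have "D n z - integral {z..x} (f n) = D n x" for n
        using plap_sysD(3)[OF sys, of z x n] x z False by simp
      ultimately show ?thesis unfolding convergent_def by auto
    qed
    then show ?thesis by (simp add: convergent_LIMSEQ_iff)
  qed
  obtain B where B: "\<And>n. \<bar>D n z\<bar> \<le> B"
    using convergentI[OF z(2), THEN convergent_imp_Bseq] by (auto simp: Bseq_def)
  define M where "M = B + integral {c..d} h"
  have M: "\<bar>D n x\<bar> \<le> M" if "x \<in> {c..d}" for n x
    using plap_sys_D_bound[OF sys[of n] h bound that z(1)] B[of n] unfolding M_def by linarith
  show "plap_sys p c d U (\<lambda>x. lim (\<lambda>n. D n x)) F"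
    unfolding plap_sys_def
  proof (intro conjI allI impI)
    have "\<bar>F x\<bar> \<le> h x" if "x \<in> {c..d}" for x
      by (rule LIMSEQ_le_const2[OF tendsto_rabs[OF f[OF that]]]) (use bound that in auto)
    then show "F absolutely_integrable_on {c..d}"
      using I(1)[of c d] by (intro absolutely_integrable_integrable_bound[OF _ _ h]) auto
  next
    fix x y assume xy: "c \<le> x \<and> x \<le> y \<and> y \<le> d"
    have "(\<lambda>n. D n x - D n y) \<longlonglongrightarrow> lim (\<lambda>n. D n x) - lim (\<lambda>n. D n y)"
      using xy by (intro tendsto_diff D) auto
    moreover have "D n x - D n y = integral {x..y} (f n)" for n
      using plap_sysD(3)[OF sys] xy by auto
    ultimately show "lim (\<lambda>n. D n x) - lim (\<lambda>n. D n y) = integral {x..y} F"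
      using I(2)[of x y] xy LIMSEQ_unique by auto
    have "(\<lambda>n. integral {x..y} (\<lambda>t. psi_p p (D n t))) \<longlonglongrightarrow> integral {x..y} (\<lambda>t. psi_p p (lim (\<lambda>n. D n t)))"
    proof (rule dominated_convergence(2))
      show "(\<lambda>t. psi_p p (D n t)) integrable_on {x..y}" for n
        using plap_sys_integrable_psi[OF p sys] xy by auto
      show "(\<lambda>t. psi_p p M) integrable_on {x..y}" by (rule integrable_const_ivl)
      show "norm (psi_p p (D n t)) \<le> psi_p p M" if "t \<in> {x..y}" for n t
        using M[of t n] that xy p by (simp add: psi_p_abs)
      show "(\<lambda>n. psi_p p (D n t)) \<longlonglongrightarrow> psi_p p (lim (\<lambda>n. D n t))" if "t \<in> {x..y}" for t
        using that xy by (intro isCont_tendsto_compose[OF isCont_psi_p[OF p]] D) auto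
    qed
    moreover have "u n y - u n x = integral {x..y} (\<lambda>t. psi_p p (D n t))" for n
      using plap_sysD(4)[OF sys] xy by auto
    moreover have "(\<lambda>n. u n y - u n x) \<longlonglongrightarrow> U y - U x"
      using xy by (intro tendsto_diff u) auto
    ultimately show "U y - U x = integral {x..y} (\<lambda>t. psi_p p (lim (\<lambda>n. D n t)))"
      using LIMSEQ_unique by auto
  qed
qed

lemma Arzela_Ascoli_Lipschitz:
  fixes F :: "nat \<Rightarrow> real \<Rightarrow> real"
  assumes ab: "a < b" and F0: "\<And>n. F n a = 0"
    and lip: "\<And>n x y. \<lbrakk>x \<in> {a..b}; y \<in> {a..b}\<rbrakk> \<Longrightarrow> \<bar>F n x - F n y\<bar> \<le> C * \<bar>x - y\<bar>"
  obtains g k where "continuous_on {a..b} g" "strict_mono (k :: nat \<Rightarrow> nat)"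
    "\<And>x. x \<in> {a..b} \<Longrightarrow> (\<lambda>n. F (k n) x) \<longlonglongrightarrow> g x"
proof -
  have "0 \<le> C * \<bar>a - b\<bar>" using order_trans[OF abs_ge_zero lip[of a b 0]] ab by simp
  then have "0 \<le> C" using ab by (simp add: zero_le_mult_iff)
  obtain g k where g: "continuous_on {a..b} g" and k: "strict_mono (k :: nat \<Rightarrow> nat)"
    and conv: "\<And>e. 0 < e \<Longrightarrow> \<exists>N. \<forall>n x. n \<ge> N \<and> x \<in> {a..b} \<longrightarrow> norm (F (k n) x - g x) < e"
  proof (rule Arzela_Ascoli[of "{a..b}" F "C * (b - a)"])
    show "norm (F n x) \<le> C * (b - a)" if "x \<in> {a..b}" for n x
    proof -
      have "\<bar>F n x - F n a\<bar> \<le> C * \<bar>x - a\<bar>" using that ab by (intro lip) auto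
      also have "\<dots> \<le> C * (b - a)" using that \<open>0 \<le> C\<close> by (intro mult_left_mono) auto
      finally show ?thesis by (simp add: F0)
    qed
    show "\<exists>d>0. \<forall>n y. y \<in> {a..b} \<and> norm (x - y) < d \<longrightarrow> norm (F n x - F n y) < e"
      if x: "x \<in> {a..b}" and "0 < e" for x e
    proof (intro exI[of _ "e / (C + 1)"] conjI allI impI)
      show "0 < e / (C + 1)" using \<open>0 \<le> C\<close> \<open>0 < e\<close> by simp
      fix n y assume y: "y \<in> {a..b} \<and> norm (x - y) < e / (C + 1)"
      then have "C * \<bar>x - y\<bar> \<le> (C + 1) * \<bar>x - y\<bar>" "(C + 1) * \<bar>x - y\<bar> < e"
        using \<open>0 \<le> C\<close> by (auto simp: field_simps)
      then show "norm (F n x - F n y) < e" using lip[OF x, of y n] y by simp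
    qed
  qed auto
  have "(\<lambda>n. F (k n) x) \<longlonglongrightarrow> g x" if "x \<in> {a..b}" for x
    using conv that by (intro LIMSEQ_I) blast
  with g k show thesis by (rule that)
qed

text \<open>The bound \<open>g\<close> is independent of the second argument: every flux stays
  within \<open>integral {a..b} g\<close> of its initial value, which yields global existence.
  Measurability is required along continuous functions, the ones that get substituted.\<close>

locale caratheodory =
  fixes p a b :: real and f :: "real \<Rightarrow> real \<Rightarrow> real" and g :: "real \<Rightarrow> real"
  assumes p: "1 < p" and ab: "a < b" and g: "g integrable_on {a..b}"
    and bound: "\<And>x y. x \<in> {a..b} \<Longrightarrow> \<bar>f x y\<bar> \<le> g x"
    and cont: "\<And>x y. x \<in> {a..b} \<Longrightarrow> isCont (f x) y"
    and meas: "\<And>v. continuous_on {a..b} v \<Longrightarrow> (\<lambda>x. f x (v x)) \<in> borel_measurable (lebesgue_on {a..b})"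
begin

text \<open>Flux with initial value \<open>s\<close> when the right-hand side is frozen at
  \<open>v\<close>. \<open>Top\<close> below is the corresponding solution, so that a fixed point of
  \<open>Top s\<close> solves the nonlinear problem.\<close>

definition Dop :: "real \<Rightarrow> (real \<Rightarrow> real) \<Rightarrow> real \<Rightarrow> real" where
  "Dop s v x = s - integral {a..x} (\<lambda>r. f r (v r))"

definition Top :: "real \<Rightarrow> (real \<Rightarrow> real) \<Rightarrow> real \<Rightarrow> real" where
  "Top s v x = integral {a..x} (\<lambda>t. psi_p p (Dop s v t))"

lemma absolutely_integrable_f:
  assumes "continuous_on {a..b} v"
  shows "(\<lambda>x. f x (v x)) absolutely_integrable_on {a..b}"
  by (rule measurable_bounded_by_integrable_imp_absolutely_integrable[OF meas[OF assms] _ g])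
    (use bound in auto)

lemma integrable_f:
  assumes "continuous_on {a..b} v" "a \<le> x" "y \<le> b"
  shows "(\<lambda>x. f x (v x)) integrable_on {x..y}"
  using integrable_on_subinterval[OF set_lebesgue_integral_eq_integral(1)[OF absolutely_integrable_f[OF assms(1)]]]
    assms by auto

lemma Dop_continuous:
  assumes "continuous_on {a..b} v"
  shows "continuous_on {a..b} (Dop s v)"
  unfolding Dop_def by (intro continuous_intros indefinite_integral_continuous_1 integrable_f assms) auto

lemma Top_sys:
  assumes "continuous_on {a..b} v"
  shows "plap_sys p a b (Top s v) (Dop s v) (\<lambda>r. f r (v r))"
  unfolding plap_sys_def
proof (intro conjI allI impI absolutely_integrable_f assms)
  fix x y assume xy: "a \<le> x \<and> x \<le> y \<and> y \<le> b"
  show "Dop s v x - Dop s v y = integral {x..y} (\<lambda>r. f r (v r))"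
    using Henstock_Kurzweil_Integration.integral_combine[of a x y "\<lambda>r. f r (v r)"] integrable_f[OF assms, of a y] xy
    by (simp add: Dop_def)
  have "(\<lambda>t. psi_p p (Dop s v t)) integrable_on {a..y}"
    using xy by (intro integrable_continuous_real continuous_intros p
        continuous_on_subset[OF Dop_continuous[OF assms]]) auto
  then show "Top s v y - Top s v x = integral {x..y} (\<lambda>t. psi_p p (Dop s v t))"
    using Henstock_Kurzweil_Integration.integral_combine[of a x y "\<lambda>t. psi_p p (Dop s v t)"] xy by (simp add: Top_def)
qed

lemma Top_continuous: "continuous_on {a..b} v \<Longrightarrow> continuous_on {a..b} (Top s v)"
  using plap_sys_continuous_u[OF p Top_sys] .

lemma Dop_bound:
  assumes "continuous_on {a..b} v" "x \<in> {a..b}"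
  shows "\<bar>Dop s v x\<bar> \<le> \<bar>s\<bar> + integral {a..b} g"
proof -
  have "\<bar>Dop s v x - Dop s v a\<bar> \<le> integral {a..b} g"
    using assms ab by (intro plap_sys_D_bound[OF Top_sys[OF assms(1)] g]) (auto intro: bound)
  moreover have "Dop s v a = s" by (simp add: Dop_def)
  ultimately show ?thesis by linarith
qed

text \<open>This causality is what lets the delayed iteration settle one interval of length
  \<epsilon> after the other.\<close>

lemma Top_cong:
  assumes "\<And>r. r \<in> {a..x} \<Longrightarrow> v r = w r"
  shows "Top s v x = Top s w x"
proof -
  have "Dop s v t = Dop s w t" if "t \<in> {a..x}" for t
    unfolding Dop_def using assms that
    by (auto intro!: Henstock_Kurzweil_Integration.integral_cong)
  then show ?thesis
    unfolding Top_def by (auto intro!: Henstock_Kurzweil_Integration.integral_cong)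
qed

text \<open>Pointwise convergence of the arguments is enough, the bound \<open>g\<close> being
  uniform. Induction over the Tonelli steps turns this into continuity of the shooting map.\<close>

lemma Top_tendsto:
  assumes v: "\<And>k::nat. continuous_on {a..b} (v k)" "continuous_on {a..b} w"
    and lim: "\<And>x. x \<in> {a..b} \<Longrightarrow> (\<lambda>k. v k x) \<longlonglongrightarrow> w x" and s: "s \<longlonglongrightarrow> t" and x: "x \<in> {a..b}"
  shows "(\<lambda>k. Top (s k) (v k) x) \<longlonglongrightarrow> Top t w x"
proof -
  have D: "(\<lambda>k. Dop (s k) (v k) y) \<longlonglongrightarrow> Dop t w y" if y: "y \<in> {a..b}" for y
    unfolding Dop_def
  proof (intro tendsto_diff s dominated_convergence(2))
    show "(\<lambda>r. f r (v k r)) integrable_on {a..y}" for k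
      using integrable_f[OF v(1)] y by auto
    show "g integrable_on {a..y}" using integrable_on_subinterval[OF g] y by auto
    show "norm (f r (v k r)) \<le> g r" if "r \<in> {a..y}" for k r using bound that y by auto
    show "(\<lambda>k. f r (v k r)) \<longlonglongrightarrow> f r (w r)" if "r \<in> {a..y}" for r
      using that y by (intro isCont_tendsto_compose[OF cont] lim) auto
  qed
  obtain B where B: "\<And>k. \<bar>s k\<bar> \<le> B"
    using convergentI[OF s, THEN convergent_imp_Bseq] by (auto simp: Bseq_def)
  define M where "M = B + integral {a..b} g"
  have M: "\<bar>Dop (s k) (v k) y\<bar> \<le> M" if "y \<in> {a..b}" for k y
    using Dop_bound[OF v(1) that, of "s k" k] B[of k] by (simp add: M_def)
  show ?thesis
    unfolding Top_def
  proof (rule dominated_convergence(2))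
    show "(\<lambda>t. psi_p p (Dop (s k) (v k) t)) integrable_on {a..x}" for k
      using plap_sys_integrable_psi[OF p Top_sys[OF v(1)]] x by auto
    show "(\<lambda>t. psi_p p M) integrable_on {a..x}" by (rule integrable_const_ivl)
    show "norm (psi_p p (Dop (s k) (v k) t)) \<le> psi_p p M" if "t \<in> {a..x}" for k t
      using M[of t k] that x p by (simp add: psi_p_abs)
    show "(\<lambda>k. psi_p p (Dop (s k) (v k) r)) \<longlonglongrightarrow> psi_p p (Dop t w r)" if "r \<in> {a..x}" for r
      using that x by (intro isCont_tendsto_compose[OF isCont_psi_p[OF p]] D) auto
  qed
qed

text \<open>Tonelli's scheme: with the unknown delayed by \<open>\<epsilon>\<close> on the right-hand side the iteration becomes
  stationary on \<open>[a, a + j \<epsilon>]\<close> after \<open>j\<close> steps. Unlike the original problem the delayed one has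
  a unique solution, depending continuously on the initial slope.\<close>

primrec tonelli :: "real \<Rightarrow> real \<Rightarrow> nat \<Rightarrow> real \<Rightarrow> real" where
  "tonelli s \<epsilon> 0 = (\<lambda>_. 0)"
| "tonelli s \<epsilon> (Suc j) = Top s (\<lambda>x. tonelli s \<epsilon> j (max a (x - \<epsilon>)))"

lemma continuous_on_delay:
  assumes "continuous_on {a..b} v" "0 \<le> \<epsilon>"
  shows "continuous_on {a..b} (\<lambda>x. v (max a (x - \<epsilon>)))"
  using assms(2) by (intro continuous_on_compose2[OF assms(1)] continuous_intros) auto

lemma tonelli_continuous:
  assumes "0 \<le> \<epsilon>"
  shows "continuous_on {a..b} (tonelli s \<epsilon> j)"
  by (induction j) (auto intro!: Top_continuous continuous_on_delay assms)

lemma tonelli_stationary: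
  assumes "0 < \<epsilon>" "x \<in> {a..b}" "x \<le> a + real j * \<epsilon>"
  shows "tonelli s \<epsilon> (Suc j) x = tonelli s \<epsilon> j x"
  using assms(2,3)
proof (induction j arbitrary: x)
  case 0
  then have "x = a" by simp
  then show ?case by (simp add: Top_def)
next
  case (Suc j)
  have "tonelli s \<epsilon> (Suc j) (max a (r - \<epsilon>)) = tonelli s \<epsilon> j (max a (r - \<epsilon>))" if "r \<in> {a..x}" for r
  proof (rule Suc.IH)
    show "max a (r - \<epsilon>) \<in> {a..b}" using that Suc.prems assms(1) by auto
    have "0 \<le> real j * \<epsilon>" using assms(1) by simp
    then show "max a (r - \<epsilon>) \<le> a + real j * \<epsilon>"
      using that Suc.prems by (auto simp: algebra_simps)
  qed
  then show ?case
    unfolding tonelli.simps(2)[of s \<epsilon> "Suc j"] tonelli.simps(2)[of s \<epsilon> j] by (intro Top_cong)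
qed

lemma tonelli_tendsto:
  assumes "0 \<le> \<epsilon>" "s \<longlonglongrightarrow> t" "x \<in> {a..b}"
  shows "(\<lambda>k. tonelli (s k) \<epsilon> j x) \<longlonglongrightarrow> tonelli t \<epsilon> j x"
  using assms(3)
proof (induction j arbitrary: x)
  case (Suc j)
  show ?case unfolding tonelli.simps(2)
    by (intro Top_tendsto continuous_on_delay tonelli_continuous assms Suc) (use assms(1) in auto)
qed simp

text \<open>Chosen so that \<open>Suc n\<close> delays exhaust \<open>{a..b}\<close>: after
  \<open>Suc n\<close> iterations the scheme is stationary everywhere.\<close>

definition approx_delay :: "nat \<Rightarrow> real" where
  "approx_delay n = (b - a) / real (Suc n)"

definition approx_sol :: "nat \<Rightarrow> real \<Rightarrow> real \<Rightarrow> real" where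
  "approx_sol n s = tonelli s (approx_delay n) (Suc n)"

definition approx_D :: "nat \<Rightarrow> real \<Rightarrow> real \<Rightarrow> real" where
  "approx_D n s = Dop s (\<lambda>x. approx_sol n s (max a (x - approx_delay n)))"

lemma approx_delay_pos: "0 < approx_delay n"
  using ab by (simp add: approx_delay_def)

lemma approx_sol_continuous: "continuous_on {a..b} (approx_sol n s)"
  unfolding approx_sol_def using approx_delay_pos[of n] by (intro tonelli_continuous) auto

lemma approx_sys:
  "plap_sys p a b (approx_sol n s) (approx_D n s) (\<lambda>r. f r (approx_sol n s (max a (r - approx_delay n))))"
proof -
  have eq: "approx_sol n s x = Top s (\<lambda>x. approx_sol n s (max a (x - approx_delay n))) x" if "x \<in> {a..b}" for x
  proof -
    have "x \<le> a + real (Suc n) * approx_delay n"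
      using that by (simp add: approx_delay_def)
    from tonelli_stationary[OF approx_delay_pos that this, of s] show ?thesis
      unfolding approx_sol_def tonelli.simps(2)[of _ _ "Suc n"] by simp
  qed
  have "plap_sys p a b (Top s (\<lambda>x. approx_sol n s (max a (x - approx_delay n)))) (approx_D n s)
      (\<lambda>r. f r (approx_sol n s (max a (r - approx_delay n))))"
    unfolding approx_D_def using approx_delay_pos[of n]
    by (intro Top_sys continuous_on_delay approx_sol_continuous) auto
  then show ?thesis
    unfolding plap_sys_def using eq by auto
qed

lemma approx_D_bound: "x \<in> {a..b} \<Longrightarrow> \<bar>approx_D n s x\<bar> \<le> \<bar>s\<bar> + integral {a..b} g"
  unfolding approx_D_def using approx_delay_pos[of n]
  by (intro Dop_bound continuous_on_delay approx_sol_continuous) auto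

lemma approx_sol_a [simp]: "approx_sol n s a = 0"
  by (simp add: approx_sol_def Top_def)

lemma approx_sol_lipschitz:
  assumes "\<bar>s\<bar> \<le> S" "x \<in> {a..b}" "y \<in> {a..b}"
  shows "\<bar>approx_sol n s x - approx_sol n s y\<bar> \<le> psi_p p (S + integral {a..b} g) * \<bar>x - y\<bar>"
proof -
  have *: "\<bar>approx_sol n s y - approx_sol n s x\<bar> \<le> psi_p p (S + integral {a..b} g) * (y - x)"
    if "a \<le> x" "x \<le> y" "y \<le> b" for x y
  proof -
    have "\<bar>integral {x..y} (\<lambda>t. psi_p p (approx_D n s t))\<bar> \<le> integral {x..y} (\<lambda>t. psi_p p (S + integral {a..b} g))"
      unfolding real_norm_def[symmetric]
    proof (rule integral_norm_bound_integral)
      show "(\<lambda>t. psi_p p (approx_D n s t)) integrable_on {x..y}"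
        using plap_sys_integrable_psi[OF p approx_sys] that by auto
      show "norm (psi_p p (approx_D n s t)) \<le> psi_p p (S + integral {a..b} g)" if t: "t \<in> {x..y}" for t
        using approx_D_bound[of t n s] t that assms(1) \<open>a \<le> x\<close> \<open>y \<le> b\<close> p by (simp add: psi_p_abs)
    qed (rule integrable_const_ivl)
    then show ?thesis
      using plap_sysD(4)[OF approx_sys that] that by (simp add: mult.commute)
  qed
  show ?thesis
    using *[of x y] *[of y x] assms(2,3) by (cases "x \<le> y") (auto simp: abs_minus_commute)
qed

text \<open>The slope may vary with n because shooting selects it anew for each delay. Bounded
  slopes give a common Lipschitz constant, hence a limit along a subsequence, and they also make the
  delay disappear in that limit.\<close>

lemma approx_compact:
  assumes s: "\<And>n. \<bar>s n\<bar> \<le> S"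
  obtains r u D where "strict_mono r" "plap_sys p a b u D (\<lambda>x. f x (u x))" "u a = 0"
    "(\<lambda>n. s (r n)) \<longlonglongrightarrow> D a" "\<And>x. x \<in> {a..b} \<Longrightarrow> (\<lambda>n. approx_sol (r n) (s (r n)) x) \<longlonglongrightarrow> u x"
proof -
  define C where "C = psi_p p (S + integral {a..b} g)"
  let ?u = "\<lambda>n. approx_sol n (s n)"
  have lip: "\<bar>?u n x - ?u n y\<bar> \<le> C * \<bar>x - y\<bar>" if "x \<in> {a..b}" "y \<in> {a..b}" for n x y
    unfolding C_def using approx_sol_lipschitz[OF s that] .
  have u_a: "?u n a = 0" for n by simp
  have "0 \<le> C * \<bar>a - b\<bar>" using order_trans[OF abs_ge_zero lip[of a b 0]] ab by simp
  then have C: "0 \<le> C" using ab by (simp add: zero_le_mult_iff)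
  obtain U k where U: "continuous_on {a..b} U" and k: "strict_mono (k :: nat \<Rightarrow> nat)"
    and conv: "\<And>x. x \<in> {a..b} \<Longrightarrow> (\<lambda>n. ?u (k n) x) \<longlonglongrightarrow> U x"
    using Arzela_Ascoli_Lipschitz[where F = ?u and C = C, OF ab u_a lip] by blast
  have "\<forall>n. (s \<circ> k) n \<in> {- S..S}"
    using s by (auto simp: abs_le_iff minus_le_iff)
  then obtain l q where q: "strict_mono q" "((s \<circ> k) \<circ> q) \<longlonglongrightarrow> l"
    using seq_compactE[OF compact_imp_seq_compact[OF compact_Icc]] by metis
  define r where "r = k \<circ> q"
  have r: "strict_mono r" unfolding r_def using k q(1) by (rule strict_mono_o)
  have sr: "(\<lambda>n. s (r n)) \<longlonglongrightarrow> l" using q(2) by (simp add: r_def o_def)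
  have ur: "(\<lambda>n. ?u (r n) x) \<longlonglongrightarrow> U x" if x: "x \<in> {a..b}" for x
    using LIMSEQ_subseq_LIMSEQ[OF conv[OF x] q(1)] by (simp add: r_def o_def)
  have delay: "(\<lambda>n. approx_delay (r n)) \<longlonglongrightarrow> 0"
    using LIMSEQ_subseq_LIMSEQ[OF lim_const_over_n[THEN LIMSEQ_Suc, of "b - a"] r]
    by (simp add: approx_delay_def o_def)
  \<comment> \<open>The delayed argument differs from x by at most the delay, so the common
    Lipschitz constant makes the difference vanish.\<close>
  have delayed: "(\<lambda>n. ?u (r n) (max a (x - approx_delay (r n)))) \<longlonglongrightarrow> U x" if x: "x \<in> {a..b}" for x
  proof -
    have "(\<lambda>n. ?u (r n) (max a (x - approx_delay (r n))) - ?u (r n) x) \<longlonglongrightarrow> 0"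
    proof (rule Lim_null_comparison)
      show "\<forall>\<^sub>F n in sequentially. norm (?u (r n) (max a (x - approx_delay (r n))) - ?u (r n) x) \<le> C * approx_delay (r n)"
      proof (rule always_eventually, rule allI)
        fix n
        have "\<bar>?u (r n) (max a (x - approx_delay (r n))) - ?u (r n) x\<bar> \<le> C * \<bar>max a (x - approx_delay (r n)) - x\<bar>"
          using x approx_delay_pos[of "r n"] by (intro lip) auto
        also have "\<dots> \<le> C * approx_delay (r n)"
          using x approx_delay_pos[of "r n"] C by (intro mult_left_mono) auto
        finally show "norm (?u (r n) (max a (x - approx_delay (r n))) - ?u (r n) x) \<le> C * approx_delay (r n)" by simp
      qed
      show "(\<lambda>n. C * approx_delay (r n)) \<longlonglongrightarrow> 0"
        using tendsto_mult_left[OF delay, of C] by simp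
    qed
    from tendsto_add[OF this ur[OF x]] show ?thesis by simp
  qed
  have Da: "approx_D n t a = t" for n t
    by (simp add: approx_D_def Dop_def)
  have lim_a: "(\<lambda>n. approx_D (r n) (s (r n)) a) \<longlonglongrightarrow> l"
    using sr by (simp add: Da)
  let ?D = "\<lambda>x. lim (\<lambda>n. approx_D (r n) (s (r n)) x)"
  have sys: "plap_sys p a b U ?D (\<lambda>x. f x (U x))"
    using plap_sys_limit(1)[OF p approx_sys g bound _ ur _ lim_a,
        of "\<lambda>x. f x (U x)"] ab isCont_tendsto_compose[OF cont delayed] by auto
  show thesis
  proof (rule that[OF r sys])
    show "U a = 0" using LIMSEQ_unique[OF ur[of a]] ab by simp
    show "(\<lambda>n. s (r n)) \<longlonglongrightarrow> ?D a" using sr limI[OF lim_a] by simp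
  qed (rule ur)
qed

theorem ivp_exists:
  obtains u D where "plap_sys p a b u D (\<lambda>x. f x (u x))" "u a = 0" "D a = s"
proof (rule approx_compact[of "\<lambda>_. s" "\<bar>s\<bar>"])
  fix r :: "nat \<Rightarrow> nat" and u D
  assume "plap_sys p a b u D (\<lambda>x. f x (u x))" "u a = 0" "(\<lambda>n. s) \<longlonglongrightarrow> D a"
  then show thesis using that by (simp add: LIMSEQ_const_iff)
qed simp

text \<open>A slope hitting zero at b is chosen for each delayed problem, and only then is the delay
  removed; the bound on the slopes keeps them in a compact set.\<close>

theorem bvp_exists:
  obtains u D where "plap_sys p a b u D (\<lambda>x. f x (u x))" "u a = 0" "u b = 0"
proof -
  \<comment> \<open>The flux varies by at most \<open>G\<close>, so started at \<open>G\<close> or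
    \<open>- G\<close> it keeps its sign. The end values for these two slopes therefore have
    opposite signs, as the intermediate value theorem requires.\<close>
  define G where "G = integral {a..b} g"
  have sgn: "D x \<ge> 0" if "plap_sys p a b u D h" "\<And>x. x \<in> {a..b} \<Longrightarrow> \<bar>h x\<bar> \<le> g x" "D a = G" "x \<in> {a..b}" for u D h x
    using plap_sys_D_bound[OF that(1) g that(2), of x a] that(3,4) ab unfolding G_def by auto
  have sgn': "D x \<le> 0" if "plap_sys p a b u D h" "\<And>x. x \<in> {a..b} \<Longrightarrow> \<bar>h x\<bar> \<le> g x" "D a = - G" "x \<in> {a..b}" for u D h x
    using plap_sys_D_bound[OF that(1) g that(2), of x a] that(3,4) ab unfolding G_def by auto
  have "0 \<le> G" unfolding G_def
    by (rule Henstock_Kurzweil_Integration.integral_nonneg[OF g]) (use bound in \<open>auto intro: order_trans[OF abs_ge_zero]\<close>)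
  have "\<exists>s. \<bar>s\<bar> \<le> G \<and> approx_sol n s b = 0" for n
  proof -
    have Da: "approx_D n t a = t" for t
      by (simp add: approx_D_def Dop_def)
    have bd: "\<bar>f r (approx_sol n t (max a (r - approx_delay n)))\<bar> \<le> g r" if "r \<in> {a..b}" for r t
      using bound that by auto
    have b_eq: "approx_sol n t b = integral {a..b} (\<lambda>r. psi_p p (approx_D n t r))" for t
      using plap_sysD(4)[OF approx_sys, of a b n t] ab by simp
    have "0 \<le> approx_sol n G b"
      unfolding b_eq using sgn[OF approx_sys bd Da] p
      by (intro Henstock_Kurzweil_Integration.integral_nonneg plap_sys_integrable_psi[OF p approx_sys]) auto
    moreover have "approx_sol n (- G) b \<le> 0"
    proof -
      have "psi_p p (approx_D n (- G) r) \<le> 0" if "r \<in> {a..b}" for r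
        using sgn'[OF approx_sys bd Da that] p psi_p_le_iff[of p "approx_D n (- G) r" 0] by simp
      then show ?thesis
        unfolding b_eq using integral_le[of "\<lambda>r. psi_p p (approx_D n (- G) r)" "{a..b}" "\<lambda>_. 0"]
          plap_sys_integrable_psi[OF p approx_sys] by auto
    qed
    moreover have "continuous_on {- G..G} (\<lambda>s. approx_sol n s b)"
      unfolding continuous_on_sequentially o_def approx_sol_def
      using approx_delay_pos[of n] ab by (intro allI ballI impI tonelli_tendsto) auto
    ultimately obtain s where "- G \<le> s" "s \<le> G" "approx_sol n s b = 0"
      using IVT'[of "\<lambda>s. approx_sol n s b" "- G" 0 G] \<open>0 \<le> G\<close> by auto
    then show ?thesis by (intro exI[of _ s]) auto
  qed
  then obtain s where s: "\<And>n. \<bar>s n\<bar> \<le> G" "\<And>n. approx_sol n (s n) b = 0" by metis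
  show thesis
  proof (rule approx_compact[OF s(1)])
    fix r :: "nat \<Rightarrow> nat" and u D
    assume sys: "plap_sys p a b u D (\<lambda>x. f x (u x))" "u a = 0"
      and lim: "\<And>x. x \<in> {a..b} \<Longrightarrow> (\<lambda>n. approx_sol (r n) (s (r n)) x) \<longlonglongrightarrow> u x"
    have "u b = 0" using lim[of b] ab s(2) by (simp add: LIMSEQ_const_iff)
    with sys show thesis by (rule that)
  qed
qed

end

section \<open>The first Dirichlet eigenvalue\<close>

lemma has_real_derivative_deriv_on:
  assumes "a < b" "x \<in> {a..b}" "(f has_real_derivative d) (at x within {a..b})"
  shows "deriv_on {a..b} f x = d"
  unfolding deriv_on_def
  by (rule vector_derivative_within_closed_interval)
    (use assms in \<open>auto simp: has_real_derivative_iff_has_vector_derivative\<close>)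

lemma deriv_on_Ioo:
  assumes "x \<in> {a<..<b}"
  shows "deriv_on {a<..<b} f x = deriv f x"
  unfolding deriv_on_def at_within_open[OF assms open_greaterThanLessThan]
  by (rule field_derivative_eq_vector_derivative[symmetric])

lemma deriv_on_interior:
  assumes "x \<in> {a<..<b}"
  shows "deriv_on {a..b} f x = deriv f x"
proof -
  have "at x within {a..b} = at x" using assms by (intro at_within_Icc_at) auto
  then show ?thesis
    unfolding deriv_on_def by (simp only: field_derivative_eq_vector_derivative)
qed

lemma C1_on_Icc_iff:
  assumes "a < b"
  shows "C1_on {a..b} f \<longleftrightarrow> (\<forall>x\<in>{a..b}. (f has_real_derivative deriv_on {a..b} f x) (at x within {a..b}))
      \<and> continuous_on {a..b} (deriv_on {a..b} f)"
proof -
  have "f differentiable_on {a..b} \<longleftrightarrow> (\<forall>x\<in>{a..b}. (f has_real_derivative deriv_on {a..b} f x) (at x within {a..b}))"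
    unfolding differentiable_on_def
    by (simp add: deriv_on_def has_real_derivative_iff_has_vector_derivative vector_derivative_works[symmetric])
  then show ?thesis by (simp add: C1_on_def)
qed

lemma C1_on_IccI:
  assumes "a < b" "\<And>x. x \<in> {a..b} \<Longrightarrow> (f has_real_derivative d x) (at x within {a..b})"
    and "continuous_on {a..b} d"
  shows "C1_on {a..b} f"
proof -
  have eq: "deriv_on {a..b} f x = d x" if "x \<in> {a..b}" for x
    using has_real_derivative_deriv_on[OF assms(1) that assms(2)[OF that]] .
  have "continuous_on {a..b} (deriv_on {a..b} f)"
    by (rule continuous_on_eq[OF assms(3)]) (simp add: eq)
  then show ?thesis
    unfolding C1_on_Icc_iff[OF assms(1)] using assms(2) by (auto simp: eq)
qed

text \<open>Conjugation of exponents is an involution, so continuity of \<open>phi_p\<close> is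
  inherited from \<open>psi_p\<close>.\<close>

lemma phi_p_eq_psi_p:
  assumes "1 < p"
  shows "phi_p p t = psi_p (p / (p - 1)) t"
proof -
  have e: "1 / (p / (p - 1) - 1) = p - 1" using assms by (simp add: field_simps)
  have "phi_p p t = psi_p (p / (p - 1)) t" if "0 \<le> t" for t
    using that by (simp add: psi_p_nonneg phi_p_nonneg e)
  from this[of t] this[of "- t"] show ?thesis by (cases "0 \<le> t") auto
qed

lemma continuous_on_phi_p [continuous_intros]:
  assumes "1 < p" "continuous_on S f"
  shows "continuous_on S (\<lambda>x. phi_p p (f x))"
  unfolding phi_p_eq_psi_p[OF assms(1)]
  by (intro continuous_intros assms(2)) (use assms(1) in \<open>simp add: field_simps\<close>)

text \<open>The pointwise inequality behind Picone's identity: |s|^p - p |t|^(p-2) t s + (p-1) |t|^p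
  is nonnegative by Young's inequality with exponents p and p / (p - 1).\<close>

lemma Young_phi_p:
  assumes p: "1 < p"
  shows "0 \<le> phi_p p s * s - p * (phi_p p t * s) + (p - 1) * (phi_p p t * t)"
proof -
  have ss: "phi_p p s * s = \<bar>s\<bar> powr p" for s
  proof (cases "s = 0")
    case False
    have "\<bar>s\<bar> powr p = \<bar>s\<bar> powr (p - 2) * \<bar>s\<bar> powr 2"
      by (subst powr_add[symmetric]) simp
    also have "\<bar>s\<bar> powr 2 = s * s" using False by (simp add: power2_eq_square)
    finally show ?thesis by (simp add: phi_p_def)
  qed simp
  have abs: "\<bar>phi_p p t\<bar> = \<bar>t\<bar> powr (p - 1)"
  proof -
    have "\<bar>phi_p p t\<bar> = phi_p p \<bar>t\<bar>" by (simp add: phi_p_def abs_mult)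
    then show ?thesis by (simp add: phi_p_nonneg)
  qed
  have "\<bar>s\<bar> * \<bar>t\<bar> powr (p - 1) \<le> \<bar>s\<bar> powr p / p + (\<bar>t\<bar> powr (p - 1)) powr (p / (p - 1)) / (p / (p - 1))"
    using p by (intro Youngs_inequality) (auto simp: field_simps)
  also have "(\<bar>t\<bar> powr (p - 1)) powr (p / (p - 1)) = \<bar>t\<bar> powr p"
    using p by (simp add: powr_powr)
  finally have "p * (\<bar>s\<bar> * \<bar>t\<bar> powr (p - 1)) \<le> \<bar>s\<bar> powr p + (p - 1) * \<bar>t\<bar> powr p"
    using p by (simp add: field_simps)
  moreover have "p * (phi_p p t * s) \<le> p * (\<bar>s\<bar> * \<bar>t\<bar> powr (p - 1))"
    using p abs_ge_self[of "phi_p p t * s"] by (intro mult_left_mono) (auto simp: abs_mult abs mult.commute)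
  ultimately show ?thesis using ss[of s] ss[of t] by simp
qed

section \<open>Eigenfunctions and uniqueness of the eigenvalue\<close>

definition eigenpair :: "real \<Rightarrow> real \<Rightarrow> real \<Rightarrow> real \<Rightarrow> (real \<Rightarrow> real) \<Rightarrow> bool" where
  "eigenpair p x0 x1 l \<Phi> \<longleftrightarrow> C1_on {x0..x1} \<Phi> \<and> \<Phi> x0 = 0 \<and> \<Phi> x1 = 0
      \<and> (\<forall>x\<in>{x0<..<x1}. \<Phi> x > 0
           \<and> ((\<lambda>x. phi_p p (deriv \<Phi> x)) has_real_derivative - (l * \<Phi> x powr (p - 1))) (at x))"

lemma lambda1_eq: "lambda1 p x0 x1 = (THE l. \<exists>\<Phi>. eigenpair p x0 x1 l \<Phi>)"
  by (simp add: lambda1_def eigenpair_def)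

text \<open>The flux is a parameter of its own and continuous up to the end points, where its strict
  signs matter. Nothing is assumed about the sign of \<open>l\<close>.\<close>

locale eigenfunction =
  fixes p x0 x1 l :: real and \<Phi> D :: "real \<Rightarrow> real"
  assumes p: "1 < p" and x01: "x0 < x1"
    and zero: "\<Phi> x0 = 0" "\<Phi> x1 = 0" and pos: "\<And>x. x \<in> {x0<..<x1} \<Longrightarrow> 0 < \<Phi> x"
    and d\<Phi>: "\<And>x. x \<in> {x0..x1} \<Longrightarrow> (\<Phi> has_real_derivative psi_p p (D x)) (at x within {x0..x1})"
    and contD: "continuous_on {x0..x1} D"
    and dD: "\<And>x. x \<in> {x0<..<x1} \<Longrightarrow> (D has_real_derivative - (l * \<Phi> x powr (p - 1))) (at x)"
begin

lemma d\<Phi>_at: "x \<in> {x0<..<x1} \<Longrightarrow> (\<Phi> has_real_derivative psi_p p (D x)) (at x)"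
  using d\<Phi>[of x] at_within_Icc_at[of x0 x x1] by auto

lemma cont\<Phi>: "continuous_on {x0..x1} \<Phi>"
  using d\<Phi> by (meson DERIV_continuous continuous_on_eq_continuous_within)

lemma D_antimono:
  assumes "0 \<le> l" "x0 \<le> x" "x \<le> y" "y \<le> x1"
  shows "D y \<le> D x"
proof (rule DERIV_nonpos_imp_decreasing_open[OF assms(3)])
  show "\<exists>d. (D has_real_derivative d) (at t) \<and> d \<le> 0" if "x < t" "t < y" for t
    using dD[of t] that assms by (intro exI[of _ "- (l * \<Phi> t powr (p - 1))"]) auto
qed (use assms in \<open>auto intro: continuous_on_subset[OF contD]\<close>)

lemma D_mono:
  assumes "l \<le> 0" "x0 \<le> x" "x \<le> y" "y \<le> x1"
  shows "D x \<le> D y"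
proof (rule DERIV_nonneg_imp_increasing_open[OF assms(3)])
  show "\<exists>d. (D has_real_derivative d) (at t) \<and> 0 \<le> d" if "x < t" "t < y" for t
    using dD[of t] that assms
    by (intro exI[of _ "- (l * \<Phi> t powr (p - 1))"]) (auto simp: mult_nonpos_nonneg)
qed (use assms in \<open>auto intro: continuous_on_subset[OF contD]\<close>)

lemma \<Phi>_mono:
  assumes "x0 \<le> x" "x \<le> y" "y \<le> x1" "\<And>t. \<lbrakk>x < t; t < y\<rbrakk> \<Longrightarrow> 0 \<le> D t"
  shows "\<Phi> x \<le> \<Phi> y"
proof (rule DERIV_nonneg_imp_increasing_open[OF assms(2)])
  show "\<exists>d. (\<Phi> has_real_derivative d) (at t) \<and> 0 \<le> d" if "x < t" "t < y" for t
    using d\<Phi>_at[of t] that assms p by (intro exI[of _ "psi_p p (D t)"]) auto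
qed (use assms in \<open>auto intro: continuous_on_subset[OF cont\<Phi>]\<close>)

lemma \<Phi>_antimono:
  assumes "x0 \<le> x" "x \<le> y" "y \<le> x1" "\<And>t. \<lbrakk>x < t; t < y\<rbrakk> \<Longrightarrow> D t \<le> 0"
  shows "\<Phi> y \<le> \<Phi> x"
proof (rule DERIV_nonpos_imp_decreasing_open[OF assms(2)])
  show "\<exists>d. (\<Phi> has_real_derivative d) (at t) \<and> d \<le> 0" if "x < t" "t < y" for t
    using d\<Phi>_at[of t] that assms p psi_p_le_iff[of p "D t" 0]
    by (intro exI[of _ "psi_p p (D t)"]) auto
qed (use assms in \<open>auto intro: continuous_on_subset[OF cont\<Phi>]\<close>)

lemma mid: "(x0 + x1) / 2 \<in> {x0<..<x1}" "0 < \<Phi> ((x0 + x1) / 2)"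
  using x01 by (auto intro!: pos)

text \<open>For nonpositive \<open>l\<close> the flux is nondecreasing; once positive, which must
  happen for \<Phi> to leave zero, it stays so, and \<Phi> cannot return to zero.\<close>

lemma l_pos: "0 < l"
proof (rule ccontr)
  assume "\<not> 0 < l"
  then have l: "l \<le> 0" by simp
  let ?c = "(x0 + x1) / 2"
  have "\<exists>t\<in>{x0<..<?c}. 0 < D t"
  proof (rule ccontr)
    assume "\<not> (\<exists>t\<in>{x0<..<?c}. 0 < D t)"
    then have "\<Phi> ?c \<le> \<Phi> x0"
      using x01 by (intro \<Phi>_antimono) (auto simp: not_less)
    then show False using mid zero by simp
  qed
  then obtain t where t: "x0 < t" "t < ?c" "0 < D t" by auto
  have "\<Phi> t \<le> \<Phi> x1"
  proof (rule \<Phi>_mono)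
    show "0 \<le> D s" if "t < s" "s < x1" for s
      using D_mono[OF l, of t s] t that by auto
  qed (use t mid in auto)
  moreover have "0 < \<Phi> t" using t mid by (intro pos) auto
  ultimately show False using zero by simp
qed

text \<open>A Hopf type statement: the flux is nonincreasing, so if it were not positive at the
  start, \<Phi> could never rise. The nonzero end slopes make quotients of eigenfunctions converge
  at the end points.\<close>

lemma D_x0_pos: "0 < D x0"
proof (rule ccontr)
  assume "\<not> 0 < D x0"
  then have "D t \<le> 0" if "x0 < t" "t < x1" for t
    using D_antimono[of x0 t] l_pos that by auto
  then have "\<Phi> ((x0 + x1) / 2) \<le> \<Phi> x0" using mid(1) by (intro \<Phi>_antimono) auto
  then show False using mid zero by simp
qed

lemma D_x1_neg: "D x1 < 0"
proof (rule ccontr)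
  assume "\<not> D x1 < 0"
  then have "0 \<le> D t" if "x0 < t" "t < x1" for t
    using D_antimono[of t x1] l_pos that by auto
  then have "\<Phi> ((x0 + x1) / 2) \<le> \<Phi> x1" using mid(1) by (intro \<Phi>_mono) auto
  then show False using mid zero by simp
qed

end

lemma eigenpair_imp_eigenfunction:
  assumes "1 < p" "x0 < x1" "eigenpair p x0 x1 l \<Phi>"
  shows "eigenfunction p x0 x1 l \<Phi> (\<lambda>x. phi_p p (deriv_on {x0..x1} \<Phi> x))"
proof
  have C1: "\<forall>x\<in>{x0..x1}. (\<Phi> has_real_derivative deriv_on {x0..x1} \<Phi> x) (at x within {x0..x1})"
    "continuous_on {x0..x1} (deriv_on {x0..x1} \<Phi>)"
    using assms unfolding eigenpair_def by (auto simp: C1_on_Icc_iff)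
  show "1 < p" "x0 < x1" by fact+
  show "\<Phi> x0 = 0" "\<Phi> x1 = 0" "\<And>x. x \<in> {x0<..<x1} \<Longrightarrow> 0 < \<Phi> x"
    using assms by (auto simp: eigenpair_def)
  show "(\<Phi> has_real_derivative psi_p p (phi_p p (deriv_on {x0..x1} \<Phi> x))) (at x within {x0..x1})"
    if "x \<in> {x0..x1}" for x using C1(1) that assms(1) by simp
  show "continuous_on {x0..x1} (\<lambda>x. phi_p p (deriv_on {x0..x1} \<Phi> x))"
    by (intro continuous_intros C1 assms)
  show "((\<lambda>x. phi_p p (deriv_on {x0..x1} \<Phi> x)) has_real_derivative - (l * \<Phi> x powr (p - 1))) (at x)"
    if "x \<in> {x0<..<x1}" for x
    by (rule has_field_derivative_transform_within_open[of "\<lambda>x. phi_p p (deriv \<Phi> x)" _ _ "{x0<..<x1}"])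
      (use assms that in \<open>auto simp: eigenpair_def deriv_on_interior\<close>)
qed

lemma eigenfunction_imp_eigenpair:
  assumes "eigenfunction p x0 x1 l \<Phi> D"
  shows "eigenpair p x0 x1 l \<Phi>"
proof -
  interpret eigenfunction p x0 x1 l \<Phi> D by fact
  have "((\<lambda>x. phi_p p (deriv \<Phi> x)) has_real_derivative - (l * \<Phi> x powr (p - 1))) (at x)"
    if "x \<in> {x0<..<x1}" for x
    by (rule has_field_derivative_transform_within_open[OF dD[OF that], of "{x0<..<x1}"])
      (use that p in \<open>auto simp: DERIV_imp_deriv[OF d\<Phi>_at]\<close>)
  moreover have "C1_on {x0..x1} \<Phi>"
    by (rule C1_on_IccI[OF x01 d\<Phi>]) (auto intro!: continuous_intros p contD)
  ultimately show ?thesis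
    using zero pos by (auto simp: eigenpair_def)
qed

lemma powr_quotient:
  fixes s t :: real
  assumes "0 < s" "0 < t"
  shows "s powr (p - 1) * s = s powr p" "t powr (p - 1) * t powr (1 - p) = 1"
    "s powr (p - 1) * t powr (1 - p) = (s / t) powr (p - 1)"
    "t powr (- p) * s powr p = (s / t) powr (p - 1) * (s / t)"
proof -
  have 1: "s powr (p - 1) * s = s powr p" if "0 < s" for s :: real
    using powr_add[of s "p - 1" 1] that by simp
  show "s powr (p - 1) * s = s powr p" using 1 assms by simp
  show "t powr (p - 1) * t powr (1 - p) = 1"
    using powr_add[of t "p - 1" "1 - p"] assms by simp
  have "t powr (1 - p) = 1 / t powr (p - 1)"
    using powr_minus_divide[of t "p - 1"] by simp
  then show "s powr (p - 1) * t powr (1 - p) = (s / t) powr (p - 1)"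
    using assms by (simp add: powr_divide)
  show "t powr (- p) * s powr p = (s / t) powr (p - 1) * (s / t)"
    using 1[of "s / t"] assms by (simp add: powr_divide powr_minus_divide)
qed

text \<open>Both functions vanish at e, so their quotient is a quotient of difference quotients,
  with nonzero slope in the denominator.\<close>

lemma eigenfunction_quotient_tendsto:
  assumes "eigenfunction p x0 x1 l1 u D1" "eigenfunction p x0 x1 l2 v D2" and e: "e \<in> {x0, x1}"
  shows "((\<lambda>x. u x / v x) \<longlongrightarrow> psi_p p (D1 e) / psi_p p (D2 e)) (at e within {x0..x1})"
proof -
  interpret A: eigenfunction p x0 x1 l1 u D1 by fact
  interpret B: eigenfunction p x0 x1 l2 v D2 by fact
  have ein: "e \<in> {x0..x1}" using e A.x01 by auto
  have z: "u e = 0" "v e = 0" using e A.zero B.zero by auto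
  have "psi_p p (D2 e) \<noteq> 0"
    using e B.D_x0_pos B.D_x1_neg by auto
  then have lim: "((\<lambda>y. ((u y - u e) / (y - e)) / ((v y - v e) / (y - e))) \<longlongrightarrow> psi_p p (D1 e) / psi_p p (D2 e))
      (at e within {x0..x1})"
    using A.d\<Phi>[OF ein] B.d\<Phi>[OF ein] unfolding has_field_derivative_iff by (intro tendsto_divide)
  show ?thesis
    by (rule Lim_transform_eventually[OF lim]) (auto simp: eventually_at_filter z)
qed

text \<open>Picone's identity: for the eigenvalues \<open>l1 < l2\<close> the function below would be strictly
  increasing although it vanishes at both end points.\<close>

lemma eigenvalue_le:
  assumes "eigenfunction p x0 x1 l1 u D1" "eigenfunction p x0 x1 l2 v D2"
  shows "l2 \<le> l1"
proof (rule ccontr)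
  assume "\<not> l2 \<le> l1"
  then have l12: "l1 < l2" by simp
  interpret A: eigenfunction p x0 x1 l1 u D1 by fact
  interpret B: eigenfunction p x0 x1 l2 v D2 by fact
  define G where "G = (\<lambda>x. D1 x * u x - D2 x * (u x powr p * v x powr (1 - p)))"
  have lim: "(G \<longlongrightarrow> 0) (at e within {x0..x1})" if e: "e \<in> {x0, x1}" for e
  proof -
    have ein: "e \<in> {x0..x1}" using e A.x01 by auto
    have "psi_p p (D1 e) / psi_p p (D2 e) \<noteq> 0"
      using e A.D_x0_pos A.D_x1_neg B.D_x0_pos B.D_x1_neg by auto
    then have q: "((\<lambda>x. (u x / v x) powr (p - 1)) \<longlongrightarrow> (psi_p p (D1 e) / psi_p p (D2 e)) powr (p - 1)) (at e within {x0..x1})"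
      by (intro tendsto_powr eigenfunction_quotient_tendsto[OF assms e] tendsto_const)
    have c: "(D1 \<longlongrightarrow> D1 e) (at e within {x0..x1})" "(D2 \<longlongrightarrow> D2 e) (at e within {x0..x1})"
      "(u \<longlongrightarrow> u e) (at e within {x0..x1})"
      using A.contD B.contD A.cont\<Phi> ein unfolding continuous_on_def by auto
    \<comment> \<open>Written as \<open>u x * (u x / v x) powr (p - 1)\<close>, the critical term is
      a factor tending to 0 times a factor with a finite limit.\<close>
    have "((\<lambda>x. D1 x * u x - D2 x * (u x * (u x / v x) powr (p - 1))) \<longlongrightarrow>
        D1 e * u e - D2 e * (u e * (psi_p p (D1 e) / psi_p p (D2 e)) powr (p - 1))) (at e within {x0..x1})"
      by (intro tendsto_intros c q)
    moreover have "u e = 0" using e A.zero by auto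
    ultimately have "((\<lambda>x. D1 x * u x - D2 x * (u x * (u x / v x) powr (p - 1))) \<longlongrightarrow> 0) (at e within {x0..x1})"
      by simp
    then show ?thesis
    proof (rule Lim_transform_eventually)
      have "D1 x * u x - D2 x * (u x * (u x / v x) powr (p - 1)) = G x" if x: "x \<in> {x0<..<x1}" for x
      proof -
        have pos: "0 < u x" "0 < v x" using A.pos B.pos x by auto
        from powr_quotient[OF this, of p]
        have "u x * (u x / v x) powr (p - 1) = u x powr p * v x powr (1 - p)"
          by (metis mult.assoc mult.commute)
        then show ?thesis by (simp add: G_def)
      qed
      then show "\<forall>\<^sub>F x in at e within {x0..x1}. D1 x * u x - D2 x * (u x * (u x / v x) powr (p - 1)) = G x"
        using e A.x01 unfolding eventually_at by (intro exI[of _ "x1 - x0"]) (auto simp: dist_real_def)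
    qed
  qed
  have dG: "\<exists>d. (G has_real_derivative d) (at x) \<and> 0 < d" if x: "x \<in> {x0<..<x1}" for x
  proof -
    have pos: "0 < u x" "0 < v x" using A.pos B.pos x by auto
    define \<alpha> where "\<alpha> = psi_p p (D1 x)"
    define \<beta> where "\<beta> = psi_p p (D2 x)"
    define R where "R = u x / v x"
    have "0 < R" using pos by (simp add: R_def)
    have der: "(G has_real_derivative
        ((- (l1 * u x powr (p - 1))) * u x + \<alpha> * D1 x)
        - ((- (l2 * v x powr (p - 1))) * (u x powr p * v x powr (1 - p))
          + ((p * u x powr (p - of_nat 1) * \<alpha>) * v x powr (1 - p)
             + ((1 - p) * v x powr ((1 - p) - of_nat 1) * \<beta>) * u x powr p) * D2 x)) (at x)"
      unfolding G_def \<alpha>_def \<beta>_def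
      by (intro DERIV_diff DERIV_mult DERIV_fun_powr A.dD B.dD A.d\<Phi>_at B.d\<Phi>_at x pos)
    have e1: "u x powr (p - 1) * u x = u x powr p" "v x powr (p - 1) * v x powr (1 - p) = 1"
      "u x powr (p - 1) * v x powr (1 - p) = R powr (p - 1)"
      "v x powr (- p) * u x powr p = R powr (p - 1) * R"
      using powr_quotient[OF pos, of p] by (simp_all add: R_def)
    \<comment> \<open>Young's inequality with s = u' and t = v' u / v. The derivative of
      \<open>G\<close> is this nonnegative expression plus
      \<open>(l2 - l1) * u x powr p\<close>.\<close>
    have Y: "0 \<le> D1 x * \<alpha> - p * (D2 x * R powr (p - 1) * \<alpha>) + (p - 1) * (D2 x * R powr (p - 1) * (\<beta> * R))"
    proof -
      have "phi_p p (\<beta> * R) = phi_p p \<beta> * R powr (p - 1)"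
      proof -
        have "R powr (p - 1) = R powr (p - 2) * R"
          using \<open>0 < R\<close> powr_add[of R "p - 2" 1] by simp
        then show ?thesis using \<open>0 < R\<close> by (simp add: phi_p_def abs_mult powr_mult)
      qed
      then have "phi_p p (\<beta> * R) = D2 x * R powr (p - 1)" "phi_p p \<alpha> = D1 x"
        using A.p by (simp_all add: \<alpha>_def \<beta>_def)
      then show ?thesis using Young_phi_p[OF A.p, of \<alpha> "\<beta> * R"] by simp
    qed
    let ?d = "((- (l1 * u x powr (p - 1))) * u x + \<alpha> * D1 x)
        - ((- (l2 * v x powr (p - 1))) * (u x powr p * v x powr (1 - p))
          + ((p * u x powr (p - of_nat 1) * \<alpha>) * v x powr (1 - p)
             + ((1 - p) * v x powr ((1 - p) - of_nat 1) * \<beta>) * u x powr p) * D2 x)"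
    have "?d = - l1 * (u x powr (p - 1) * u x) + \<alpha> * D1 x
        + l2 * (v x powr (p - 1) * v x powr (1 - p)) * u x powr p
        - p * \<alpha> * D2 x * (u x powr (p - 1) * v x powr (1 - p))
        + (p - 1) * \<beta> * D2 x * (v x powr (- p) * u x powr p)"
      by (simp add: algebra_simps)
    also have "\<dots> = (l2 - l1) * u x powr p + (D1 x * \<alpha> - p * (D2 x * R powr (p - 1) * \<alpha>)
        + (p - 1) * (D2 x * R powr (p - 1) * (\<beta> * R)))"
      unfolding e1 by (simp add: algebra_simps)
    also have "\<dots> > 0" using Y l12 pos by (intro add_pos_nonneg) auto
    finally show ?thesis using der by blast
  qed
  have mono: "G x < G y" if "x0 < x" "x < y" "y < x1" for x y
    using that dG by (intro DERIV_pos_imp_increasing[of x y G]) auto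
  \<comment> \<open>Monotonicity is known only inside the interval, so the limits at the ends are
    compared with two interior points: 0 \<le> G c < G d \<le> 0.\<close>
  define c where "c = (x0 + x1) / 2"
  define d where "d = (c + x1) / 2"
  have cd: "x0 < c" "c < d" "d < x1" using A.x01 by (auto simp: c_def d_def field_simps)
  have nt: "at x0 within {x0..x1} \<noteq> bot" "at x1 within {x0..x1} \<noteq> bot"
    using A.x01 by (auto simp: trivial_limit_within islimpt_Icc)
  have "0 \<le> G c"
  proof (rule tendsto_upperbound[OF lim[of x0] _ nt(1)])
    show "\<forall>\<^sub>F x in at x0 within {x0..x1}. G x \<le> G c"
      unfolding eventually_at using cd mono[of _ c]
      by (intro exI[of _ "c - x0"]) (auto simp: dist_real_def intro!: less_imp_le)
  qed simp
  moreover have "G d \<le> 0"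
  proof (rule tendsto_lowerbound[OF lim[of x1] _ nt(2)])
    show "\<forall>\<^sub>F x in at x1 within {x0..x1}. G d \<le> G x"
      unfolding eventually_at using cd mono[of d]
      by (intro exI[of _ "x1 - d"]) (auto simp: dist_real_def intro!: less_imp_le)
  qed simp
  ultimately show False using mono[OF cd] by simp
qed

section \<open>Existence of the eigenvalue and a lower bound for it\<close>

lemma phi_p_pos_iff [simp]: "1 < p \<Longrightarrow> 0 < phi_p p t \<longleftrightarrow> 0 < t"
  using phi_p_less_iff[of p 0 t] by simp

lemma phi_p_nonneg_iff [simp]: "1 < p \<Longrightarrow> 0 \<le> phi_p p t \<longleftrightarrow> 0 \<le> t"
  using phi_p_le_iff[of p 0 t] by simp

lemma isCont_phi_p: "1 < p \<Longrightarrow> isCont (phi_p p) t"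
  using continuous_on_phi_p[of p UNIV "\<lambda>x. x"] by (simp add: continuous_on_eq_continuous_at continuous_on_id)

lemma psi_p_1 [simp]: "psi_p p 1 = 1"
  by (simp add: psi_p_def)

lemma phi_p_1 [simp]: "phi_p p 1 = 1"
  by (simp add: phi_p_def)

text \<open>The half eigenfunction is the solution with initial slope \<open>1\<close> up to the first zero of its
  slope. The nonlinearity is truncated at a height \<open>T\<close> that the solution cannot reach.\<close>

lemma half_eigenfunction:
  assumes p: "1 < p"
  obtains h u D where "0 < h" "plap_sys p 0 h u D (\<lambda>x. phi_p p (u x))" "u 0 = 0" "D h = 0"
    "\<And>x. x \<in> {0<..h} \<Longrightarrow> 0 < u x" "p / (p - 1) \<le> h powr (p / (p - 1))"
proof -
  \<comment> \<open>As long as u \<le> x \<le> 1/2, the flux loses at most 1/2 on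
    \<open>{0..1/2}\<close>; slopes of at least \<open>psi_p p (1 / 2)\<close> there bring u up to
    \<eta>.\<close>
  define \<eta> where "\<eta> = psi_p p (1 / 2) / 2"
  have "0 < \<eta>" using p by (simp add: \<eta>_def)
  have "\<eta> < 1" using psi_p_less_iff[OF p, of "1/2" 1] by (simp add: \<eta>_def)
  \<comment> \<open>\<open>T\<close> is both the height of the cut and the length of the interval.
    Were the flux positive throughout, it would fall after 1/2 at a rate of at least
    \<open>phi_p p \<eta>\<close>, more than 1 in total before \<open>T\<close>.\<close>
  define T where "T = 1 + 2 / phi_p p \<eta>"
  have f\<eta>: "0 < phi_p p \<eta>" using \<open>0 < \<eta>\<close> p by simp
  then have "1 < T" by (simp add: T_def)
  define f where "f = (\<lambda>(x::real) y. phi_p p (max 0 (min y T)))"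
  have f_nonneg: "0 \<le> f x y" for x y using p by (simp add: f_def)
  interpret caratheodory p 0 T f "\<lambda>_. phi_p p T"
  proof
    show "1 < p" by fact
    show "0 < T" using \<open>1 < T\<close> by simp
    show "(\<lambda>_. phi_p p T) integrable_on {0..T}" by (rule integrable_const_ivl)
    show "\<bar>f x y\<bar> \<le> phi_p p T" for x y
      using f_nonneg[of x y] p \<open>1 < T\<close> by (simp add: f_def)
    show "isCont (f x) y" for x y
      unfolding f_def by (intro isCont_o2[OF _ isCont_phi_p] continuous_intros p)
    show "(\<lambda>x. f x (v x)) \<in> borel_measurable (lebesgue_on {0..T})" if "continuous_on {0..T} v" for v
      unfolding f_def
      by (intro continuous_imp_measurable_on_sets_lebesgue continuous_intros p that) auto
  qed
  obtain u D where sys: "plap_sys p 0 T u D (\<lambda>x. f x (u x))" and u0: "u 0 = 0" and D0: "D 0 = 1"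
    by (rule ivp_exists)
  have D_anti: "D y \<le> D x" if "0 \<le> x" "x \<le> y" "y \<le> T" for x y
    using plap_sys_D_diff_bounds(2)[OF sys that, of 0] f_nonneg by simp
  have D_le: "D x \<le> 1" if "0 \<le> x" "x \<le> T" for x
    using D_anti[of 0 x] D0 that by simp
  have u_le: "u x \<le> x" if "0 \<le> x" "x \<le> T" for x
    using plap_sys_u_diff_bounds(1)[OF p sys, of 0 x 1] D_le that u0 by simp
  have "\<exists>x\<in>{0..T}. D x \<le> 0"
  proof (rule ccontr)
    assume "\<not> ?thesis"
    then have Dpos: "0 < D x" if "0 \<le> x" "x \<le> T" for x using that by (auto simp: not_le)
    have u_mono: "u x \<le> u y" if "0 \<le> x" "x \<le> y" "y \<le> T" for x y
      using that by (intro plap_sys_u_mono[OF p sys]) (auto intro!: less_imp_le[OF Dpos])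
    have f1: "f x (u x) \<le> 1" if "0 \<le> x" "x \<le> 1 / 2" for x
    proof -
      have "f x (u x) \<le> phi_p p 1"
        unfolding f_def phi_p_le_iff[OF p] using u_le[of x] that \<open>1 < T\<close> by simp
      then show ?thesis by simp
    qed
    have "1 / 2 \<le> D x" if "0 \<le> x" "x \<le> 1 / 2" for x
      using plap_sys_D_diff_bounds(1)[OF sys, of 0 x 1] f1 that \<open>1 < T\<close> D0 by simp
    then have "\<eta> \<le> u (1 / 2)"
      using plap_sys_u_diff_bounds(2)[OF p sys, of 0 "1/2" "1/2"] \<open>1 < T\<close> u0 by (simp add: \<eta>_def)
    then have "phi_p p \<eta> \<le> f x (u x)" if "1 / 2 \<le> x" "x \<le> T" for x
      unfolding f_def phi_p_le_iff[OF p] using u_mono[of "1/2" x] that \<open>\<eta> < 1\<close> \<open>1 < T\<close> by simp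
    then have "phi_p p \<eta> * (T - 1 / 2) \<le> D (1 / 2) - D T"
      using \<open>1 < T\<close> by (intro plap_sys_D_diff_bounds(2)[OF sys]) auto
    also have "\<dots> < 1" using D_le[of "1/2"] Dpos[of T] \<open>1 < T\<close> by simp
    finally show False using f\<eta> mult_pos_pos[OF f\<eta> f\<eta>] by (simp add: T_def field_simps)
  qed
  then obtain x where "0 \<le> x" "x \<le> T" "D x \<le> 0" by auto
  then obtain h where h: "0 \<le> h" "h \<le> x" "D h = 0"
    using IVT2'[of D x 0 0] D0 continuous_on_subset[OF plap_sys_continuous_D[OF sys], of "{0..x}"] by auto
  have hT: "h \<le> T" using h \<open>x \<le> T\<close> by simp
  have "0 < h" using h D0 by (cases "h = 0") auto
  have D_nonneg: "0 \<le> D t" if "0 \<le> t" "t \<le> h" for t using D_anti[of t h] h hT that by simp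
  have u_mono: "u s \<le> u t" if "0 \<le> s" "s \<le> t" "t \<le> h" for s t
    using that hT D_nonneg by (intro plap_sys_u_mono[OF p sys]) auto
  have u_nonneg: "0 \<le> u t" if "0 \<le> t" "t \<le> h" for t using u_mono[of 0 t] u0 that by simp
  \<comment> \<open>Flux at most 1 gives u t \<le> t \<le> T, so the cut is inactive.\<close>
  have f_eq: "f t (u t) = phi_p p (u t)" if "t \<in> {0..h}" for t
    using u_nonneg[of t] u_le[of t] that hT by (simp add: f_def)
  have sys': "plap_sys p 0 h u D (\<lambda>x. phi_p p (u x))"
    by (rule plap_sys_cong[OF plap_sys_subinterval[OF sys order_refl hT]]) (use f_eq in auto)
  \<comment> \<open>A zero at t would, by monotonicity, make u vanish on \<open>{0..t}\<close>; but
    then the flux would keep its value 1 and u t would be at least t.\<close>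
  have u_pos: "0 < u t" if "t \<in> {0<..h}" for t
  proof (rule ccontr)
    assume "\<not> 0 < u t"
    then have z: "u s = 0" if "s \<in> {0..t}" for s
      using u_mono[of s t] u_nonneg[of s] that \<open>t \<in> {0<..h}\<close> by auto
    have "1 \<le> D s" if "s \<in> {0..t}" for s
      using plap_sys_D_diff_bounds(1)[OF sys', of 0 s 0] z that \<open>t \<in> {0<..h}\<close> D0 by simp
    then have "t \<le> u t"
      using plap_sys_u_diff_bounds(2)[OF p sys', of 0 t 1] \<open>t \<in> {0<..h}\<close> u0 by simp
    then show False using z[of t] that by simp
  qed
  have uh: "0 < u h" using u_pos \<open>0 < h\<close> by simp
  \<comment> \<open>Since u is largest at h, comparison with the constant right-hand side
    \<open>phi_p p (u h)\<close> bounds u h by u h times h^q / q with q = p / (p - 1). Cancelling u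
    h gives h^q \<ge> q, the source of the eigenvalue bound.\<close>
  have "D t \<le> phi_p p (u h) * (h - t)" if "t \<in> {0..h}" for t
    using plap_sys_D_diff_bounds(1)[OF sys', of t h "phi_p p (u h)"] u_mono that h p by simp
  then have "u h - u 0 \<le> psi_p p (phi_p p (u h)) * ((h - 0) powr (p / (p - 1)) / (p / (p - 1)))"
    using h uh p by (intro plap_sys_growth(2)[OF p sys']) auto
  then have "u h * 1 \<le> u h * (h powr (p / (p - 1)) / (p / (p - 1)))"
    using u0 p by simp
  then have "1 \<le> h powr (p / (p - 1)) / (p / (p - 1))" using uh by (simp only: mult_le_cancel_left_pos)
  then have "p / (p - 1) \<le> h powr (p / (p - 1))" using p by (simp add: field_simps)
  then show thesis using that[of h u D] \<open>0 < h\<close> sys' u0 h(3) u_pos by blast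
qed

text \<open>The half eigenfunction, with zero slope at h, is continued evenly to
  \<open>{0..2 * h}\<close> and then rescaled to the given interval by a factor \<kappa>;
  homogeneity turns the eigenvalue 1 into \<kappa>^p.\<close>

lemma eigenfunction_exists:
  assumes p: "1 < p" and x01: "x0 < x1"
  obtains l \<Phi> D where "eigenfunction p x0 x1 l \<Phi> D"
    "(2 / (x1 - x0)) powr p * (p / (p - 1)) powr (p - 1) \<le> l"
proof -
  obtain h u D where h: "0 < h" and sys: "plap_sys p 0 h u D (\<lambda>x. phi_p p (u x))" and u0: "u 0 = 0" and Dh: "D h = 0"
    and u_pos: "\<And>x. x \<in> {0<..h} \<Longrightarrow> 0 < u x" and h_ge: "p / (p - 1) \<le> h powr (p / (p - 1))"
    using half_eigenfunction[OF p] by blast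
  define U where "U = (\<lambda>x. if x \<le> h then u x else u (2 * h - x))"
  define V where "V = (\<lambda>x. if x \<le> h then D x else - D (2 * h - x))"
  have L: "plap_sys p 0 h U V (\<lambda>x. phi_p p (U x))"
    by (rule plap_sys_cong[OF sys]) (auto simp: U_def V_def)
  have "plap_sys p (2 * h - h) (2 * h - 0) U V (\<lambda>x. phi_p p (U x))"
    by (rule plap_sys_cong[OF plap_sys_reflect[OF sys, of "2 * h"]]) (auto simp: U_def V_def Dh)
  then have R: "plap_sys p h (2 * h) U V (\<lambda>x. phi_p p (U x))" by simp
  have sysU: "plap_sys p 0 (2 * h) U V (\<lambda>x. phi_p p (U x))"
    by (rule plap_sys_glue[OF p L R]) (use h in auto)
  have U_ends: "U 0 = 0" "U (2 * h) = 0" using h u0 by (auto simp: U_def)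
  have U_pos: "0 < U x" if "x \<in> {0<..<2 * h}" for x
    using u_pos[of x] u_pos[of "2 * h - x"] that by (auto simp: U_def)
  have U_cont: "continuous_on {0..2 * h} U" by (rule plap_sys_continuous_u[OF p sysU])
  have dV: "(V has_real_derivative - phi_p p (U x)) (at x)" if x: "x \<in> {0<..<2 * h}" for x
  proof -
    have "((\<lambda>y. V 0 - integral {0..y} (\<lambda>x. phi_p p (U x))) has_real_derivative - phi_p p (U x)) (at x within {0..2 * h})"
      using x by (auto intro!: derivative_eq_intros integral_has_real_derivative continuous_intros p U_cont)
    then have "(V has_real_derivative - phi_p p (U x)) (at x within {0..2 * h})"
      by (rule has_field_derivative_transform_within[OF _ zero_less_one])
        (use plap_sysD(3)[OF sysU, of 0] x in fastforce)+
    then show ?thesis using x at_within_Icc_at[of 0 x "2 * h"] by simp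
  qed
  define \<kappa> where "\<kappa> = 2 * h / (x1 - x0)"
  have \<kappa>: "0 < \<kappa>" "\<kappa> * (x1 - x0) = 2 * h" using h x01 by (auto simp: \<kappa>_def)
  have range: "\<kappa> * (x - x0) \<in> {0..2 * h}" if "x \<in> {x0..x1}" for x
    using that \<kappa>(1) mult_left_mono[of "x - x0" "x1 - x0" \<kappa>] by (simp add: \<kappa>(2))
  have range': "\<kappa> * (x - x0) \<in> {0<..<2 * h}" if "x \<in> {x0<..<x1}" for x
    using that \<kappa>(1) mult_strict_left_mono[of "x - x0" "x1 - x0" \<kappa>] by (simp add: \<kappa>(2))
  have d\<kappa>: "((\<lambda>x. \<kappa> * (x - x0)) has_real_derivative \<kappa>) (at x within S)" for x S
    by (auto intro!: derivative_eq_intros)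
  \<comment> \<open>Slopes scale by \<kappa>, hence fluxes by
    \<open>\<kappa> powr (p - 1)\<close>.\<close>
  have \<kappa>_scale: "psi_p p (\<kappa> powr (p - 1) * t) = psi_p p t * \<kappa>" for t
    using \<kappa>(1) p by (simp add: psi_p_def abs_mult powr_mult powr_powr sgn_mult)
  have "eigenfunction p x0 x1 (\<kappa> powr p) (\<lambda>x. U (\<kappa> * (x - x0))) (\<lambda>x. \<kappa> powr (p - 1) * V (\<kappa> * (x - x0)))"
  proof
    show "1 < p" "x0 < x1" by fact+
    show "U (\<kappa> * (x0 - x0)) = 0" "U (\<kappa> * (x1 - x0)) = 0" using U_ends by (simp_all add: \<kappa>)
    show "0 < U (\<kappa> * (x - x0))" if "x \<in> {x0<..<x1}" for x using U_pos range'[OF that] .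
    show "((\<lambda>x. U (\<kappa> * (x - x0))) has_real_derivative psi_p p (\<kappa> powr (p - 1) * V (\<kappa> * (x - x0)))) (at x within {x0..x1})"
      if "x \<in> {x0..x1}" for x
    proof -
      have "(U has_real_derivative psi_p p (V (\<kappa> * (x - x0)))) (at (\<kappa> * (x - x0)) within (\<lambda>x. \<kappa> * (x - x0)) ` {x0..x1})"
        using plap_sys_has_derivative[OF p sysU range[OF that]] by (rule DERIV_subset) (use range in auto)
      from DERIV_image_chain[OF this d\<kappa>] show ?thesis
        by (simp add: \<kappa>_scale o_def)
    qed
    have "continuous_on {x0..x1} (\<lambda>x. V (\<kappa> * (x - x0)))"
      by (rule continuous_on_compose2[OF plap_sys_continuous_D[OF sysU]])
        (use range in \<open>auto intro!: continuous_intros\<close>)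
    then show "continuous_on {x0..x1} (\<lambda>x. \<kappa> powr (p - 1) * V (\<kappa> * (x - x0)))"
      by (intro continuous_intros)
    show "((\<lambda>x. \<kappa> powr (p - 1) * V (\<kappa> * (x - x0))) has_real_derivative
        - (\<kappa> powr p * U (\<kappa> * (x - x0)) powr (p - 1))) (at x)" if "x \<in> {x0<..<x1}" for x
    proof -
      have e: "\<kappa> powr (p - 1) * (- phi_p p (U (\<kappa> * (x - x0))) * \<kappa>) = - (\<kappa> powr p * U (\<kappa> * (x - x0)) powr (p - 1))"
        using powr_quotient(1)[of \<kappa> \<kappa> p] \<kappa>(1) U_pos[OF range'[OF that]] by (simp add: phi_p_nonneg)
      show ?thesis
        using DERIV_cmult[OF DERIV_chain2[OF dV[OF range'[OF that]] d\<kappa>], of "\<kappa> powr (p - 1)"] e by simp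
    qed
  qed
  moreover have "(2 / (x1 - x0)) powr p * (p / (p - 1)) powr (p - 1) \<le> \<kappa> powr p"
  proof -
    have "(p / (p - 1)) powr (p - 1) \<le> (h powr (p / (p - 1))) powr (p - 1)"
      using h_ge p by (intro powr_mono2) auto
    also have "\<dots> = h powr p" using p by (simp add: powr_powr)
    finally have "(2 / (x1 - x0)) powr p * (p / (p - 1)) powr (p - 1) \<le> (2 / (x1 - x0)) powr p * h powr p"
      by (intro mult_left_mono) auto
    also have "\<dots> = \<kappa> powr p" using h x01 by (simp add: \<kappa>_def powr_mult[symmetric] powr_divide)
    finally show ?thesis .
  qed
  ultimately show thesis by (rule that)
qed

text \<open>\<open>lambda1\<close> is a definite description, so the bound becomes available only
  after existence and uniqueness; uniqueness is \<open>eigenvalue_le\<close> used in both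
  directions.\<close>

lemma lambda1_ge:
  assumes p: "1 < p" and x01: "x0 < x1"
  shows "(2 / (x1 - x0)) powr p * (p / (p - 1)) powr (p - 1) \<le> lambda1 p x0 x1"
proof -
  obtain l \<Phi> D where l: "eigenfunction p x0 x1 l \<Phi> D"
    "(2 / (x1 - x0)) powr p * (p / (p - 1)) powr (p - 1) \<le> l"
    using eigenfunction_exists[OF assms] by blast
  have "lambda1 p x0 x1 = l"
    unfolding lambda1_eq
  proof (rule the_equality)
    show "\<exists>\<Phi>. eigenpair p x0 x1 l \<Phi>" using eigenfunction_imp_eigenpair[OF l(1)] by blast
    fix l' assume "\<exists>\<Phi>. eigenpair p x0 x1 l' \<Phi>"
    then obtain \<Phi>' where "eigenpair p x0 x1 l' \<Phi>'" by blast
    from eigenpair_imp_eigenfunction[OF assms this] l(1) show "l' = l"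
      using eigenvalue_le by (metis order_antisym)
  qed
  then show ?thesis using l(2) by simp
qed

section \<open>Weak solutions and the operator S\<close>

lemma continuous_on_Icc_bounded:
  fixes f :: "real \<Rightarrow> real"
  assumes "continuous_on {c..d} f"
  obtains B where "0 \<le> B" "\<And>x. x \<in> {c..d} \<Longrightarrow> \<bar>f x\<bar> \<le> B"
proof -
  obtain B where B: "\<forall>x\<in>f ` {c..d}. norm x \<le> B"
    using compact_imp_bounded[OF compact_continuous_image[OF assms compact_Icc]] unfolding bounded_iff ..
  show thesis by (rule that[of "max B 0"]) (use B in \<open>auto intro: max.coboundedI1\<close>)
qed

text \<open>The data live on the open interval while systems integrate over the closed one. The
  value 0 at the end points makes pointwise bounds hold there, where \<delta> vanishes.\<close>

definition restr :: "real \<Rightarrow> real \<Rightarrow> (real \<Rightarrow> real) \<Rightarrow> real \<Rightarrow> real" where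
  "restr a b m x = (if x \<in> {a<..<b} then m x else 0)"

lemma restr_interior [simp]: "a < x \<Longrightarrow> x < b \<Longrightarrow> restr a b m x = m x"
  by (simp add: restr_def)

lemma absolutely_integrable_restr:
  "restr a b m absolutely_integrable_on S \<longleftrightarrow> m absolutely_integrable_on {a<..<b}"
  if "{a<..<b} \<subseteq> S" "S \<in> sets lebesgue" for S
proof
  assume "restr a b m absolutely_integrable_on S"
  then have "restr a b m absolutely_integrable_on {a<..<b}"
    by (rule set_integrable_subset) (use that in auto)
  then show "m absolutely_integrable_on {a<..<b}"
    using set_integrable_cong[of lebesgue lebesgue "{a<..<b}" "{a<..<b}" "restr a b m" m] by simp
next
  assume "m absolutely_integrable_on {a<..<b}"
  then have "restr a b m absolutely_integrable_on UNIV"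
    unfolding restr_def[abs_def] absolutely_integrable_restrict_UNIV .
  then show "restr a b m absolutely_integrable_on S"
    by (rule set_integrable_subset) (use that in auto)
qed

text \<open>On a bounded interval 1 + |f|^q is an integrable majorant of |f|.\<close>

lemma Lp_on_absolutely_integrable:
  assumes "1 \<le> q" "Lp_on q {a<..<b} f"
  shows "f absolutely_integrable_on {a<..<b}"
proof (rule measurable_bounded_by_integrable_imp_absolutely_integrable)
  show "f \<in> borel_measurable (lebesgue_on {a<..<b})" using assms by (simp add: Lp_on_def)
  have "(\<lambda>x. \<bar>f x\<bar> powr q) integrable_on {a<..<b}"
    using assms by (intro integrable_on_lebesgue_on) (auto simp: Lp_on_def)
  then show "(\<lambda>x. 1 + \<bar>f x\<bar> powr q) integrable_on {a<..<b}"
    by (intro integrable_add) (auto simp: integrable_on_open_interval_real)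
  show "norm (f x) \<le> 1 + \<bar>f x\<bar> powr q" for x
  proof (cases "\<bar>f x\<bar> \<le> 1")
    case False
    then have "\<bar>f x\<bar> powr 1 \<le> \<bar>f x\<bar> powr q" using assms(1) by (intro powr_mono) auto
    then show ?thesis using False by simp
  qed (simp add: add_increasing2)
qed simp

lemma measurable_restr_mult:
  assumes "m \<in> borel_measurable (lebesgue_on {a<..<b})" "continuous_on {a<..<b} h"
  shows "(\<lambda>x. restr a b m x * h x) \<in> borel_measurable (lebesgue_on {a..b})"
proof -
  have "h \<in> borel_measurable (lebesgue_on {a<..<b})"
    using assms(2) by (rule continuous_imp_measurable_on_sets_lebesgue) simp
  then have "(\<lambda>x. m x * h x) \<in> borel_measurable (lebesgue_on {a<..<b})"
    using assms(1) by (rule borel_measurable_times[rotated])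
  then have "(\<lambda>x. if x \<in> {a<..<b} then m x * h x else 0) \<in> borel_measurable lebesgue"
    by (rule borel_measurable_if_I) simp
  moreover have "(\<lambda>x. if x \<in> {a<..<b} then m x * h x else 0) = (\<lambda>x. restr a b m x * h x)"
    by (auto simp: restr_def)
  ultimately show ?thesis by (simp add: measurable_restrict_space1)
qed

text \<open>For solutions of the singular problem the right-hand side need not be integrable up to
  the end points, so the system is demanded on compact subintervals only.\<close>

definition plap_sys_loc ::
    "real \<Rightarrow> real \<Rightarrow> real \<Rightarrow> (real \<Rightarrow> real) \<Rightarrow> (real \<Rightarrow> real) \<Rightarrow> (real \<Rightarrow> real) \<Rightarrow> bool" where
  "plap_sys_loc p a b u D f \<longleftrightarrow> (\<forall>c d. a < c \<and> c \<le> d \<and> d < b \<longrightarrow> plap_sys p c d u D f)"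

lemma plap_sys_imp_loc: "plap_sys p a b u D f \<Longrightarrow> plap_sys_loc p a b u D f"
  by (auto simp: plap_sys_loc_def intro: plap_sys_subinterval)

lemma plap_sys_locE:
  assumes "plap_sys_loc p a b u D f" "x \<in> {a<..<b}"
  obtains c d where "a < c" "c < x" "x < d" "d < b" "plap_sys p c d u D f"
proof (rule that[of "(a + x) / 2" "(x + b) / 2"])
  show "plap_sys p ((a + x) / 2) ((x + b) / 2) u D f"
    using assms unfolding plap_sys_loc_def by auto
qed (use assms in auto)

lemma plap_sys_loc_has_derivative:
  assumes "1 < p" "plap_sys_loc p a b u D f" "x \<in> {a<..<b}"
  shows "(u has_real_derivative psi_p p (D x)) (at x)"
  using plap_sys_locE[OF assms(2,3)] plap_sys_has_derivative_at[OF assms(1)]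
  by (metis greaterThanLessThan_iff)

lemma plap_sys_loc_continuous_D:
  assumes "plap_sys_loc p a b u D f"
  shows "continuous_on {a<..<b} D"
proof -
  have "isCont D x" if x: "x \<in> {a<..<b}" for x
  proof -
    obtain c d where "c < x" "x < d" "plap_sys p c d u D f"
      using plap_sys_locE[OF assms x] by metis
    then show ?thesis using plap_sys_continuous_D[of p c d u D f]
      by (intro continuous_on_interior[of "{c..d}" D]) auto
  qed
  then show ?thesis by (simp add: continuous_at_imp_continuous_on)
qed

lemma plap_sys_loc_C1:
  assumes "1 < p" "plap_sys_loc p a b u D f"
  shows "C1_on {a<..<b} u" "\<And>x. x \<in> {a<..<b} \<Longrightarrow> deriv u x = psi_p p (D x)"
proof -
  show d: "deriv u x = psi_p p (D x)" if "x \<in> {a<..<b}" for x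
    using plap_sys_loc_has_derivative[OF assms that] by (rule DERIV_imp_deriv)
  have "u differentiable_on {a<..<b}"
    unfolding differentiable_on_def
    using plap_sys_loc_has_derivative[OF assms] real_differentiable_def differentiable_at_withinI by blast
  moreover have "continuous_on {a<..<b} (deriv_on {a<..<b} u)"
    by (rule continuous_on_eq[OF continuous_on_psi_p[OF assms(1) plap_sys_loc_continuous_D[OF assms(2)]]])
      (simp add: deriv_on_Ioo d)
  ultimately show "C1_on {a<..<b} u" by (simp add: C1_on_def)
qed

section \<open>Absolute continuity of the flux and the weak form\<close>

lemma plap_sys_D_derivative_ae:
  assumes sys: "plap_sys p a b u D f"
  obtains N where "negligible N" "\<And>x. x \<in> {a<..<b} - N \<Longrightarrow> (D has_real_derivative - f x) (at x)"
proof -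
  obtain N where N: "negligible N"
    "\<And>x. x \<in> {a<..<b} - N \<Longrightarrow> ((\<lambda>x. integral {a..x} f) has_real_derivative f x) (at x)"
    using integral_differentiable_ae[OF plap_sysD(2)[OF sys]] by blast
  have "(D has_real_derivative - f x) (at x)" if x: "x \<in> {a<..<b} - N" for x
  proof -
    have "((\<lambda>x. D a - integral {a..x} f) has_real_derivative - f x) (at x)"
      using DERIV_diff[OF DERIV_const N(2)[OF x], of "D a"] by simp
    moreover have "D a - integral {a..y} f = D y" if "y \<in> {a<..<b}" for y
      using plap_sysD(3)[OF sys, of a y] that by auto
    ultimately show ?thesis
      using has_field_derivative_transform_within_open[of "\<lambda>x. D a - integral {a..x} f" "- f x" x "{a<..<b}" D] x
      by auto
  qed
  with N(1) show thesis by (rule that)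
qed

lemma plap_sys_D_abs_cont:
  assumes sys: "plap_sys p a b u D f"
  shows "abs_cont_on a b D"
proof (rule abs_cont_on_integral_bound[of "\<lambda>x. \<bar>f x\<bar>"])
  show fi: "(\<lambda>x. \<bar>f x\<bar>) integrable_on {a..b}"
    using plap_sysD(1)[OF sys] by (simp add: absolutely_integrable_on_def)
  show "\<bar>D y - D x\<bar> \<le> integral {x..y} (\<lambda>x. \<bar>f x\<bar>)" if "a \<le> x" "x \<le> y" "y \<le> b" for x y
    using plap_sys_D_bound[OF plap_sys_subinterval[OF sys that(1,3)], of "\<lambda>x. \<bar>f x\<bar>" y x] that
      integrable_on_subinterval[OF fi, of x y] by auto
qed simp

text \<open>The product rule for \<open>D * \<phi>\<close> holds only almost everywhere; the product
  is absolutely continuous, so its derivative may nevertheless be integrated, and the boundary terms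
  vanish.\<close>

lemma plap_sys_integration_by_parts:
  assumes sys: "plap_sys p c d u D f" and cd: "c < d"
    and \<phi>: "\<And>x. (\<phi> has_real_derivative \<phi>' x) (at x)" "continuous_on {c..d} \<phi>'" "\<phi> c = 0" "\<phi> d = 0"
  shows "(\<lambda>x. D x * \<phi>' x) absolutely_integrable_on {c..d}" "(\<lambda>x. f x * \<phi> x) absolutely_integrable_on {c..d}"
    and "integral {c..d} (\<lambda>x. D x * \<phi>' x) = integral {c..d} (\<lambda>x. f x * \<phi> x)"
proof -
  have D: "continuous_on {c..d} D" by (rule plap_sys_continuous_D[OF sys])
  have cont\<phi>: "continuous_on {c..d} \<phi>"
    using \<phi>(1) by (meson DERIV_isCont continuous_at_imp_continuous_on)
  obtain B where B: "0 \<le> B" "\<And>x. x \<in> {c..d} \<Longrightarrow> \<bar>D x\<bar> \<le> B"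
    using continuous_on_Icc_bounded[OF D] by blast
  obtain C where C: "0 \<le> C" "\<And>x. x \<in> {c..d} \<Longrightarrow> \<bar>\<phi> x\<bar> \<le> C"
    using continuous_on_Icc_bounded[OF cont\<phi>] by blast
  obtain C' where C': "0 \<le> C'" "\<And>x. x \<in> {c..d} \<Longrightarrow> \<bar>\<phi>' x\<bar> \<le> C'"
    using continuous_on_Icc_bounded[OF \<phi>(2)] by blast
  have fi: "(\<lambda>x. \<bar>f x\<bar>) integrable_on {c..d}"
    using plap_sysD(1)[OF sys] by (simp add: absolutely_integrable_on_def)
  show 1: "(\<lambda>x. D x * \<phi>' x) absolutely_integrable_on {c..d}"
    by (intro absolutely_integrable_continuous_real continuous_intros D \<phi>)
  show 2: "(\<lambda>x. f x * \<phi> x) absolutely_integrable_on {c..d}"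
    using absolutely_integrable_bounded_measurable_product_real[of \<phi> "{c..d}" f]
      continuous_imp_measurable_on_sets_lebesgue[OF cont\<phi>] plap_sysD(1)[OF sys]
      compact_imp_bounded[OF compact_continuous_image[OF cont\<phi> compact_Icc]]
    by (simp add: mult.commute)
  obtain N where N: "negligible N" "\<And>x. x \<in> {c<..<d} - N \<Longrightarrow> (D has_real_derivative - f x) (at x)"
    using plap_sys_D_derivative_ae[OF sys] by blast
  \<comment> \<open>The two terms of the majorant come from the splitting
    \<open>(D y - D x) * \<phi> y + D x * (\<phi> y - \<phi> x)\<close>.\<close>
  have "abs_cont_on c d (\<lambda>x. D x * \<phi> x)"
  proof (rule abs_cont_on_integral_bound[of "\<lambda>x. C * \<bar>f x\<bar> + B * C'"])
    show g: "(\<lambda>x. C * \<bar>f x\<bar> + B * C') integrable_on {c..d}"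
      by (intro integrable_add integrable_on_mult_right fi integrable_const_ivl)
    show "0 \<le> C * \<bar>f x\<bar> + B * C'" for x using B(1) C(1) C'(1) by simp
    fix x y assume xy: "c \<le> x" "x \<le> y" "y \<le> d"
    have fxy: "(\<lambda>x. \<bar>f x\<bar>) integrable_on {x..y}" using integrable_on_subinterval[OF fi] xy by auto
    have "\<bar>D y - D x\<bar> \<le> integral {x..y} (\<lambda>x. \<bar>f x\<bar>)"
      using plap_sys_D_bound[OF plap_sys_subinterval[OF sys xy(1,3)], of "\<lambda>x. \<bar>f x\<bar>" y x] xy fxy by auto
    then have "\<bar>(D y - D x) * \<phi> y\<bar> \<le> integral {x..y} (\<lambda>x. \<bar>f x\<bar>) * C"
      unfolding abs_mult using C(1) C(2)[of y] xy by (intro mult_mono) auto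
    moreover have "\<bar>\<phi> y - \<phi> x\<bar> \<le> C' * (y - x)"
      using field_differentiable_bound[of "{x..y}" \<phi> \<phi>' C' x y] C'(2) xy
        has_field_derivative_at_within[OF \<phi>(1)] by (auto simp: abs_minus_commute)
    then have "\<bar>D x * (\<phi> y - \<phi> x)\<bar> \<le> B * (C' * (y - x))"
      unfolding abs_mult using B(1) B(2)[of x] C'(1) xy by (intro mult_mono) auto
    moreover have "D y * \<phi> y - D x * \<phi> x = (D y - D x) * \<phi> y + D x * (\<phi> y - \<phi> x)" by (simp add: algebra_simps)
    moreover have "integral {x..y} (\<lambda>x. C * \<bar>f x\<bar> + B * C') = C * integral {x..y} (\<lambda>x. \<bar>f x\<bar>) + B * C' * (y - x)"
      using fxy xy by (subst Henstock_Kurzweil_Integration.integral_add) (auto intro!: integrable_on_mult_right)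
    ultimately show "\<bar>D y * \<phi> y - D x * \<phi> x\<bar> \<le> integral {x..y} (\<lambda>x. C * \<bar>f x\<bar> + B * C')"
      by (simp add: algebra_simps)
  qed
  moreover have "((\<lambda>x. D x * \<phi> x) has_real_derivative D x * \<phi>' x - f x * \<phi> x) (at x)" if "x \<in> {c<..<d} - N" for x
    using DERIV_mult[OF N(2)[OF that] \<phi>(1)[of x]] by (simp add: algebra_simps)
  ultimately have "((\<lambda>x. D x * \<phi>' x - f x * \<phi> x) has_integral D d * \<phi> d - D c * \<phi> c) {c..d}"
    using cd N(1) by (intro abs_cont_on_has_integral) auto
  then have "integral {c..d} (\<lambda>x. D x * \<phi>' x - f x * \<phi> x) = 0" using \<phi> by (simp add: integral_unique)
  then show "integral {c..d} (\<lambda>x. D x * \<phi>' x) = integral {c..d} (\<lambda>x. f x * \<phi> x)"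
    using set_lebesgue_integral_eq_integral(1)[OF 1] set_lebesgue_integral_eq_integral(1)[OF 2]
    by (simp add: Henstock_Kurzweil_Integration.integral_diff)
qed

lemma test_function_derivative:
  assumes "\<phi> \<in> test_functions a b"
  shows "(\<phi> has_real_derivative deriv \<phi> x) (at x)" "continuous_on S (deriv \<phi>)"
proof -
  have "((deriv ^^ k) \<phi>) differentiable_on UNIV" for k using assms by (simp add: test_functions_def)
  from this[of 0] this[of 1] have d: "\<phi> differentiable_on UNIV" "deriv \<phi> differentiable_on UNIV" by auto
  show "(\<phi> has_real_derivative deriv \<phi> x) (at x)"
    using d(1) by (simp add: differentiable_on_def DERIV_deriv_iff_real_differentiable)
  show "continuous_on S (deriv \<phi>)"
    using differentiable_imp_continuous_on[OF d(2)] continuous_on_subset by blast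
qed

lemma test_function_support:
  assumes \<phi>: "\<phi> \<in> test_functions a b" and "a < b"
  obtains c d where "a < c" "c < d" "d < b" "\<And>x. x \<notin> {c<..<d} \<Longrightarrow> \<phi> x = 0 \<and> deriv \<phi> x = 0"
proof -
  define K where "K = closure {x. \<phi> x \<noteq> 0}"
  have K: "compact K" "K \<subseteq> {a<..<b}" using \<phi> by (auto simp: test_functions_def K_def)
  have out: "\<phi> x = 0 \<and> deriv \<phi> x = 0" if "x \<notin> K" for x
  proof -
    have op: "open (- K)" using K(1) by (simp add: compact_imp_closed open_Compl)
    have z: "\<phi> y = 0" if "y \<in> - K" for y using that closure_subset[of "{x. \<phi> x \<noteq> 0}"] by (auto simp: K_def)
    have "(\<phi> has_real_derivative 0) (at x)"
      by (rule has_field_derivative_transform_within_open[of "\<lambda>_. 0" 0 x "- K"]) (use op z that in auto)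
    then show ?thesis using z that DERIV_imp_deriv by auto
  qed
  show thesis
  proof (cases "K = {}")
    case True
    then show thesis using out \<open>a < b\<close> by (intro that[of "(2 * a + b) / 3" "(a + 2 * b) / 3"]) auto
  next
    case False
    obtain s t where s: "s \<in> K" "\<And>x. x \<in> K \<Longrightarrow> s \<le> x" and t: "t \<in> K" "\<And>x. x \<in> K \<Longrightarrow> x \<le> t"
      using compact_attains_inf[OF K(1) False] compact_attains_sup[OF K(1) False] by blast
    have "a < s" "t < b" "s \<le> t" using s t K(2) by auto
    then show thesis
      using out s(2) t(2) by (intro that[of "(a + s) / 2" "(t + b) / 2"]) (auto, fastforce+)
  qed
qed

lemma set_integral_support:
  fixes g :: "real \<Rightarrow> real"
  assumes "a < c" "d < b" "\<And>x. x \<notin> {c<..<d} \<Longrightarrow> g x = 0" "g absolutely_integrable_on {c..d}"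
  shows "(LINT x:{a<..<b}|lebesgue. g x) = integral {c..d} g"
proof -
  have "(LINT x:{a<..<b}|lebesgue. g x) = (LINT x:{c..d}|lebesgue. g x)"
    unfolding set_lebesgue_integral_def
  proof (rule Bochner_Integration.integral_cong[OF refl])
    fix x
    show "indicator {a<..<b} x *\<^sub>R g x = indicator {c..d} x *\<^sub>R g x"
      using assms(1,2) assms(3)[of x] by (auto simp: indicator_def)
  qed
  then show ?thesis using set_lebesgue_integral_eq_integral(2)[OF assms(4)] by simp
qed

lemma solves_P_I:
  assumes p: "1 < p" and ab: "a < b" and sys: "plap_sys_loc p a b u D f"
    and f: "\<And>x. x \<in> {a<..<b} \<Longrightarrow> f x = m x * u x powr (- \<gamma>)"
    and u: "continuous_on {a..b} u" "\<And>x. x \<in> {a<..<b} \<Longrightarrow> 0 < u x" "u a = 0" "u b = 0"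
  shows "solves_P p a b m \<gamma> u"
  unfolding solves_P_def
proof (intro conjI ballI)
  show "C1_on {a<..<b} u" by (rule plap_sys_loc_C1(1)[OF p sys])
  fix \<phi> assume \<phi>: "\<phi> \<in> test_functions a b"
  obtain c d where cd: "a < c" "c < d" "d < b" and z: "\<And>x. x \<notin> {c<..<d} \<Longrightarrow> \<phi> x = 0 \<and> deriv \<phi> x = 0"
    using test_function_support[OF \<phi> ab] by metis
  have sys': "plap_sys p c d u D f" using sys cd by (auto simp: plap_sys_loc_def)
  have z_ends: "\<phi> c = 0" "\<phi> d = 0" using z[of c] z[of d] by auto
  note parts = plap_sys_integration_by_parts[OF sys' cd(2) test_function_derivative[OF \<phi>] z_ends]
  have "(LINT x:{a<..<b}|lebesgue. phi_p p (deriv u x) * deriv \<phi> x) = (LINT x:{a<..<b}|lebesgue. D x * deriv \<phi> x)"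
    by (rule set_lebesgue_integral_cong) (auto simp: plap_sys_loc_C1(2)[OF p sys] p)
  also have "\<dots> = integral {c..d} (\<lambda>x. D x * deriv \<phi> x)"
    by (rule set_integral_support[OF cd(1,3) _ parts(1)]) (use z in auto)
  also have "\<dots> = integral {c..d} (\<lambda>x. f x * \<phi> x)" by (rule parts(3))
  also have "\<dots> = (LINT x:{a<..<b}|lebesgue. f x * \<phi> x)"
    by (rule set_integral_support[OF cd(1,3) _ parts(2), symmetric]) (use z in auto)
  also have "\<dots> = (LINT x:{a<..<b}|lebesgue. m x * u x powr (- \<gamma>) * \<phi> x)"
    by (rule set_lebesgue_integral_cong) (auto simp: f)
  finally show "(LINT x:{a<..<b}|lebesgue. phi_p p (deriv u x) * deriv \<phi> x)
      = (LINT x:{a<..<b}|lebesgue. m x * u x powr (- \<gamma>) * \<phi> x)" .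
qed (use u in auto)

text \<open>The flux of a local system may have arbitrary values at the end points. It is replaced
  by the continuous extension that integrability of f provides, after which the equation for u
  extends by continuity.\<close>

lemma plap_sys_loc_extend:
  assumes p: "1 < p" and ab: "a < b" and loc: "plap_sys_loc p a b u D f"
    and f: "f absolutely_integrable_on {a..b}" and u: "continuous_on {a..b} u"
  obtains D' where "plap_sys p a b u D' f"
proof -
  define z where "z = (a + b) / 2"
  have z: "a < z" "z < b" using ab by (auto simp: z_def)
  have fi: "f integrable_on {a..b}" using f by (rule set_lebesgue_integral_eq_integral(1))
  have comb: "integral {a..x} f + integral {x..y} f = integral {a..y} f" if "a \<le> x" "x \<le> y" "y \<le> b" for x y
    using that integrable_on_subinterval[OF fi, of a y]
    by (intro Henstock_Kurzweil_Integration.integral_combine) auto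
  define D' where "D' = (\<lambda>x. (D z + integral {a..z} f) - integral {a..x} f)"
  have DD: "D' x = D x" if x: "a < x" "x < b" for x
  proof (cases "x \<le> z")
    case True
    have "plap_sys p x z u D f" using loc x z True by (auto simp: plap_sys_loc_def)
    from plap_sysD(3)[OF this, of x z] show ?thesis using comb[of x z] x z True by (simp add: D'_def)
  next
    case False
    have "plap_sys p z x u D f" using loc x z False by (auto simp: plap_sys_loc_def)
    from plap_sysD(3)[OF this, of z x] show ?thesis using comb[of z x] x z False by (simp add: D'_def)
  qed
  have D'c: "continuous_on {a..b} D'"
    unfolding D'_def by (intro continuous_intros indefinite_integral_continuous_1 fi)
  have psi: "(\<lambda>t. psi_p p (D' t)) integrable_on {a..b}"
    by (intro integrable_continuous_real continuous_intros p D'c)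
  \<comment> \<open>The defect of the second equation: constant inside the interval, hence on the
    closed interval by continuity.\<close>
  define w where "w = (\<lambda>x. u x - integral {a..x} (\<lambda>t. psi_p p (D' t)))"
  have w: "continuous_on {a..b} w"
    unfolding w_def by (intro continuous_intros u indefinite_integral_continuous_1 psi)
  have combp: "integral {a..x} (\<lambda>t. psi_p p (D' t)) + integral {x..y} (\<lambda>t. psi_p p (D' t)) = integral {a..y} (\<lambda>t. psi_p p (D' t))"
    if "a \<le> x" "x \<le> y" "y \<le> b" for x y
    using that integrable_on_subinterval[OF psi, of a y]
    by (intro Henstock_Kurzweil_Integration.integral_combine) auto
  have w_const: "w x = w y" if "a < x" "x \<le> y" "y < b" for x y
  proof -
    have "plap_sys p x y u D f" using loc that by (auto simp: plap_sys_loc_def)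
    from plap_sysD(4)[OF this, of x y] have "u y - u x = integral {x..y} (\<lambda>t. psi_p p (D t))" using that by simp
    also have "\<dots> = integral {x..y} (\<lambda>t. psi_p p (D' t))"
      using that by (intro Henstock_Kurzweil_Integration.integral_cong) (simp add: DD)
    finally show ?thesis using combp[of x y] that by (simp add: w_def)
  qed
  have "w x = w z" if "x \<in> {a..b}" for x
  proof (rule continuous_constant_on_closure[of "{a<..<b}" w "w z"])
    show "continuous_on (closure {a<..<b}) w" using w ab by simp
    show "w y = w z" if y: "y \<in> {a<..<b}" for y
    proof (cases "y \<le> z")
      case True
      then show ?thesis by (intro w_const) (use y z in auto)
    next
      case False
      then show ?thesis by (intro w_const[symmetric]) (use y z in auto)
    qed
    show "x \<in> closure {a<..<b}" using that ab by simp
  qed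
  then have weq: "w x = w y" if "x \<in> {a..b}" "y \<in> {a..b}" for x y using that by metis
  have "plap_sys p a b u D' f"
    unfolding plap_sys_def
  proof (intro conjI allI impI f)
    fix x y assume xy: "a \<le> x \<and> x \<le> y \<and> y \<le> b"
    show "D' x - D' y = integral {x..y} f" using comb[of x y] xy by (simp add: D'_def)
    show "u y - u x = integral {x..y} (\<lambda>t. psi_p p (D' t))"
      using weq[of x y] combp[of x y] xy by (simp add: w_def)
  qed
  then show thesis by (rule that)
qed

lemma plap_sys_C1:
  assumes "1 < p" "a < b" "plap_sys p a b u D f"
  shows "C1_on {a..b} u" "\<And>x. x \<in> {a..b} \<Longrightarrow> deriv_on {a..b} u x = psi_p p (D x)"
proof -
  note d = plap_sys_has_derivative[OF assms(1,3)]
  show "C1_on {a..b} u"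
    by (rule C1_on_IccI[OF assms(2) d]) (auto intro!: continuous_intros plap_sys_continuous_D[OF assms(3)] assms(1))
  show "deriv_on {a..b} u x = psi_p p (D x)" if "x \<in> {a..b}" for x
    by (rule has_real_derivative_deriv_on[OF assms(2) that d[OF that]])
qed

section \<open>The interior of the positive cone\<close>

lemma derivative_lower_bound_left:
  assumes ab: "a < b" and d: "(u has_real_derivative d) (at a within {a..b})" and u: "u a = 0"
    and k: "\<And>x. \<lbrakk>a < x; x < c\<rbrakk> \<Longrightarrow> k * (x - a) \<le> u x" and c: "a < c"
  shows "k \<le> d"
proof (rule tendsto_lowerbound)
  show "((\<lambda>y. (u y - u a) / (y - a)) \<longlongrightarrow> d) (at a within {a..b})"
    using d by (simp add: has_field_derivative_iff)
  show "\<forall>\<^sub>F y in at a within {a..b}. k \<le> (u y - u a) / (y - a)"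
    unfolding eventually_at using c k u by (intro exI[of _ "c - a"]) (auto simp: dist_real_def field_simps)
  show "at a within {a..b} \<noteq> bot" using ab by (simp add: trivial_limit_within islimpt_Icc)
qed

lemma derivative_upper_bound_right:
  assumes ab: "a < b" and d: "(u has_real_derivative d) (at b within {a..b})" and u: "u b = 0"
    and k: "\<And>x. \<lbrakk>c < x; x < b\<rbrakk> \<Longrightarrow> k * (b - x) \<le> u x" and c: "c < b"
  shows "d \<le> - k"
proof (rule tendsto_upperbound)
  show "((\<lambda>y. (u y - u b) / (y - b)) \<longlongrightarrow> d) (at b within {a..b})"
    using d by (simp add: has_field_derivative_iff)
  show "\<forall>\<^sub>F y in at b within {a..b}. (u y - u b) / (y - b) \<le> - k"
    unfolding eventually_at using c k u by (intro exI[of _ "b - c"]) (auto simp: dist_real_def field_simps)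
  show "at b within {a..b} \<noteq> bot" using ab by (simp add: trivial_limit_within islimpt_Icc)
qed

lemma bdist_pos: "x \<in> {a<..<b} \<Longrightarrow> 0 < bdist a b x"
  by (auto simp: bdist_def)

lemma bdist_nonneg: "x \<in> {a..b} \<Longrightarrow> 0 \<le> bdist a b x"
  by (auto simp: bdist_def)

lemma continuous_on_bdist [continuous_intros]: "continuous_on S (bdist a b)"
  unfolding bdist_def[abs_def] by (intro continuous_intros)

lemma P_interior_I:
  assumes p: "1 < p" and ab: "a < b" and sys: "plap_sys p a b u D f" and u: "u a = 0" "u b = 0"
    and k: "0 < k" "\<And>x. x \<in> {a<..<b} \<Longrightarrow> k * bdist a b x \<le> u x"
  shows "u \<in> P_interior a b"
proof -
  note C1 = plap_sys_C1[OF p ab sys]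
  have d: "(u has_real_derivative deriv_on {a..b} u x) (at x within {a..b})" if "x \<in> {a..b}" for x
    using C1(1) that by (simp add: C1_on_Icc_iff[OF ab])
  have "k \<le> deriv_on {a..b} u a"
  proof (rule derivative_lower_bound_left[OF ab d u(1)])
    show "k * (x - a) \<le> u x" if "a < x" "x < (a + b) / 2" for x
    proof -
      have "bdist a b x = x - a" using that by (simp add: bdist_def)
      then show ?thesis using k(2)[of x] that by simp
    qed
  qed (use ab in auto)
  moreover have "deriv_on {a..b} u b \<le> - k"
  proof (rule derivative_upper_bound_right[OF ab d u(2)])
    show "k * (b - x) \<le> u x" if "(a + b) / 2 < x" "x < b" for x
    proof -
      have "bdist a b x = b - x" using that by (simp add: bdist_def)
      then show ?thesis using k(2)[of x] that by simp
    qed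
  qed (use ab in auto)
  moreover have "0 < u x" if "x \<in> {a<..<b}" for x
    using k(1) k(2)[OF that] bdist_pos[OF that] by (meson less_le_trans mult_pos_pos)
  ultimately show ?thesis
    using C1(1) u k(1) by (auto simp: P_interior_def)
qed

text \<open>Near each end point half of the end slope serves as a bound; between these zones v has a
  positive minimum by compactness.\<close>

lemma P_interior_lower_bound:
  assumes ab: "a < b" and v: "v \<in> P_interior a b"
  obtains k where "0 < k" "\<And>x. x \<in> {a..b} \<Longrightarrow> k * bdist a b x \<le> v x"
proof -
  have C1: "C1_on {a..b} v" and v0: "v a = 0" "v b = 0" and vpos: "\<And>x. x \<in> {a<..<b} \<Longrightarrow> 0 < v x"
    and d0: "0 < deriv_on {a..b} v a" and d1: "deriv_on {a..b} v b < 0"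
    using v by (auto simp: P_interior_def)
  have d: "(v has_real_derivative deriv_on {a..b} v x) (at x within {a..b})" if "x \<in> {a..b}" for x
    using C1 that by (simp add: C1_on_Icc_iff[OF ab])
  have cont: "continuous_on {a..b} v"
    using d by (meson DERIV_continuous continuous_on_eq_continuous_within)
  define k0 where "k0 = deriv_on {a..b} v a / 2"
  define k1 where "k1 = - deriv_on {a..b} v b / 2"
  have "k0 < deriv_on {a..b} v a" "deriv_on {a..b} v b < - k1" using d0 d1 by (auto simp: k0_def k1_def)
  have k01: "0 < k0" "0 < k1" using d0 d1 by (auto simp: k0_def k1_def)
  have "((\<lambda>y. (v y - v a) / (y - a)) \<longlongrightarrow> deriv_on {a..b} v a) (at a within {a..b})"
    using d[of a] ab by (simp add: has_field_derivative_iff)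
  from order_tendstoD(1)[OF this \<open>k0 < deriv_on {a..b} v a\<close>]
  obtain e0 where e0: "0 < e0" "\<And>y. \<lbrakk>y \<in> {a..b}; y \<noteq> a; \<bar>y - a\<bar> < e0\<rbrakk> \<Longrightarrow> k0 < (v y - v a) / (y - a)"
    unfolding eventually_at by (auto simp: dist_real_def)
  have "((\<lambda>y. (v y - v b) / (y - b)) \<longlongrightarrow> deriv_on {a..b} v b) (at b within {a..b})"
    using d[of b] ab by (simp add: has_field_derivative_iff)
  from order_tendstoD(2)[OF this \<open>deriv_on {a..b} v b < - k1\<close>]
  obtain e1 where e1: "0 < e1" "\<And>y. \<lbrakk>y \<in> {a..b}; y \<noteq> b; \<bar>y - b\<bar> < e1\<rbrakk> \<Longrightarrow> (v y - v b) / (y - b) < - k1"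
    unfolding eventually_at by (auto simp: dist_real_def)
  \<comment> \<open>The last term of the minimum keeps the middle interval nonempty.\<close>
  define e where "e = min (min e0 e1) ((b - a) / 2)"
  have e: "0 < e" "e \<le> e0" "e \<le> e1" "a + e \<le> b - e" "e < b - a"
    using e0(1) e1(1) ab by (auto simp: e_def min_def field_simps)
  obtain s where s: "s \<in> {a + e..b - e}" "\<And>y. y \<in> {a + e..b - e} \<Longrightarrow> v s \<le> v y"
    using continuous_attains_inf[of "{a + e..b - e}" v] continuous_on_subset[OF cont, of "{a + e..b - e}"] e by auto
  have vs: "0 < v s" using vpos[of s] s(1) e(1) by auto
  define k where "k = min (min k0 k1) (v s / (b - a))"
  have k: "0 < k" "k \<le> k0" "k \<le> k1" "k \<le> v s / (b - a)"
    using k01 vs ab by (auto simp: k_def)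
  then have ks: "k * (b - a) \<le> v s" using ab by (simp add: pos_le_divide_eq)
  have "k * bdist a b x \<le> v x" if x: "x \<in> {a..b}" for x
  proof -
    consider "x = a" | "x = b" | "a < x" "x < a + e" | "b - e < x" "x < b" | "x \<in> {a + e..b - e}"
      using x by fastforce
    then show ?thesis
    proof cases
      case 3
      then have "k0 * (x - a) < v x" using e0(2)[of x] e v0 ab by (simp add: field_simps)
      moreover have "k * bdist a b x \<le> k0 * (x - a)"
        using k 3 x bdist_nonneg[OF x] by (intro mult_mono) (auto simp: bdist_def)
      ultimately show ?thesis by simp
    next
      case 4
      then have "k1 * (b - x) < v x" using e1(2)[of x] e v0 ab by (simp add: field_simps)
      moreover have "k * bdist a b x \<le> k1 * (b - x)"
        using k 4 x bdist_nonneg[OF x] by (intro mult_mono) (auto simp: bdist_def)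
      ultimately show ?thesis by simp
    next
      case 5
      have "k * bdist a b x \<le> k * (b - a)" using k x by (intro mult_left_mono) (auto simp: bdist_def)
      also note ks
      also note s(2)[OF 5]
      finally show ?thesis .
    qed (use v0 ab in \<open>auto simp: bdist_def\<close>)
  qed
  with k(1) show thesis by (rule that)
qed

text \<open>Its contrapositive is what gets used: two solutions with the same boundary values cannot
  have strictly ordered fluxes. This replaces a comparison principle.\<close>

lemma plap_sys_strict_compare:
  assumes p: "1 < p" and ab: "a < b" and s1: "plap_sys p a b u1 D1 f1" and s2: "plap_sys p a b u2 D2 f2"
    and D: "\<And>t. t \<in> {a..b} \<Longrightarrow> D2 t < D1 t"
  shows "u2 b - u2 a < u1 b - u1 a"
proof -
  have "u1 a - u2 a < u1 b - u2 b"
  proof (rule DERIV_pos_imp_increasing_open[OF ab, of "\<lambda>x. u1 x - u2 x"])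
    show "\<exists>d. ((\<lambda>x. u1 x - u2 x) has_real_derivative d) (at x) \<and> 0 < d" if "a < x" "x < b" for x
      using DERIV_diff[OF plap_sys_has_derivative_at[OF p s1, of x] plap_sys_has_derivative_at[OF p s2, of x]]
        that D[of x] p by (intro exI[of _ "psi_p p (D1 x) - psi_p p (D2 x)"]) auto
    show "continuous_on {a..b} (\<lambda>x. u1 x - u2 x)"
      by (intro continuous_intros plap_sys_continuous_u[OF p s1] plap_sys_continuous_u[OF p s2])
  qed
  then show ?thesis by simp
qed

text \<open>With equal right-hand sides the fluxes differ by a constant, and a nonzero constant
  would order them strictly.\<close>

lemma plap_sys_unique:
  assumes p: "1 < p" and ab: "a < b" and s1: "plap_sys p a b u1 D1 f" and s2: "plap_sys p a b u2 D2 f"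
    and z: "u1 a = 0" "u1 b = 0" "u2 a = 0" "u2 b = 0" and x: "x \<in> {a..b}"
  shows "u1 x = u2 x"
proof -
  have diff: "D1 t - D2 t = D1 a - D2 a" if "t \<in> {a..b}" for t
    using plap_sysD(3)[OF s1, of a t] plap_sysD(3)[OF s2, of a t] that by simp
  have "\<not> D2 a < D1 a"
  proof
    assume "D2 a < D1 a"
    then have "u2 b - u2 a < u1 b - u1 a"
      by (intro plap_sys_strict_compare[OF p ab s1 s2]) (use diff in fastforce)
    then show False using z by simp
  qed
  moreover have "\<not> D1 a < D2 a"
  proof
    assume "D1 a < D2 a"
    then have "u1 b - u1 a < u2 b - u2 a"
      by (intro plap_sys_strict_compare[OF p ab s2 s1]) (use diff in fastforce)
    then show False using z by simp
  qed
  ultimately have "D1 t = D2 t" if "t \<in> {a..b}" for t using diff[OF that] by simp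
  then have "integral {a..x} (\<lambda>t. psi_p p (D1 t)) = integral {a..x} (\<lambda>t. psi_p p (D2 t))"
    using x by (intro Henstock_Kurzweil_Integration.integral_cong) auto
  then show ?thesis using plap_sysD(4)[OF s1, of a x] plap_sysD(4)[OF s2, of a x] x z by simp
qed

lemma abs_cont_on_subset:
  assumes "abs_cont_on a b F" "a \<le> c" "d \<le> b" and eq: "\<And>x. x \<in> {c..d} \<Longrightarrow> F x = G x"
  shows "abs_cont_on c d G"
  unfolding abs_cont_on_def
proof (intro allI impI)
  fix \<epsilon> :: real assume "\<epsilon> > 0"
  from assms(1)[unfolded abs_cont_on_def, rule_format, OF this]
  obtain \<eta> where "\<eta> > 0" and \<eta>: "\<forall>(n::nat) l r. (\<forall>i<n. a \<le> l i \<and> l i \<le> r i \<and> r i \<le> b)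
      \<and> disjoint_family_on (\<lambda>i. {l i<..<r i}) {..<n} \<and> (\<Sum>i<n. r i - l i) < \<eta>
      \<longrightarrow> (\<Sum>i<n. \<bar>F (r i) - F (l i)\<bar>) < \<epsilon>"
    by (elim exE conjE)
  have "(\<Sum>i<n. \<bar>G (r i) - G (l i)\<bar>) < \<epsilon>"
    if lr: "\<forall>i<n. c \<le> l i \<and> l i \<le> r i \<and> r i \<le> d"
      and *: "disjoint_family_on (\<lambda>i. {l i<..<r i}) {..<n}" "(\<Sum>i<n. r i - l i) < \<eta>"
    for n :: nat and l r
  proof -
    have "(\<Sum>i<n. \<bar>F (r i) - F (l i)\<bar>) < \<epsilon>"
      by (rule \<eta>[rule_format]) (use lr * assms(2,3) in fastforce)
    moreover have "(\<Sum>i<n. \<bar>F (r i) - F (l i)\<bar>) = (\<Sum>i<n. \<bar>G (r i) - G (l i)\<bar>)"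
      by (intro sum.cong refl) (use lr eq in fastforce)
    ultimately show ?thesis by simp
  qed
  then show "\<exists>\<eta>>0. \<forall>(n::nat) l r. (\<forall>i<n. c \<le> l i \<and> l i \<le> r i \<and> r i \<le> d)
        \<and> disjoint_family_on (\<lambda>i. {l i<..<r i}) {..<n} \<and> (\<Sum>i<n. r i - l i) < \<eta>
        \<longrightarrow> (\<Sum>i<n. \<bar>G (r i) - G (l i)\<bar>) < \<epsilon>"
    using \<open>\<eta> > 0\<close> by (intro exI[of _ \<eta>]) auto
qed

lemma AE_lebesgue_on_Ioo_iff:
  "(AE x in lebesgue_on {a<..<b}. P x) \<longleftrightarrow> (\<exists>N. negligible N \<and> (\<forall>x\<in>{a<..<b::real} - N. P x))"
proof -
  have "(AE x in lebesgue_on {a<..<b}. P x) \<longleftrightarrow> (AE x in lebesgue. x \<in> {a<..<b} \<longrightarrow> P x)"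
    by (subst AE_restrict_space_iff) auto
  also have "\<dots> \<longleftrightarrow> (\<exists>N. negligible N \<and> (\<forall>x\<in>{a<..<b} - N. P x))"
  proof
    assume "AE x in lebesgue. x \<in> {a<..<b} \<longrightarrow> P x"
    then obtain N where "N \<in> null_sets lebesgue" "{x \<in> space lebesgue. \<not> (x \<in> {a<..<b} \<longrightarrow> P x)} \<subseteq> N"
      unfolding eventually_ae_filter by blast
    then show "\<exists>N. negligible N \<and> (\<forall>x\<in>{a<..<b} - N. P x)"
      by (intro exI[of _ N]) (auto simp: negligible_iff_null_sets)
  next
    assume "\<exists>N. negligible N \<and> (\<forall>x\<in>{a<..<b} - N. P x)"
    then obtain N where "N \<in> null_sets lebesgue" "\<forall>x\<in>{a<..<b} - N. P x"
      by (auto simp: negligible_iff_null_sets)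
    then show "AE x in lebesgue. x \<in> {a<..<b} \<longrightarrow> P x"
      by (intro AE_I'[of N]) auto
  qed
  finally show ?thesis .
qed

text \<open>One direction integrates the a.e. derivative of an absolutely continuous flux, the other
  is Lebesgue differentiation of an integral.\<close>

lemma dirichlet_sol_iff:
  assumes p: "1 < p" and ab: "a < b" and m: "m absolutely_integrable_on {a<..<b}"
  shows "dirichlet_sol p a b m v \<longleftrightarrow> (\<exists>D. plap_sys p a b v D (restr a b m)) \<and> v a = 0 \<and> v b = 0"
proof (intro iffI conjI)
  assume v: "dirichlet_sol p a b m v"
  then show "v a = 0" "v b = 0" by (auto simp: dirichlet_sol_def)
  define D where "D = (\<lambda>x. phi_p p (deriv_on {a..b} v x))"
  have AC: "abs_cont_on a b D" and C1: "C1_on {a..b} v"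
    using v by (auto simp: dirichlet_sol_def D_def)
  obtain N where N: "negligible N" "\<And>x. x \<in> {a<..<b} - N \<Longrightarrow> (D has_real_derivative - m x) (at x)"
    using v unfolding dirichlet_sol_def AE_lebesgue_on_Ioo_iff D_def by blast
  have "plap_sys p a b v D (restr a b m)"
    unfolding plap_sys_def
  proof (intro conjI allI impI)
    show "restr a b m absolutely_integrable_on {a..b}"
      using m by (subst absolutely_integrable_restr) auto
    fix x y assume xy: "a \<le> x \<and> x \<le> y \<and> y \<le> b"
    have "((\<lambda>t. - restr a b m t) has_integral D y - D x) {x..y}"
      using xy N by (intro abs_cont_on_has_integral[OF _ abs_cont_on_subset[OF AC] N(1)]) auto
    then show "D x - D y = integral {x..y} (restr a b m)"
      by (simp add: integral_unique has_integral_neg_iff)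
    have "((\<lambda>t. psi_p p (D t)) has_integral v y - v x) {x..y}"
    proof (rule fundamental_theorem_of_calculus)
      fix t assume t: "t \<in> {x..y}"
      have "(v has_real_derivative deriv_on {a..b} v t) (at t within {a..b})"
        using C1 t xy by (simp add: C1_on_Icc_iff[OF ab])
      then have "(v has_real_derivative psi_p p (D t)) (at t within {x..y})"
        using xy p by (auto simp: D_def intro: DERIV_subset)
      then show "(v has_vector_derivative psi_p p (D t)) (at t within {x..y})"
        by (simp add: has_real_derivative_iff_has_vector_derivative)
    qed (use xy in auto)
    then show "v y - v x = integral {x..y} (\<lambda>t. psi_p p (D t))" by (simp add: integral_unique)
  qed
  then show "\<exists>D. plap_sys p a b v D (restr a b m)" by (intro exI[of _ D])
next
  assume "(\<exists>D. plap_sys p a b v D (restr a b m)) \<and> v a = 0 \<and> v b = 0"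
  then obtain D where sys: "plap_sys p a b v D (restr a b m)" and v0: "v a = 0" "v b = 0" by blast
  note C1 = plap_sys_C1[OF p ab sys]
  have phi: "phi_p p (deriv_on {a..b} v x) = D x" if "x \<in> {a..b}" for x using C1(2)[OF that] p by simp
  obtain N where N: "negligible N" "\<And>x. x \<in> {a<..<b} - N \<Longrightarrow> (D has_real_derivative - restr a b m x) (at x)"
    using plap_sys_D_derivative_ae[OF sys] by blast
  have "((\<lambda>x. phi_p p (deriv_on {a..b} v x)) has_real_derivative - m x) (at x)" if "x \<in> {a<..<b} - N" for x
    by (rule has_field_derivative_transform_within_open[of D _ _ "{a<..<b}"])
      (use N(2)[OF that] that phi in auto)
  then have "AE x in lebesgue_on {a<..<b}. ((\<lambda>x. phi_p p (deriv_on {a..b} v x)) has_real_derivative - m x) (at x)"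
    unfolding AE_lebesgue_on_Ioo_iff using N(1) by blast
  moreover have "abs_cont_on a b (\<lambda>x. phi_p p (deriv_on {a..b} v x))"
    by (rule abs_cont_on_subset[OF plap_sys_D_abs_cont[OF sys]]) (auto simp: phi)
  ultimately show "dirichlet_sol p a b m v" using C1(1) v0 by (simp add: dirichlet_sol_def)
qed

text \<open>Existence is the boundary value problem with a right-hand side independent of u.
  Together with uniqueness on \<open>{a..b}\<close> and the extension by zero it makes the definite
  description meaningful.\<close>

lemma sol_op_plap_sys:
  assumes p: "1 < p" and ab: "a < b" and m: "m absolutely_integrable_on {a<..<b}"
  obtains D where "plap_sys p a b (sol_op p a b m) D (restr a b m)" "sol_op p a b m a = 0" "sol_op p a b m b = 0"
proof -
  have m0: "restr a b m absolutely_integrable_on {a..b}" using m by (subst absolutely_integrable_restr) auto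
  interpret caratheodory p a b "\<lambda>x y. restr a b m x" "\<lambda>x. \<bar>restr a b m x\<bar>"
    by standard (use p ab m0 absolutely_integrable_measurable[of "{a..b}" "restr a b m"]
        in \<open>auto simp: absolutely_integrable_on_def\<close>)
  obtain u D where u: "plap_sys p a b u D (restr a b m)" "u a = 0" "u b = 0" by (rule bvp_exists)
  define v where "v = (\<lambda>x. if x \<in> {a..b} then u x else 0)"
  have v: "plap_sys p a b v D (restr a b m)" by (rule plap_sys_cong[OF u(1)]) (auto simp: v_def)
  have v0: "v a = 0" "v b = 0" using u ab by (auto simp: v_def)
  have "sol_op p a b m = v"
    unfolding sol_op_def
  proof (rule the_equality)
    show "dirichlet_sol p a b m v \<and> (\<forall>x. x \<notin> {a..b} \<longrightarrow> v x = 0)"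
      using v v0 by (auto simp: dirichlet_sol_iff[OF p ab m] v_def)
    fix w assume w: "dirichlet_sol p a b m w \<and> (\<forall>x. x \<notin> {a..b} \<longrightarrow> w x = 0)"
    then obtain D' where D': "plap_sys p a b w D' (restr a b m)" "w a = 0" "w b = 0"
      by (auto simp: dirichlet_sol_iff[OF p ab m])
    show "w = v"
    proof
      fix x show "w x = v x"
      proof (cases "x \<in> {a..b}")
        case True
        then show ?thesis using plap_sys_unique[OF p ab D'(1) v D'(2,3) v0] by simp
      next
        case False
        then show ?thesis using w by (auto simp: v_def)
      qed
    qed
  qed
  then show thesis using that v v0 by simp
qed

section \<open>Part (i): small exponents\<close>

lemma powr_uminus_mono:
  fixes s t \<gamma> :: real
  assumes "0 < s" "s \<le> t" "0 \<le> \<gamma>"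
  shows "t powr (- \<gamma>) \<le> s powr (- \<gamma>)"
  using assms by (intro powr_mono2') auto

text \<open>As the exponent grows, the power moves away from 1 in one direction, fixed by whether t
  \<le> 1. Hence the error for one exponent controls all smaller ones.\<close>

lemma abs_powr_uminus_minus_one_mono:
  fixes t \<gamma> \<gamma>' :: real
  assumes "0 < t" "0 \<le> \<gamma>" "\<gamma> \<le> \<gamma>'"
  shows "\<bar>t powr (- \<gamma>) - 1\<bar> \<le> \<bar>t powr (- \<gamma>') - 1\<bar>"
proof (cases "t \<le> 1")
  case True
  have "1 \<le> t powr (- \<gamma>)"
    using powr_uminus_mono[OF assms(1) True assms(2)] by simp
  moreover have "t powr (- \<gamma>) \<le> t powr (- \<gamma>')"
    using True assms by (intro powr_mono') auto
  ultimately show ?thesis by simp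
next
  case False
  have "t powr (- \<gamma>) \<le> 1"
    using powr_uminus_mono[of 1 t \<gamma>] False assms(2) by simp
  moreover have "t powr (- \<gamma>') \<le> t powr (- \<gamma>)"
    using False assms by (intro powr_mono) auto
  ultimately show ?thesis by simp
qed

lemma integrable_bdist_singular:
  fixes r :: real
  assumes "- 1 < r" "a \<le> b"
  shows "(\<lambda>x. (x - a) powr r + (b - x) powr r) integrable_on {a..b}"
proof -
  have 1: "(\<lambda>x. (b - x) powr r) integrable_on {a..b}"
    using has_integral_reverse_powr[OF assms] by (auto simp: integrable_on_def)
  then have "(\<lambda>x. (x - a) powr r) integrable_on {a..b}"
    using integrable_reflect_about[of "\<lambda>x. (b - x) powr r" "a + b" a b] by simp
  with 1 show ?thesis by (intro integrable_add)
qed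

lemma divide_le_self:
  fixes x q :: real
  assumes "0 \<le> x" "1 \<le> q"
  shows "x / q \<le> x"
  using divide_left_mono[of 1 q x] assms by simp

text \<open>A bound for \<open>\<bar>c powr (- \<gamma>) - 1\<bar>\<close> over all c between k
  \<delta>(x) and R: the power is monotone in c, so its extreme values occur at the two ends of this
  range.\<close>

definition small_exp_err :: "real \<Rightarrow> real \<Rightarrow> real \<Rightarrow> real \<Rightarrow> real \<Rightarrow> real \<Rightarrow> real" where
  "small_exp_err a b k R \<gamma> x = \<bar>(k * bdist a b x) powr (- \<gamma>) - 1\<bar> + \<bar>R powr (- \<gamma>) - 1\<bar>"

lemma small_exp_err_bound:
  assumes "0 < k * bdist a b x" "k * bdist a b x \<le> c" "c \<le> R" "0 \<le> \<gamma>"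
  shows "\<bar>c powr (- \<gamma>) - 1\<bar> \<le> small_exp_err a b k R \<gamma> x"
  using powr_uminus_mono[OF assms(1,2,4)] powr_uminus_mono[of c R \<gamma>] assms
  unfolding small_exp_err_def by linarith

lemma small_exp_err_mono:
  assumes "0 < k" "0 < R" "x \<in> {a<..<b}" "0 \<le> \<gamma>" "\<gamma> \<le> \<gamma>'"
  shows "small_exp_err a b k R \<gamma> x \<le> small_exp_err a b k R \<gamma>' x"
  unfolding small_exp_err_def using assms bdist_pos[OF assms(3)]
  by (intro add_mono abs_powr_uminus_minus_one_mono) auto

lemma small_exp_err_continuous:
  assumes "0 < k"
  shows "continuous_on {a<..<b} (small_exp_err a b k R \<gamma>)"
proof -
  have "k * bdist a b x \<noteq> 0" if "x \<in> {a<..<b}" for x using bdist_pos[OF that] assms by simp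
  then show ?thesis
    unfolding small_exp_err_def[abs_def] by (intro continuous_intros) auto
qed

text \<open>Here m in L^(p') enters. Young's inequality with exponents p' and p separates |m| from
  (k \<delta>)^(-1/(2p)), and the p-th power of the latter is a multiple of \<delta>^(-1/2), which
  is integrable; this dictates the bound 1/(2p) on the exponent.\<close>

lemma small_exp_err_integrable:
  assumes p: "1 < p" and ab: "a < b" and m: "Lp_on (p / (p - 1)) {a<..<b} m"
    and k: "0 < k" "0 < R" and \<gamma>: "0 \<le> \<gamma>" "\<gamma> \<le> 1 / (2 * p)"
  shows "(\<lambda>x. restr a b m x * small_exp_err a b k R \<gamma> x) absolutely_integrable_on {a..b}"
proof (rule measurable_bounded_by_integrable_imp_absolutely_integrable)
  show "(\<lambda>x. restr a b m x * small_exp_err a b k R \<gamma> x) \<in> borel_measurable (lebesgue_on {a..b})"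
    using m by (intro measurable_restr_mult small_exp_err_continuous k) (auto simp: Lp_on_def)
  define q where "q = p / (p - 1)"
  define C where "C = 1 + \<bar>R powr (- (1 / (2 * p))) - 1\<bar>"
  define h where "h = (\<lambda>x. \<bar>m x\<bar> powr q + (k powr (- (1 / 2)) * ((x - a) powr (- (1 / 2)) + (b - x) powr (- (1 / 2)))
      + C * \<bar>restr a b m x\<bar>))"
  have q: "1 < q" "1 / q + 1 / p = 1" using p by (auto simp: q_def field_simps)
  have "(\<lambda>x. \<bar>m x\<bar> powr q) integrable_on {a<..<b}"
    using m by (intro integrable_on_lebesgue_on) (auto simp: Lp_on_def q_def)
  then have 1: "(\<lambda>x. \<bar>m x\<bar> powr q) integrable_on {a..b}" by (simp add: integrable_on_open_interval_real)
  have "m absolutely_integrable_on {a<..<b}"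
    using q by (intro Lp_on_absolutely_integrable[OF _ m]) (simp add: q_def)
  then have "restr a b m absolutely_integrable_on {a..b}" by (subst absolutely_integrable_restr) auto
  then have 2: "(\<lambda>x. \<bar>restr a b m x\<bar>) integrable_on {a..b}" by (simp add: absolutely_integrable_on_def)
  show "h integrable_on {a..b}"
    unfolding h_def using ab
    by (intro integrable_add[OF 1] integrable_add integrable_on_mult_right 2 integrable_bdist_singular) auto
  show "norm (restr a b m x * small_exp_err a b k R \<gamma> x) \<le> h x" if x: "x \<in> {a..b}" for x
  proof (cases "x \<in> {a<..<b}")
    case False
    then have "restr a b m x = 0" by (auto simp: restr_def)
    then show ?thesis by (simp add: h_def)
  next
    case True
    define d where "d = bdist a b x"
    have d: "0 < d" using bdist_pos[OF True] by (simp add: d_def)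
    define s where "s = (k * d) powr (- (1 / (2 * p)))"
    have "small_exp_err a b k R \<gamma> x \<le> small_exp_err a b k R (1 / (2 * p)) x"
      by (rule small_exp_err_mono[OF k True \<gamma>])
    also have "\<dots> \<le> s + C"
      unfolding small_exp_err_def C_def s_def d_def by (simp add: abs_if)
    finally have "\<bar>m x\<bar> * small_exp_err a b k R \<gamma> x \<le> \<bar>m x\<bar> * s + C * \<bar>m x\<bar>"
      using mult_left_mono[of "small_exp_err a b k R \<gamma> x" "s + C" "\<bar>m x\<bar>"] by (simp add: algebra_simps)
    also have "\<bar>m x\<bar> * s \<le> \<bar>m x\<bar> powr q / q + s powr p / p"
      using q p by (intro Youngs_inequality) (auto simp: s_def)
    also have "\<bar>m x\<bar> powr q / q \<le> \<bar>m x\<bar> powr q" using q by (intro divide_le_self) auto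
    also have "s powr p / p \<le> s powr p" using p by (intro divide_le_self) auto
    also have "s powr p = k powr (- (1 / 2)) * d powr (- (1 / 2))"
      using p k d by (simp add: s_def powr_powr powr_mult)
    also have "d powr (- (1 / 2)) \<le> (x - a) powr (- (1 / 2)) + (b - x) powr (- (1 / 2))"
      by (auto simp: d_def bdist_def min_def)
    finally show ?thesis using True k by (simp add: h_def abs_mult small_exp_err_def abs_of_nonneg)
  qed
qed simp

text \<open>The error tends to 0 pointwise along exponents tending to 0 and is dominated by the
  error for the exponent 1/(2p).\<close>

lemma small_exp_err_integral_small:
  assumes p: "1 < p" and ab: "a < b" and m: "Lp_on (p / (p - 1)) {a<..<b} m"
    and k: "0 < k" "0 < R" and \<eta>: "0 < \<eta>"
  obtains \<gamma> where "0 < \<gamma>" "\<gamma> \<le> 1 / (2 * p)"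
    "integral {a..b} (\<lambda>x. \<bar>restr a b m x * small_exp_err a b k R \<gamma> x\<bar>) < \<eta>"
proof -
  define \<Gamma> where "\<Gamma> = (\<lambda>n. (1 / (2 * p)) / real (Suc n))"
  have \<Gamma>: "0 < \<Gamma> n" "\<Gamma> n \<le> 1 / (2 * p)" for n
  proof -
    show "0 < \<Gamma> n" using p by (simp add: \<Gamma>_def)
    show "\<Gamma> n \<le> 1 / (2 * p)" unfolding \<Gamma>_def by (rule divide_le_self) (use p in auto)
  qed
  have \<Gamma>0: "\<Gamma> \<longlonglongrightarrow> 0"
    using lim_const_over_n[THEN LIMSEQ_Suc, of "1 / (2 * p)"] by (simp only: \<Gamma>_def)
  let ?E = "small_exp_err a b k R"
  have int: "(\<lambda>x. \<bar>restr a b m x * ?E \<gamma> x\<bar>) integrable_on {a..b}" if "0 \<le> \<gamma>" "\<gamma> \<le> 1 / (2 * p)" for \<gamma>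
    using small_exp_err_integrable[OF p ab m k that] by (simp add: absolutely_integrable_on_def)
  have "(\<lambda>n. integral {a..b} (\<lambda>x. \<bar>restr a b m x * ?E (\<Gamma> n) x\<bar>)) \<longlonglongrightarrow> integral {a..b} (\<lambda>x. 0)"
  proof (rule dominated_convergence(2))
    show "(\<lambda>x. \<bar>restr a b m x * ?E (\<Gamma> n) x\<bar>) integrable_on {a..b}" for n
      using \<Gamma>[of n] by (intro int) auto
    show "(\<lambda>x. \<bar>restr a b m x * ?E (1 / (2 * p)) x\<bar>) integrable_on {a..b}"
      using p by (intro int) auto
    have E_nonneg: "0 \<le> ?E \<gamma> x" for \<gamma> x by (simp add: small_exp_err_def)
    show "norm \<bar>restr a b m x * ?E (\<Gamma> n) x\<bar> \<le> \<bar>restr a b m x * ?E (1 / (2 * p)) x\<bar>" for n x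
    proof (cases "x \<in> {a<..<b}")
      case True
      have "?E (\<Gamma> n) x \<le> ?E (1 / (2 * p)) x"
        using \<Gamma>[of n] by (intro small_exp_err_mono k True) auto
      then show ?thesis by (simp add: abs_mult mult_left_mono E_nonneg)
    qed (auto simp: restr_def)
    show "(\<lambda>n. \<bar>restr a b m x * ?E (\<Gamma> n) x\<bar>) \<longlonglongrightarrow> 0" for x
    proof (cases "x \<in> {a<..<b}")
      case True
      have pos: "0 < k * bdist a b x" using bdist_pos[OF True] k by simp
      have "(\<lambda>n. \<bar>restr a b m x * ?E (\<Gamma> n) x\<bar>) \<longlonglongrightarrow>
          \<bar>restr a b m x * (\<bar>(k * bdist a b x) powr (- 0) - 1\<bar> + \<bar>R powr (- 0) - 1\<bar>)\<bar>"
        unfolding small_exp_err_def using pos k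
        by (intro tendsto_intros \<Gamma>0) auto
      then show ?thesis using bdist_pos[OF True] k by simp
    qed (auto simp: restr_def)
  qed
  then have "(\<lambda>n. integral {a..b} (\<lambda>x. \<bar>restr a b m x * ?E (\<Gamma> n) x\<bar>)) \<longlonglongrightarrow> 0" by simp
  from order_tendstoD(2)[OF this \<eta>]
  obtain n where "integral {a..b} (\<lambda>x. \<bar>restr a b m x * ?E (\<Gamma> n) x\<bar>) < \<eta>"
    by (metis (mono_tags, lifting) eventually_sequentially order_refl)
  with \<Gamma>[of n] show thesis by (rule that)
qed

lemma solution_small_gamma:
  assumes ab: "a < b" and p: "1 < p" and m: "Lp_on (p / (p - 1)) {a<..<b} m"
    and S: "sol_op p a b m \<in> P_interior a b"
  shows "\<exists>\<gamma>0>0. \<forall>\<gamma>. 0 < \<gamma> \<and> \<gamma> \<le> \<gamma>0 \<longrightarrow> (\<exists>u. solves_P p a b m \<gamma> u \<and> u \<in> P_interior a b)"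
proof -
  have "1 \<le> p / (p - 1)" using p by (simp add: field_simps)
  then have mi: "m absolutely_integrable_on {a<..<b}" using m by (rule Lp_on_absolutely_integrable)
  then have m0: "restr a b m absolutely_integrable_on {a..b}" by (subst absolutely_integrable_restr) auto
  define v where "v = sol_op p a b m"
  obtain Dm where vsys: "plap_sys p a b v Dm (restr a b m)" and v0: "v a = 0" "v b = 0"
    using sol_op_plap_sys[OF p ab mi] unfolding v_def by blast
  obtain k1 where k1: "0 < k1" "\<And>x. x \<in> {a..b} \<Longrightarrow> k1 * bdist a b x \<le> v x"
    using P_interior_lower_bound[OF ab S] unfolding v_def by blast
  \<comment> \<open>Half of the slope available under v is kept as a reserve: a deviation of at most
    k \<delta> from v leaves u \<ge> k \<delta>.\<close>
  define k where "k = k1 / 2"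
  have k: "0 < k" "\<And>x. x \<in> {a..b} \<Longrightarrow> 2 * (k * bdist a b x) \<le> v x"
    using k1 by (auto simp: k_def)
  obtain R0 where R0: "0 \<le> R0" "\<And>x. x \<in> {a..b} \<Longrightarrow> \<bar>v x\<bar> \<le> R0"
    using continuous_on_Icc_bounded[OF plap_sys_continuous_u[OF p vsys]] by blast
  \<comment> \<open>Large enough for v plus a deviation of \<open>k * (b - a)\<close>, so the upper
    cut is inactive as well.\<close>
  define R where "R = R0 + k * (b - a) + 1"
  have "0 \<le> k * (b - a)" using k(1) ab by simp
  then have R: "0 < R" using R0(1) by (simp add: R_def)
  have kR: "k * bdist a b x \<le> R" if "x \<in> {a..b}" for x
  proof -
    have "0 \<le> k * bdist a b x" using k(1) bdist_nonneg[OF that] by simp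
    then show ?thesis using k(2)[OF that] R0(2)[OF that] \<open>0 \<le> k * (b - a)\<close> unfolding R_def by linarith
  qed
  obtain M where M: "0 \<le> M" "\<And>x. x \<in> {a..b} \<Longrightarrow> \<bar>Dm x\<bar> \<le> M"
    using continuous_on_Icc_bounded[OF plap_sys_continuous_D[OF vsys]] by blast
  have "uniformly_continuous_on {- (M + 1)..M + 1} (psi_p p)"
    by (intro compact_uniformly_continuous continuous_at_imp_continuous_on ballI isCont_psi_p p compact_Icc)
  then obtain d where d: "0 < d" "\<And>s t. \<lbrakk>s \<in> {- (M + 1)..M + 1}; t \<in> {- (M + 1)..M + 1}; \<bar>s - t\<bar> < d\<rbrakk>
      \<Longrightarrow> \<bar>psi_p p s - psi_p p t\<bar> < k"
    unfolding uniformly_continuous_on_def dist_real_def using k(1) by metis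
  \<comment> \<open>The fluxes will differ by less than \<open>2 * \<eta>\<close>: one \<eta> from
    the initial values, one from the integrated error.\<close>
  define \<eta> where "\<eta> = min d 1 / 2"
  have \<eta>: "0 < \<eta>" "2 * \<eta> \<le> d" "2 * \<eta> \<le> 1" using d(1) by (auto simp: \<eta>_def)
  let ?E = "small_exp_err a b k R"
  obtain \<gamma>0 where \<gamma>0: "0 < \<gamma>0" "\<gamma>0 \<le> 1 / (2 * p)"
    and E_small: "integral {a..b} (\<lambda>x. \<bar>restr a b m x * ?E \<gamma>0 x\<bar>) < \<eta>"
    using small_exp_err_integral_small[OF p ab m k(1) R \<eta>(1)] by blast
  have E_int: "(\<lambda>x. \<bar>restr a b m x * ?E \<gamma>0 x\<bar>) integrable_on {a..b}"
    using small_exp_err_integrable[OF p ab m k(1) R, of \<gamma>0] \<gamma>0 by (simp add: absolutely_integrable_on_def)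
  have "\<exists>u. solves_P p a b m \<gamma> u \<and> u \<in> P_interior a b" if \<gamma>: "0 < \<gamma>" "\<gamma> \<le> \<gamma>0" for \<gamma>
  proof -
    \<comment> \<open>u is clamped to the range from k \<delta> to R, in which the error bound
      holds.\<close>
    define cl where "cl = (\<lambda>x y. max (k * bdist a b x) (min y R))"
    define f where "f = (\<lambda>x y. restr a b m x * cl x y powr (- \<gamma>))"
    have cl: "0 < cl x y" "k * bdist a b x \<le> cl x y" "cl x y \<le> R" if "x \<in> {a<..<b}" for x y
      using k(1) bdist_pos[OF that] kR[of x] that by (auto simp: cl_def intro: less_le_trans[OF _ max.cobounded1])
    have f_err: "\<bar>f x y - restr a b m x\<bar> \<le> \<bar>restr a b m x * ?E \<gamma>0 x\<bar>" for x y
    proof (cases "x \<in> {a<..<b}")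
      case True
      have "0 < k * bdist a b x" using k(1) bdist_pos[OF True] by simp
      then have "\<bar>cl x y powr (- \<gamma>) - 1\<bar> \<le> ?E \<gamma> x"
        using cl[OF True] \<gamma> by (intro small_exp_err_bound) auto
      also have "\<dots> \<le> ?E \<gamma>0 x" using \<gamma> by (intro small_exp_err_mono k R True) auto
      finally have "\<bar>cl x y powr (- \<gamma>) - 1\<bar> \<le> \<bar>?E \<gamma>0 x\<bar>" by simp
      then have "\<bar>restr a b m x\<bar> * \<bar>cl x y powr (- \<gamma>) - 1\<bar> \<le> \<bar>restr a b m x\<bar> * \<bar>?E \<gamma>0 x\<bar>"
        by (intro mult_left_mono) auto
      moreover have "f x y - restr a b m x = restr a b m x * (cl x y powr (- \<gamma>) - 1)"
        by (simp add: f_def algebra_simps)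
      ultimately show ?thesis by (simp add: abs_mult)
    qed (auto simp: f_def restr_def)
    interpret caratheodory p a b f "\<lambda>x. \<bar>restr a b m x\<bar> + \<bar>restr a b m x * ?E \<gamma>0 x\<bar>"
    proof
      show "1 < p" "a < b" by fact+
      show "(\<lambda>x. \<bar>restr a b m x\<bar> + \<bar>restr a b m x * ?E \<gamma>0 x\<bar>) integrable_on {a..b}"
        using m0 E_int by (intro integrable_add) (auto simp: absolutely_integrable_on_def)
      show "\<bar>f x y\<bar> \<le> \<bar>restr a b m x\<bar> + \<bar>restr a b m x * ?E \<gamma>0 x\<bar>" for x y
        using f_err[of x y] by linarith
      show "isCont (f x) y" for x y
      proof (cases "x \<in> {a<..<b}")
        case True
        have "max (k * bdist a b x) (min y R) \<noteq> 0" using cl(1)[OF True, of y] by (simp add: cl_def)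
        then show ?thesis unfolding f_def cl_def by (intro continuous_intros) auto
      qed (auto simp: f_def restr_def)
      show "(\<lambda>x. f x (w x)) \<in> borel_measurable (lebesgue_on {a..b})" if w: "continuous_on {a..b} w" for w
        unfolding f_def
      proof (rule measurable_restr_mult)
        show "m \<in> borel_measurable (lebesgue_on {a<..<b})" using m by (simp add: Lp_on_def)
        have "cl x (w x) \<noteq> 0" if "x \<in> {a<..<b}" for x using cl(1)[OF that, of "w x"] by simp
        moreover have "continuous_on {a<..<b} w" using w by (rule continuous_on_subset) auto
        ultimately show "continuous_on {a<..<b} (\<lambda>x. cl x (w x) powr (- \<gamma>))"
          unfolding cl_def by (intro continuous_intros) auto
      qed
    qed
    obtain u D where usys: "plap_sys p a b u D (\<lambda>x. f x (u x))" and u0: "u a = 0" "u b = 0" by (rule bvp_exists)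
    have D_diff: "\<bar>(D t - Dm t) - (D a - Dm a)\<bar> < \<eta>" if t: "t \<in> {a..b}" for t
    proof -
      have sub: "{a..t} \<subseteq> {a..b}" using t by auto
      have i1: "(\<lambda>x. f x (u x)) integrable_on {a..t}" "restr a b m integrable_on {a..t}"
        using integrable_on_subinterval[OF plap_sysD(2)[OF usys] sub] integrable_on_subinterval[OF plap_sysD(2)[OF vsys] sub] by auto
      have i2: "(\<lambda>x. \<bar>restr a b m x * ?E \<gamma>0 x\<bar>) integrable_on {a..t}"
        by (rule integrable_on_subinterval[OF E_int sub])
      have "(D t - Dm t) - (D a - Dm a) = - integral {a..t} (\<lambda>x. f x (u x) - restr a b m x)"
        using plap_sysD(3)[OF usys, of a t] plap_sysD(3)[OF vsys, of a t] t i1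
        by (simp add: Henstock_Kurzweil_Integration.integral_diff)
      also have "\<bar>\<dots>\<bar> \<le> integral {a..t} (\<lambda>x. \<bar>restr a b m x * ?E \<gamma>0 x\<bar>)"
        using integral_norm_bound_integral[OF integrable_diff[OF i1] i2] f_err by simp
      also have "\<dots> \<le> integral {a..b} (\<lambda>x. \<bar>restr a b m x * ?E \<gamma>0 x\<bar>)"
        using sub by (intro integral_subset_le i2 E_int) auto
      finally show ?thesis using E_small by simp
    qed
    \<comment> \<open>The flux difference varies by less than \<eta>. If it started beyond \<eta>,
      it would keep its sign and the fluxes would be strictly ordered, against the equal boundary
      values.\<close>
    have Da: "\<bar>D a - Dm a\<bar> \<le> \<eta>"
    proof (rule ccontr)
      assume "\<not> \<bar>D a - Dm a\<bar> \<le> \<eta>"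
      then consider "\<eta> < D a - Dm a" | "\<eta> < Dm a - D a" by linarith
      then show False
      proof cases
        case 1
        then have "v b - v a < u b - u a"
          using D_diff by (intro plap_sys_strict_compare[OF p ab usys vsys]) (fastforce simp: abs_less_iff)
        then show False using u0 v0 by simp
      next
        case 2
        then have "u b - u a < v b - v a"
          using D_diff by (intro plap_sys_strict_compare[OF p ab vsys usys]) (fastforce simp: abs_less_iff)
        then show False using u0 v0 by simp
      qed
    qed
    have psi_close: "\<bar>psi_p p (D t) - psi_p p (Dm t)\<bar> \<le> k" if t: "t \<in> {a..b}" for t
    proof -
      have "\<bar>D t - Dm t\<bar> < 2 * \<eta>" using D_diff[OF t] Da by linarith
      then have "\<bar>D t - Dm t\<bar> < d" "D t \<in> {- (M + 1)..M + 1}" "Dm t \<in> {- (M + 1)..M + 1}"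
        using \<eta> M(2)[OF t] by (auto simp: abs_le_iff abs_less_iff)
      then show ?thesis using d(2) by (intro less_imp_le) auto
    qed
    \<comment> \<open>\<open>u - v\<close> is Lipschitz with constant k and vanishes at both ends,
      so it is bounded by k \<delta> and not merely by a constant.\<close>
    have incr: "\<bar>(u y - v y) - (u x - v x)\<bar> \<le> k * (y - x)" if "a \<le> x" "x \<le> y" "y \<le> b" for x y
    proof -
      have i: "(\<lambda>t. psi_p p (D t)) integrable_on {x..y}" "(\<lambda>t. psi_p p (Dm t)) integrable_on {x..y}"
        using plap_sys_integrable_psi[OF p usys] plap_sys_integrable_psi[OF p vsys] that by auto
      have "(u y - v y) - (u x - v x) = integral {x..y} (\<lambda>t. psi_p p (D t) - psi_p p (Dm t))"
        using plap_sysD(4)[OF usys that] plap_sysD(4)[OF vsys that] i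
        by (simp add: Henstock_Kurzweil_Integration.integral_diff)
      also have "\<bar>\<dots>\<bar> \<le> integral {x..y} (\<lambda>t. k)"
        using integral_norm_bound_integral[OF integrable_diff[OF i] integrable_const_ivl] psi_close that by simp
      finally show ?thesis using that by (simp add: mult.commute)
    qed
    have close: "\<bar>u x - v x\<bar> \<le> k * bdist a b x" if "x \<in> {a..b}" for x
      using incr[of a x] incr[of x b] that u0 v0 by (auto simp: bdist_def min_def)
    have u_ge: "k * bdist a b x \<le> u x" and u_le: "u x \<le> R" if x: "x \<in> {a..b}" for x
    proof -
      show "k * bdist a b x \<le> u x" using close[OF x] k(2)[OF x] by linarith
      have "k * bdist a b x \<le> k * (b - a)"
        using k(1) x by (intro mult_left_mono) (auto simp: bdist_def)
      then show "u x \<le> R" using close[OF x] R0(2)[OF x] unfolding R_def by linarith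
    qed
    have "solves_P p a b m \<gamma> u"
    proof (rule solves_P_I[OF p ab plap_sys_imp_loc[OF usys] _ plap_sys_continuous_u[OF p usys] _ u0])
      fix x assume x: "x \<in> {a<..<b}"
      have "cl x (u x) = u x" using u_ge[of x] u_le[of x] x by (simp add: cl_def)
      then show "f x (u x) = m x * u x powr (- \<gamma>)" using x by (simp add: f_def)
      have "0 < k * bdist a b x" using k(1) bdist_pos[OF x] by simp
      then show "0 < u x" using u_ge[of x] x by simp
    qed
    moreover have "u \<in> P_interior a b"
      by (rule P_interior_I[OF p ab usys u0 k(1)]) (use u_ge in auto)
    ultimately show ?thesis by blast
  qed
  then show ?thesis using \<gamma>0(1) by blast
qed

section \<open>Part (ii): truncation and passage to the limit\<close>

text \<open>The floor k \<delta> makes the negative part of m harmless, since m^-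
  \<delta>^(-\<gamma>) is integrable. The constant floor \<epsilon> makes the right-hand side
  dominated by |m| \<epsilon>^(-\<gamma>) and is later sent to 0.\<close>

definition trunc_rhs :: "real \<Rightarrow> real \<Rightarrow> (real \<Rightarrow> real) \<Rightarrow> real \<Rightarrow> real \<Rightarrow> real \<Rightarrow> real \<Rightarrow> real \<Rightarrow> real" where
  "trunc_rhs a b m \<gamma> k \<epsilon> x y = restr a b m x * max (max y (k * bdist a b x)) \<epsilon> powr (- \<gamma>)"

lemma truncated_solution_exists:
  assumes p: "1 < p" and ab: "a < b" and m: "m absolutely_integrable_on {a<..<b}"
    and \<gamma>: "0 < \<gamma>" and \<epsilon>: "0 < \<epsilon>"
  obtains u D where "plap_sys p a b u D (\<lambda>x. trunc_rhs a b m \<gamma> k \<epsilon> x (u x))" "u a = 0" "u b = 0"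
proof -
  have m0: "restr a b m absolutely_integrable_on {a..b}" using m by (subst absolutely_integrable_restr) auto
  have pos: "0 < max (max y (k * bdist a b x)) \<epsilon>" for x y using \<epsilon> by (simp add: less_max_iff_disj)
  interpret caratheodory p a b "trunc_rhs a b m \<gamma> k \<epsilon>" "\<lambda>x. \<bar>restr a b m x\<bar> * \<epsilon> powr (- \<gamma>)"
  proof
    show "1 < p" "a < b" by fact+
    show "(\<lambda>x. \<bar>restr a b m x\<bar> * \<epsilon> powr (- \<gamma>)) integrable_on {a..b}"
      using m0 by (intro integrable_on_mult_left) (auto simp: absolutely_integrable_on_def)
    show "\<bar>trunc_rhs a b m \<gamma> k \<epsilon> x y\<bar> \<le> \<bar>restr a b m x\<bar> * \<epsilon> powr (- \<gamma>)" for x y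
      unfolding trunc_rhs_def abs_mult using powr_uminus_mono[OF \<epsilon>, of "max (max y (k * bdist a b x)) \<epsilon>" \<gamma>] \<gamma>
      by (intro mult_left_mono) auto
    show "isCont (trunc_rhs a b m \<gamma> k \<epsilon> x) y" for x y
      unfolding trunc_rhs_def[abs_def] using pos[of y x] by (intro continuous_intros) auto
    show "(\<lambda>x. trunc_rhs a b m \<gamma> k \<epsilon> x (v x)) \<in> borel_measurable (lebesgue_on {a..b})" if v: "continuous_on {a..b} v" for v
      unfolding trunc_rhs_def
    proof (rule measurable_restr_mult)
      show "m \<in> borel_measurable (lebesgue_on {a<..<b})"
        using m by (simp add: absolutely_integrable_measurable)
      have "continuous_on {a<..<b} v" using v by (rule continuous_on_subset) auto
      then show "continuous_on {a<..<b} (\<lambda>x. max (max (v x) (k * bdist a b x)) \<epsilon> powr (- \<gamma>))"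
        using pos by (intro continuous_intros) (auto simp: less_le)
    qed
  qed
  show thesis using bvp_exists that by blast
qed

text \<open>Since u has to return to 0 at b, a positive flux at x must vanish at some first later
  point. Up to there u is at least u x, so the flux lost on the way is at most the integral of h
  times (u x)^(-\<gamma>).\<close>

lemma flux_upper_bound:
  assumes p: "1 < p" and sys: "plap_sys p a b u D f" and ub: "u b = 0"
    and h: "h integrable_on {a..b}" "\<And>t. 0 \<le> h t"
    and f: "\<And>t s. \<lbrakk>t \<in> {a..b}; 0 < s; s \<le> u t\<rbrakk> \<Longrightarrow> \<bar>f t\<bar> \<le> h t * s powr (- \<gamma>)"
    and x: "x \<in> {a..b}" "0 < u x"
  shows "D x \<le> integral {a..b} h * u x powr (- \<gamma>)"
proof (cases "D x \<le> 0")
  case True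
  have "0 \<le> integral {a..b} h" using h by (intro Henstock_Kurzweil_Integration.integral_nonneg) auto
  then show ?thesis using True by (meson mult_nonneg_nonneg order_trans powr_ge_zero)
next
  case False
  define Z where "Z = {t \<in> {x..b}. D t \<le> 0}"
  have Dc: "continuous_on {x..b} D" using plap_sys_continuous_D[OF sys] x by (auto intro: continuous_on_subset)
  have Z_ne: "Z \<noteq> {}"
  proof
    assume "Z = {}"
    then have "u x \<le> u b"
      using x by (intro plap_sys_u_mono[OF p sys]) (auto simp: Z_def intro: less_imp_le)
    then show False using ub x by simp
  qed
  have Z_compact: "compact Z"
  proof -
    have Z_eq: "Z = {x..b} \<inter> D -` {..0}" by (auto simp: Z_def)
    have "closed Z" unfolding Z_eq by (intro continuous_closed_preimage Dc) auto
    then have "compact ({x..b} \<inter> Z)" by (intro compact_Int_closed) auto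
    moreover have "{x..b} \<inter> Z = Z" by (auto simp: Z_def)
    ultimately show ?thesis by simp
  qed
  obtain y where y: "y \<in> Z" "\<And>t. t \<in> Z \<Longrightarrow> y \<le> t"
    using compact_attains_inf[OF Z_compact Z_ne] by blast
  have yxb: "x \<le> y" "y \<le> b" "D y \<le> 0" using y(1) by (auto simp: Z_def)
  have pos: "0 < D t" if "x \<le> t" "t < y" for t
    using y(2)[of t] that yxb by (force simp: Z_def)
  have "0 \<le> D y"
  proof (rule ccontr)
    assume "\<not> 0 \<le> D y"
    then obtain t where "x \<le> t" "t \<le> y" "D t = 0"
      using IVT2'[of D y 0 x] False yxb continuous_on_subset[OF Dc, of "{x..y}"] by auto
    then show False using pos[of t] \<open>\<not> 0 \<le> D y\<close> by (cases "t = y") auto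
  qed
  then have Dnn: "0 \<le> D t" if "t \<in> {x..y}" for t using pos[of t] that by (cases "t = y") auto
  have u_ge: "u x \<le> u t" if "t \<in> {x..y}" for t
    using that x yxb Dnn by (intro plap_sys_u_mono[OF p sys]) auto
  have sub: "{x..y} \<subseteq> {a..b}" using x yxb by auto
  have hi: "h integrable_on {x..y}" by (rule integrable_on_subinterval[OF h(1) sub])
  have "D x \<le> integral {x..y} f"
    using plap_sysD(3)[OF sys, of x y] x yxb by simp
  also have "\<dots> \<le> integral {x..y} (\<lambda>t. h t * u x powr (- \<gamma>))"
  proof (rule integral_le)
    show "f integrable_on {x..y}" by (rule integrable_on_subinterval[OF plap_sysD(2)[OF sys] sub])
    show "(\<lambda>t. h t * u x powr (- \<gamma>)) integrable_on {x..y}" by (intro integrable_on_mult_left hi)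
    show "f t \<le> h t * u x powr (- \<gamma>)" if "t \<in> {x..y}" for t
      using f[of t "u x"] u_ge[OF that] that sub x by (force simp: abs_le_iff)
  qed
  also have "\<dots> = integral {x..y} h * u x powr (- \<gamma>)" by simp
  also have "\<dots> \<le> integral {a..b} h * u x powr (- \<gamma>)"
    using sub h by (intro mult_right_mono integral_subset_le hi) auto
  finally show ?thesis .
qed

text \<open>Reflection supplies the bound for the negative flux; the hypothesis on |f| is symmetric
  under it.\<close>

lemma flux_bound:
  assumes p: "1 < p" and sys: "plap_sys p a b u D f" and u0: "u a = 0" "u b = 0"
    and h: "h integrable_on {a..b}" "\<And>t. 0 \<le> h t"
    and f: "\<And>t s. \<lbrakk>t \<in> {a..b}; 0 < s; s \<le> u t\<rbrakk> \<Longrightarrow> \<bar>f t\<bar> \<le> h t * s powr (- \<gamma>)"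
    and x: "x \<in> {a..b}" "0 < u x"
  shows "\<bar>D x\<bar> \<le> integral {a..b} h * u x powr (- \<gamma>)"
proof -
  have "plap_sys p (a + b - b) (a + b - a) (\<lambda>x. u (a + b - x)) (\<lambda>x. - D (a + b - x)) (\<lambda>x. f (a + b - x))"
    by (rule plap_sys_reflect[OF sys])
  then have sys': "plap_sys p a b (\<lambda>x. u (a + b - x)) (\<lambda>x. - D (a + b - x)) (\<lambda>x. f (a + b - x))" by simp
  have h': "(\<lambda>t. h (a + b - t)) integrable_on {a..b}" using h(1) integrable_reflect_about[of h "a + b" a b] by simp
  have "- D (a + b - (a + b - x)) \<le> integral {a..b} (\<lambda>t. h (a + b - t)) * u (a + b - (a + b - x)) powr (- \<gamma>)"
    by (rule flux_upper_bound[OF p sys' _ h']) (use u0 h f x in auto)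
  moreover have "integral {a..b} (\<lambda>t. h (a + b - t)) = integral {a..b} h"
    using integral_reflect_about[of a b h "a + b"] by simp
  ultimately show ?thesis
    using flux_upper_bound[OF p sys u0(2) h f x] by (simp add: abs_le_iff)
qed

text \<open>The flux bound says that \<open>u\<^sup>q\<close> with \<open>q = 1 + \<gamma> / (p - 1)\<close> is Lipschitz with a constant
  that does not depend on the truncation.\<close>

lemma powr_solution_lipschitz:
  assumes p: "1 < p" and sys: "plap_sys p a b u D f" and \<gamma>: "0 < \<gamma>" and A: "0 \<le> A"
    and pos: "\<And>x. x \<in> {a<..<b} \<Longrightarrow> 0 < u x" and nn: "\<And>x. x \<in> {a..b} \<Longrightarrow> 0 \<le> u x"
    and D: "\<And>x. x \<in> {a<..<b} \<Longrightarrow> \<bar>D x\<bar> \<le> A * u x powr (- \<gamma>)"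
    and q: "q = 1 + \<gamma> / (p - 1)" and xy: "x \<in> {a..b}" "y \<in> {a..b}"
  shows "\<bar>u x powr q - u y powr q\<bar> \<le> q * psi_p p A * \<bar>x - y\<bar>"
proof -
  have q1: "1 < q" using \<gamma> p by (simp add: q)
  have cont: "continuous_on {a..b} (\<lambda>x. u x powr q)"
    using q1 nn by (intro continuous_on_powr' plap_sys_continuous_u[OF p sys] continuous_intros) auto
  have *: "\<bar>u y powr q - u x powr q\<bar> \<le> q * psi_p p A * (y - x)" if "a \<le> x" "x < y" "y \<le> b" for x y
  proof -
    have der: "((\<lambda>x. u x powr q) has_real_derivative q * u t powr (q - of_nat 1) * psi_p p (D t)) (at t)" if "t \<in> {a<..<b}" for t
      by (intro DERIV_fun_powr plap_sys_has_derivative_at[OF p sys that] pos that)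
    \<comment> \<open>q is chosen so that q - 1 = \<gamma> / (p - 1): differentiating the power
      produces exactly the factor that cancels the singular factor in the slope bound.\<close>
    have bd: "\<bar>q * u t powr (q - of_nat 1) * psi_p p (D t)\<bar> \<le> q * psi_p p A" if t: "t \<in> {a<..<b}" for t
    proof -
      have "\<bar>psi_p p (D t)\<bar> \<le> psi_p p (A * u t powr (- \<gamma>))"
        using D[OF t] p by (simp add: psi_p_abs)
      also have "\<dots> = psi_p p A * u t powr (- (\<gamma> / (p - 1)))"
        using A by (simp add: psi_p_mult powr_powr)
      finally have "u t powr (q - 1) * \<bar>psi_p p (D t)\<bar> \<le> u t powr (\<gamma> / (p - 1)) * (psi_p p A * u t powr (- (\<gamma> / (p - 1))))"
        by (simp add: q mult_left_mono)
      also have "\<dots> = psi_p p A" using pos[OF t] by (simp add: powr_minus field_simps)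
      finally show ?thesis using q1 by (simp add: abs_mult mult.assoc mult_left_mono)
    qed
    obtain t where "x < t" "t < y"
      and t: "u y powr q - u x powr q = (q * u t powr (q - of_nat 1) * psi_p p (D t)) * (y - x)"
    proof (rule mvt[OF \<open>x < y\<close>])
      show "continuous_on {x..y} (\<lambda>x. u x powr q)" using \<open>a \<le> x\<close> \<open>y \<le> b\<close> by (intro continuous_on_subset[OF cont]) auto
      show "((\<lambda>x. u x powr q) has_derivative (*) (q * u s powr (q - of_nat 1) * psi_p p (D s))) (at s)"
        if "x < s" "s < y" for s
        using der[of s] that \<open>a \<le> x\<close> \<open>y \<le> b\<close> by (simp add: has_field_derivative_def)
    qed blast
    then show ?thesis using bd[of t] that by (simp add: abs_mult mult_right_mono)
  qed
  show ?thesis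
    using *[of x y] *[of y x] xy by (cases x y rule: linorder_cases) (auto simp: abs_minus_commute)
qed

text \<open>The flux bound degenerates where u tends to 0, so compactness is taken for the powers
  u^q instead of u. Away from the end points the floor k \<delta> is bounded below, which gives a
  majorant independent of \<epsilon> on every compact subinterval.\<close>

theorem truncated_limit:
  assumes p: "1 < p" and ab: "a < b" and m: "m absolutely_integrable_on {a<..<b}" and \<gamma>: "0 < \<gamma>" and k: "0 < k"
    and sys: "\<And>n. plap_sys p a b (u n) (D n) (\<lambda>x. trunc_rhs a b m \<gamma> k (\<epsilon> n) x (u n x))"
    and u0: "\<And>n. u n a = 0" "\<And>n. u n b = 0"
    and u_ge: "\<And>n x. x \<in> {a..b} \<Longrightarrow> k * bdist a b x \<le> u n x"
    and \<epsilon>: "\<And>n. 0 < \<epsilon> n" "\<epsilon> \<longlonglongrightarrow> 0"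
  obtains U E where "plap_sys_loc p a b U E (\<lambda>x. restr a b m x * U x powr (- \<gamma>))"
    "continuous_on {a..b} U" "U a = 0" "U b = 0" "\<And>x. x \<in> {a..b} \<Longrightarrow> k * bdist a b x \<le> U x"
proof -
  define q where "q = 1 + \<gamma> / (p - 1)"
  have q1: "1 < q" using \<gamma> p by (simp add: q_def)
  have m0: "restr a b m absolutely_integrable_on {a..b}" using m by (subst absolutely_integrable_restr) auto
  then have m0i: "(\<lambda>x. \<bar>restr a b m x\<bar>) integrable_on {a..b}" by (simp add: absolutely_integrable_on_def)
  define A where "A = integral {a..b} (\<lambda>x. \<bar>restr a b m x\<bar>)"
  have A: "0 \<le> A" unfolding A_def by (intro Henstock_Kurzweil_Integration.integral_nonneg m0i) auto
  have u_nn: "0 \<le> u n x" if "x \<in> {a..b}" for n x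
    using u_ge[OF that, of n] bdist_nonneg[OF that] k by (meson less_imp_le mult_nonneg_nonneg order_trans)
  have u_pos: "0 < u n x" if "x \<in> {a<..<b}" for n x
  proof -
    have "0 < k * bdist a b x" using bdist_pos[OF that] k by simp
    then show ?thesis using u_ge[of x n] that by simp
  qed
  have flux: "\<bar>D n x\<bar> \<le> A * u n x powr (- \<gamma>)" if x: "x \<in> {a<..<b}" for n x
    unfolding A_def
  proof (rule flux_bound[OF p sys u0 m0i _ _ _ u_pos[OF x]])
    show "\<bar>trunc_rhs a b m \<gamma> k (\<epsilon> n) t (u n t)\<bar> \<le> \<bar>restr a b m t\<bar> * s powr (- \<gamma>)" if "0 < s" "s \<le> u n t" for t s
      unfolding trunc_rhs_def abs_mult using that \<gamma>
        powr_uminus_mono[of s "max (max (u n t) (k * bdist a b t)) (\<epsilon> n)" \<gamma>]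
      by (intro mult_left_mono) (auto simp: le_max_iff_disj)
  qed (use x in auto)
  define W where "W = (\<lambda>n x. u n x powr q)"
  define C where "C = q * psi_p p A"
  have lip: "\<bar>W n x - W n y\<bar> \<le> C * \<bar>x - y\<bar>" if "x \<in> {a..b}" "y \<in> {a..b}" for n x y
    unfolding W_def C_def
    by (rule powr_solution_lipschitz[OF p sys \<gamma> A u_pos u_nn flux q_def that])
  have W_end: "W n a = 0" "W n b = 0" for n using u0 by (auto simp: W_def)
  obtain V r0 where V: "continuous_on {a..b} V" and r0: "strict_mono (r0 :: nat \<Rightarrow> nat)"
    and WV: "\<And>x. x \<in> {a..b} \<Longrightarrow> (\<lambda>n. W (r0 n) x) \<longlonglongrightarrow> V x"
    using Arzela_Ascoli_Lipschitz[where F = W and C = C, OF ab W_end(1) lip] by blast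
  have V_nn: "0 \<le> V x" if "x \<in> {a..b}" for x
    by (rule LIMSEQ_le_const[OF WV[OF that]]) (simp add: W_def)
  \<comment> \<open>The root undoes the power; it is continuous at 0, so the boundary values
    survive.\<close>
  define U where "U = (\<lambda>x. V x powr (1 / q))"
  have Uc: "continuous_on {a..b} U"
    unfolding U_def using q1 V_nn by (intro continuous_on_powr' V continuous_intros) auto
  have uU0: "(\<lambda>n. u (r0 n) x) \<longlonglongrightarrow> U x" if x: "x \<in> {a..b}" for x
  proof -
    have "(\<lambda>n. W (r0 n) x powr (1 / q)) \<longlonglongrightarrow> V x powr (1 / q)"
      using q1 by (intro tendsto_powr' WV x tendsto_const) (auto simp: W_def)
    moreover have "W n x powr (1 / q) = u n x" for n
      using u_nn[OF x, of n] q1 by (simp add: W_def powr_powr)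
    ultimately show ?thesis by (simp add: U_def)
  qed
  \<comment> \<open>Convergence of the flux at one interior point is enough; the midpoint is far
    from both ends, so the flux is bounded there uniformly in n.\<close>
  define z where "z = (a + b) / 2"
  have z: "z \<in> {a<..<b}" using ab by (auto simp: z_def)
  define B where "B = A * (k * bdist a b z) powr (- \<gamma>)"
  have "\<bar>D n z\<bar> \<le> B" for n
  proof -
    have "u n z powr (- \<gamma>) \<le> (k * bdist a b z) powr (- \<gamma>)"
      using u_ge[of z n] z k bdist_pos[OF z] \<gamma> by (intro powr_uminus_mono) auto
    then have "A * u n z powr (- \<gamma>) \<le> B" unfolding B_def using A by (rule mult_left_mono)
    then show ?thesis using flux[OF z, of n] by simp
  qed
  then have "\<forall>n. (\<lambda>n. D (r0 n) z) n \<in> {- B..B}"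
    by (auto simp: abs_le_iff minus_le_iff)
  then obtain l r1 where r1: "strict_mono r1" "((\<lambda>n. D (r0 n) z) \<circ> r1) \<longlonglongrightarrow> l"
    using seq_compactE[OF compact_imp_seq_compact[OF compact_Icc]] by metis
  define r where "r = (\<lambda>n. r0 (r1 n))"
  have Dz: "(\<lambda>n. D (r n) z) \<longlonglongrightarrow> l" using r1(2) by (simp add: r_def o_def)
  have r: "strict_mono r" using r0 r1(1) by (simp add: r_def strict_mono_def)
  have uU: "(\<lambda>n. u (r n) x) \<longlonglongrightarrow> U x" if "x \<in> {a..b}" for x
    using LIMSEQ_subseq_LIMSEQ[OF uU0[OF that] r1(1)] by (simp add: r_def o_def)
  have \<epsilon>r: "(\<lambda>n. \<epsilon> (r n)) \<longlonglongrightarrow> 0"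
    using LIMSEQ_subseq_LIMSEQ[OF \<epsilon>(2) r] by (simp add: o_def)
  have U_ge: "k * bdist a b x \<le> U x" if "x \<in> {a..b}" for x
    by (rule LIMSEQ_le_const[OF uU[OF that]]) (use u_ge[OF that] in auto)
  have U0: "U a = 0" "U b = 0"
    using uU[of a] uU[of b] u0 ab by (simp_all add: LIMSEQ_const_iff)
  define E where "E = (\<lambda>x. lim (\<lambda>n. D (r n) x))"
  have "plap_sys_loc p a b U E (\<lambda>x. restr a b m x * U x powr (- \<gamma>))"
    unfolding plap_sys_loc_def
  proof (intro allI impI)
    fix c d assume cd: "a < c \<and> c \<le> d \<and> d < b"
    \<comment> \<open>The interval is enlarged to contain z, where the fluxes are known to
      converge.\<close>
    define c' where "c' = min c z"
    define d' where "d' = max d z"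
    have c'd': "a < c'" "d' < b" "c' \<le> z" "z \<le> d'" "c' \<le> c" "d \<le> d'" using cd z by (auto simp: c'_def d'_def)
    have inside: "x \<in> {a<..<b}" "x \<in> {a..b}" if "x \<in> {c'..d'}" for x using that c'd' by auto
    have kpos: "0 < k * bdist a b x" if "x \<in> {c'..d'}" for x using bdist_pos[OF inside(1)[OF that]] k by simp
    have "continuous_on {c'..d'} (\<lambda>x. (k * bdist a b x) powr (- \<gamma>))"
      using kpos by (intro continuous_intros) (auto simp: less_le)
    then obtain G where G: "0 \<le> G" "\<And>x. x \<in> {c'..d'} \<Longrightarrow> \<bar>(k * bdist a b x) powr (- \<gamma>)\<bar> \<le> G"
      using continuous_on_Icc_bounded by blast
    have "plap_sys p c' d' U (\<lambda>x. lim (\<lambda>n. D (r n) x)) (\<lambda>x. restr a b m x * U x powr (- \<gamma>))"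
    proof (rule plap_sys_limit(1)[OF p])
      show "plap_sys p c' d' (u (r n)) (D (r n)) (\<lambda>x. trunc_rhs a b m \<gamma> k (\<epsilon> (r n)) x (u (r n) x))" for n
        by (rule plap_sys_subinterval[OF sys]) (use c'd' in auto)
      have "(\<lambda>x. \<bar>restr a b m x\<bar>) integrable_on {c'..d'}"
        by (rule integrable_on_subinterval[OF m0i]) (use c'd' in auto)
      then show "(\<lambda>x. \<bar>restr a b m x\<bar> * G) integrable_on {c'..d'}" by (rule integrable_on_mult_left)
      show "\<bar>trunc_rhs a b m \<gamma> k (\<epsilon> (r n)) x (u (r n) x)\<bar> \<le> \<bar>restr a b m x\<bar> * G" if x: "x \<in> {c'..d'}" for n x
      proof -
        have "max (max (u (r n) x) (k * bdist a b x)) (\<epsilon> (r n)) powr (- \<gamma>) \<le> (k * bdist a b x) powr (- \<gamma>)"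
          using \<gamma> by (intro powr_uminus_mono kpos x) auto
        also have "\<dots> \<le> G" using G(2)[OF x] by simp
        finally show ?thesis unfolding trunc_rhs_def abs_mult by (intro mult_left_mono) auto
      qed
      show "(\<lambda>n. trunc_rhs a b m \<gamma> k (\<epsilon> (r n)) x (u (r n) x)) \<longlonglongrightarrow> restr a b m x * U x powr (- \<gamma>)"
        if x: "x \<in> {c'..d'}" for x
      proof -
        have "0 < U x" "k * bdist a b x \<le> U x" using U_ge[OF inside(2)[OF x]] kpos[OF x] by auto
        then have max_eq: "max (max (U x) (k * bdist a b x)) 0 = U x" by simp
        have "(\<lambda>n. trunc_rhs a b m \<gamma> k (\<epsilon> (r n)) x (u (r n) x)) \<longlonglongrightarrow>
            restr a b m x * max (max (U x) (k * bdist a b x)) 0 powr (- \<gamma>)"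
          unfolding trunc_rhs_def using \<open>0 < U x\<close> max_eq by (intro tendsto_intros uU \<epsilon>r inside(2)[OF x]) auto
        then show ?thesis by (simp add: max_eq)
      qed
      show "(\<lambda>n. u (r n) x) \<longlonglongrightarrow> U x" if "x \<in> {c'..d'}" for x by (rule uU[OF inside(2)[OF that]])
      show "z \<in> {c'..d'}" using c'd' by auto
      show "(\<lambda>n. D (r n) z) \<longlonglongrightarrow> l" by (rule Dz)
    qed
    then show "plap_sys p c d U E (\<lambda>x. restr a b m x * U x powr (- \<gamma>))"
      unfolding E_def by (rule plap_sys_subinterval) (use c'd' in auto)
  qed
  from this Uc U0 U_ge show thesis by (rule that)
qed

section \<open>Part (ii): bounds from below\<close>

text \<open>In the next two lemmas \<open>c\<close> is the midpoint of \<open>I\<close> and only the left half of the interval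
  is considered; \<open>B\<close> bounds the total increase of the flux outside \<open>I\<close>.\<close>

lemma barrier_height:
  assumes p: "1 < p" and sys: "plap_sys p a c u D f" and ua: "0 \<le> u a" and x0: "a \<le> x0" "x0 \<le> c"
    and out: "\<And>x. \<lbrakk>a \<le> x; x \<le> x0\<rbrakk> \<Longrightarrow> D x0 - D x \<le> B"
    and anti: "\<And>x y. \<lbrakk>x0 \<le> x; x \<le> y; y \<le> c\<rbrakk> \<Longrightarrow> D y \<le> D x"
    and K: "0 \<le> K" "\<And>x. \<lbrakk>x0 \<le> x; x \<le> c; \<And>t. t \<in> {x0..c} \<Longrightarrow> u t \<le> H\<rbrakk> \<Longrightarrow> K * (c - x) \<le> D x - D c"
    and KB: "B \<le> K * (c - x0)"
    and KH: "H \<le> psi_p p K * ((c - x0) powr (p / (p - 1)) / (p / (p - 1)))"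
    and Dc: "0 \<le> D c"
  shows "H \<le> u c"
proof (rule ccontr)
  assume "\<not> H \<le> u c"
  then have uc: "u c < H" by simp
  have D_in: "0 \<le> D t" if "t \<in> {x0..c}" for t using anti[of t c] Dc that by auto
  have "u t \<le> H" if "t \<in> {x0..c}" for t
  proof -
    have "u t \<le> u c"
      using that x0 D_in by (intro plap_sys_u_mono[OF p sys]) auto
    then show ?thesis using uc by simp
  qed
  then have D_ge: "K * (c - x) \<le> D x" if "x \<in> {x0..c}" for x
    using K(2)[of x] that Dc by auto
  \<comment> \<open>On the way to x0 the flux has gained at most \<open>B\<close>, while at x0 it is
    at least \<open>K * (c - x0) \<ge> B\<close>; hence it was nonnegative before.\<close>
  have "0 \<le> D t" if "a \<le> t" "t \<le> x0" for t
    using out[OF that] D_ge[of x0] KB x0 by simp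
  then have "u a \<le> u x0" using x0 by (intro plap_sys_u_mono[OF p sys]) auto
  moreover have "psi_p p K * ((c - x0) powr (p / (p - 1)) / (p / (p - 1))) \<le> u c - u x0"
    by (rule plap_sys_growth(1)[OF p plap_sys_subinterval[OF sys x0(1) order_refl] x0(2) K(1) D_ge])
  ultimately show False using KH uc ua by linarith
qed

lemma barrier_slope:
  assumes p: "1 < p" and sys: "plap_sys p a c u D f" and ua: "u a = 0" and x0: "a \<le> x0" "x0 \<le> c" and ac: "a < c"
    and k: "0 < k" and B: "0 \<le> B" and \<sigma>: "phi_p p \<sigma> = phi_p p k + B"
    and out: "\<And>x y. \<lbrakk>a \<le> x; x \<le> y; y \<le> x0\<rbrakk> \<Longrightarrow> D y - D x \<le> B"
    and anti: "\<And>x y. \<lbrakk>x0 \<le> x; x \<le> y; y \<le> c\<rbrakk> \<Longrightarrow> D y \<le> D x"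
    and uc: "(c - a) * \<sigma> \<le> u c" and x: "x \<in> {a..c}"
  shows "k * (x - a) \<le> u x"
proof (rule ccontr)
  assume neg: "\<not> k * (x - a) \<le> u x"
  \<comment> \<open>At a negative minimum of w, which must be interior, u has slope exactly k and
    lies below the line of slope k.\<close>
  define w where "w = (\<lambda>x. u x - k * (x - a))"
  have k\<sigma>: "k \<le> \<sigma>" using \<sigma> B phi_p_le_iff[OF p, of k \<sigma>] by simp
  have "continuous_on {a..c} w"
    unfolding w_def by (intro continuous_intros plap_sys_continuous_u[OF p sys])
  then obtain z where z: "z \<in> {a..c}" "\<And>y. y \<in> {a..c} \<Longrightarrow> w z \<le> w y"
    using continuous_attains_inf[of "{a..c}" w] ac by auto
  have wz: "w z < 0" using z(2)[OF x] neg by (simp add: w_def)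
  have "z \<noteq> a" using wz ua by (auto simp: w_def)
  moreover have "z \<noteq> c"
  proof
    assume "z = c"
    moreover have "(c - a) * k \<le> (c - a) * \<sigma>" using k\<sigma> ac by simp
    ultimately show False using wz uc by (simp add: w_def mult.commute)
  qed
  ultimately have zi: "a < z" "z < c" using z(1) by auto
  have "(w has_real_derivative psi_p p (D z) - k) (at z)"
    unfolding w_def using zi
    by (auto intro!: derivative_eq_intros plap_sys_has_derivative_at[OF p sys])
  moreover have "\<forall>y. \<bar>z - y\<bar> < min (z - a) (c - z) \<longrightarrow> w z \<le> w y"
    using z(2) by (auto simp: abs_if split: if_splits)
  ultimately have "psi_p p (D z) - k = 0"
    using zi by (intro DERIV_local_min[of w _ z "min (z - a) (c - z)"]) auto
  then have Dz: "D z = phi_p p k" using phi_psi_p[OF p, of "D z"] by simp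
  \<comment> \<open>From its value \<open>phi_p p k\<close> at z the flux gains at most
    \<open>B\<close> before x0 and nothing afterwards. So u climbs with slope at most \<sigma>, too
    slowly to reach (c - a) \<sigma> at c.\<close>
  have "D t \<le> phi_p p \<sigma>" if t: "t \<in> {z..c}" for t
  proof -
    consider "t \<le> x0" | "z \<le> x0" "x0 < t" | "x0 < z" by linarith
    then show ?thesis
    proof cases
      case 1
      then show ?thesis using out[of z t] zi t Dz \<sigma> by simp
    next
      case 2
      then show ?thesis using out[of z x0] anti[of x0 t] zi t Dz \<sigma> by simp
    next
      case 3
      then show ?thesis using anti[of z t] zi t Dz \<sigma> B by simp
    qed
  qed
  then have "u c - u z \<le> \<sigma> * (c - z)"
    using plap_sys_u_diff_bounds(1)[OF p sys, of z c "phi_p p \<sigma>"] zi p by simp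
  moreover have "k * (z - a) \<le> \<sigma> * (z - a)" using k\<sigma> zi by simp
  moreover have "\<sigma> * (c - z) + \<sigma> * (z - a) = (c - a) * \<sigma>" by (simp add: algebra_simps)
  ultimately show False using uc wz by (simp add: w_def)
qed

text \<open>The height bound at the midpoint is obtained from whichever half lies on the uphill
  side; the slope bound is then applied on both sides, on the right after reflection.\<close>

lemma barrier:
  assumes p: "1 < p" and sys: "plap_sys p a b u D f" and u0: "u a = 0" "u b = 0"
    and I: "a \<le> x0" "x0 < x1" "x1 \<le> b" and c: "c = (x0 + x1) / 2"
    and k: "0 < k" and B: "0 \<le> B" and \<sigma>: "phi_p p \<sigma> = phi_p p k + B"
    and out: "\<And>x y. \<lbrakk>a \<le> x; x \<le> y; y \<le> x0 \<or> x1 \<le> x; y \<le> b\<rbrakk> \<Longrightarrow> D y - D x \<le> B"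
    and anti: "\<And>x y. \<lbrakk>x0 \<le> x; x \<le> y; y \<le> x1\<rbrakk> \<Longrightarrow> D y \<le> D x"
    and K: "0 \<le> K" "\<And>x y. \<lbrakk>x0 \<le> x; x \<le> y; y \<le> x1; \<And>t. t \<in> {x..y} \<Longrightarrow> u t \<le> H\<rbrakk> \<Longrightarrow> K * (y - x) \<le> D x - D y"
    and KB: "B \<le> K * ((x1 - x0) / 2)"
    and KH: "H \<le> psi_p p K * (((x1 - x0) / 2) powr (p / (p - 1)) / (p / (p - 1)))"
    and H: "(c - a) * \<sigma> \<le> H" "(b - c) * \<sigma> \<le> H"
    and x: "x \<in> {a..b}"
  shows "k * bdist a b x \<le> u x"
proof -
  have cI: "x0 \<le> c" "c \<le> x1" "a < c" "c < b" "c - x0 = (x1 - x0) / 2" "x1 - c = (x1 - x0) / 2"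
    using I by (auto simp: c field_simps)
  have KB': "B \<le> K * (c - x0)" using KB by (simp only: cI(5))
  have KH': "H \<le> psi_p p K * ((c - x0) powr (p / (p - 1)) / (p / (p - 1)))" using KH by (simp only: cI(5))
  have half: "a + b - c - (a + b - x1) = (x1 - x0) / 2" using cI(6) by simp
  have L: "plap_sys p a c u D f" by (rule plap_sys_subinterval[OF sys]) (use cI in auto)
  have "plap_sys p (a + b - b) (a + b - c) (\<lambda>x. u (a + b - x)) (\<lambda>x. - D (a + b - x)) (\<lambda>x. f (a + b - x))"
    by (rule plap_sys_reflect[OF plap_sys_subinterval[OF sys]]) (use cI in auto)
  then have R: "plap_sys p a (a + b - c) (\<lambda>x. u (a + b - x)) (\<lambda>x. - D (a + b - x)) (\<lambda>x. f (a + b - x))" by simp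
  have KL: "K * (c - x) \<le> D x - D c" if "x0 \<le> x" "x \<le> c" "\<And>t. t \<in> {x0..c} \<Longrightarrow> u t \<le> H" for x
    using that cI by (intro K(2)) auto
  have KR: "K * (y - c) \<le> D c - D y" if "c \<le> y" "y \<le> x1" "\<And>t. t \<in> {c..x1} \<Longrightarrow> u t \<le> H" for y
    using that cI by (intro K(2)) auto
  \<comment> \<open>The sign of the flux at c selects the half on which u increases toward
    c.\<close>
  have "H \<le> u c"
  proof (cases "0 \<le> D c")
    case True
    show ?thesis
      by (rule barrier_height[OF p L _ I(1) cI(1) _ _ K(1) KL _ _ True])
        (use u0 I cI out[of _ x0] anti KB' KH' in auto)
  next
    case False
    have "H \<le> u (a + b - (a + b - c))"
    proof (rule barrier_height[OF p R, of "a + b - x1" B K])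
      show "K * (a + b - c - x) \<le> - D (a + b - x) - - D (a + b - (a + b - c))"
        if "a + b - x1 \<le> x" "x \<le> a + b - c" and le: "\<And>t. t \<in> {a + b - x1..a + b - c} \<Longrightarrow> u (a + b - t) \<le> H" for x
      proof -
        have "u t \<le> H" if "t \<in> {c..x1}" for t using le[of "a + b - t"] that by auto
        then show ?thesis using KR[of "a + b - x"] that by (simp add: algebra_simps)
      qed
      show "- D (a + b - (a + b - x1)) - - D (a + b - x) \<le> B" if "a \<le> x" "x \<le> a + b - x1" for x
        using out[of x1 "a + b - x"] that I by simp
      show "- D (a + b - y) \<le> - D (a + b - x)" if "a + b - x1 \<le> x" "x \<le> y" "y \<le> a + b - c" for x y
        using anti[of "a + b - y" "a + b - x"] that cI by simp
      show "B \<le> K * (a + b - c - (a + b - x1))" using KB by (simp only: half)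
      show "H \<le> psi_p p K * ((a + b - c - (a + b - x1)) powr (p / (p - 1)) / (p / (p - 1)))"
        using KH by (simp only: half)
    qed (use u0 I cI False K(1) in auto)
    then show ?thesis by simp
  qed
  then have uc: "(c - a) * \<sigma> \<le> u c" "(b - c) * \<sigma> \<le> u c" using H by linarith+
  show ?thesis
  proof (cases "x \<le> c")
    case True
    have "k * (x - a) \<le> u x"
      by (rule barrier_slope[OF p L u0(1) I(1) cI(1,3) k B \<sigma> _ _ uc(1)])
        (use out anti I cI x True in auto)
    moreover have "k * bdist a b x \<le> k * (x - a)" using k by (intro mult_left_mono) (auto simp: bdist_def)
    ultimately show ?thesis by simp
  next
    case False
    have "k * ((a + b - x) - a) \<le> u (a + b - (a + b - x))"
    proof (rule barrier_slope[OF p R _ _ _ _ k B \<sigma>])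
      show "- D (a + b - y) - - D (a + b - x) \<le> B" if "a \<le> x" "x \<le> y" "y \<le> a + b - x1" for x y
        using out[of "a + b - y" "a + b - x"] that I by simp
      show "- D (a + b - y) \<le> - D (a + b - x)" if "a + b - x1 \<le> x" "x \<le> y" "y \<le> a + b - c" for x y
        using anti[of "a + b - y" "a + b - x"] that cI by simp
    qed (use u0 I cI x False uc in auto)
    then have "k * (b - x) \<le> u x" by simp
    moreover have "k * bdist a b x \<le> k * (b - x)" using k by (intro mult_left_mono) (auto simp: bdist_def)
    ultimately show ?thesis by simp
  qed
qed

text \<open>A concave function vanishing at both ends lies above its chords to the point y.
  Replacing the horizontal length of the chord by b - a makes the slope independent of the position
  of y.\<close>

lemma concave_solution_lower_bound:
  assumes p: "1 < p" and sys: "plap_sys p a b u D f" and u0: "u a = 0" "u b = 0"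
    and anti: "\<And>x y. \<lbrakk>a \<le> x; x \<le> y; y \<le> b\<rbrakk> \<Longrightarrow> D y \<le> D x"
    and y: "y \<in> {a..b}" "h \<le> u y" "0 \<le> h" and x: "x \<in> {a<..<b}"
  shows "h / (b - a) * bdist a b x \<le> u x"
proof -
  have ab: "a < b" "x - a > 0" "b - x > 0" using x by auto
  have L: "psi_p p (D x) * (x - a) \<le> u x"
    using plap_sys_u_diff_bounds(2)[OF p sys, of a x "D x"] anti x u0 by auto
  have R: "- u x \<le> psi_p p (D x) * (b - x)"
    using plap_sys_u_diff_bounds(1)[OF p sys, of x b "D x"] anti x u0 by auto
  have ux: "0 \<le> u x"
  proof (rule ccontr)
    assume "\<not> 0 \<le> u x"
    then have "psi_p p (D x) * (x - a) < 0" "0 < psi_p p (D x) * (b - x)" using L R by auto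
    then show False using ab by (simp add: mult_less_0_iff zero_less_mult_iff)
  qed
  show ?thesis
  proof (cases "x \<le> y")
    case True
    have "u y - u x \<le> psi_p p (D x) * (y - x)"
      using plap_sys_u_diff_bounds(1)[OF p sys, of x y "D x"] anti x y True by auto
    then have "(u y - u x) * (x - a) \<le> (psi_p p (D x) * (x - a)) * (y - x)"
      using mult_right_mono[of "u y - u x" "psi_p p (D x) * (y - x)" "x - a"] ab by (simp add: algebra_simps)
    also have "\<dots> \<le> u x * (y - x)" using L True by (intro mult_right_mono) auto
    finally have "u y * (x - a) \<le> u x * (y - a)" by (simp add: algebra_simps)
    also have "\<dots> \<le> u x * (b - a)" using ux y by (intro mult_left_mono) auto
    finally have "u y * (x - a) \<le> u x * (b - a)" .
    moreover have "h * bdist a b x \<le> u y * (x - a)"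
      using y x by (intro mult_mono) (auto simp: bdist_def)
    ultimately show ?thesis using ab by (simp add: field_simps)
  next
    case False
    have "psi_p p (D x) * (x - y) \<le> u x - u y"
      using plap_sys_u_diff_bounds(2)[OF p sys, of y x "D x"] anti x y False by auto
    then have "(u y - u x) * (b - x) \<le> (- (psi_p p (D x) * (b - x))) * (x - y)"
      using mult_right_mono[of "psi_p p (D x) * (x - y)" "u x - u y" "b - x"] ab by (simp add: algebra_simps)
    also have "\<dots> \<le> u x * (x - y)" using R False by (intro mult_right_mono) auto
    finally have "u y * (b - x) \<le> u x * (b - y)" by (simp add: algebra_simps)
    also have "\<dots> \<le> u x * (b - a)" using ux y by (intro mult_left_mono) auto
    finally have "u y * (b - x) \<le> u x * (b - a)" .
    moreover have "h * bdist a b x \<le> u y * (b - x)"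
      using y x by (intro mult_mono) (auto simp: bdist_def)
    ultimately show ?thesis using ab by (simp add: field_simps)
  qed
qed

lemma integral_mono_ae:
  fixes f g :: "real \<Rightarrow> real"
  assumes "f integrable_on S" "g integrable_on S" "negligible N" "\<And>x. x \<in> S - N \<Longrightarrow> f x \<le> g x"
  shows "integral S f \<le> integral S g"
proof -
  let ?g = "\<lambda>x. if x \<in> N then f x else g x"
  have "?g integrable_on S" by (rule integrable_spike[OF assms(2,3)]) auto
  then have "integral S f \<le> integral S ?g" using assms by (intro integral_le) auto
  also have "\<dots> = integral S g" by (rule integral_spike[OF assms(3)]) auto
  finally show ?thesis .
qed

text \<open>If \<open>m\<close> is nonnegative, the solutions are concave and a bound from below for their maximum suffices.\<close>

lemma barrier_nonneg:
  assumes p: "1 < p" and ab: "a < b" and m: "m absolutely_integrable_on {a<..<b}" and \<gamma>: "0 < \<gamma>"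
    and N: "negligible N" "\<And>x. x \<in> {a<..<b} - N \<Longrightarrow> 0 \<le> m x"
    and P: "0 < integral {a..b} (restr a b m)"
  obtains k where "0 < k"
    "\<And>u D \<epsilon> x. \<lbrakk>plap_sys p a b u D (\<lambda>x. trunc_rhs a b m \<gamma> k \<epsilon> x (u x)); u a = 0; u b = 0; 0 < \<epsilon>; \<epsilon> \<le> 1; x \<in> {a..b}\<rbrakk>
      \<Longrightarrow> k * bdist a b x \<le> u x"
proof -
  have m0: "restr a b m absolutely_integrable_on {a..b}" using m by (subst absolutely_integrable_restr) auto
  then have m0i: "restr a b m integrable_on {a..b}" by (rule set_lebesgue_integral_eq_integral(1))
  define N' where "N' = N \<union> {a, b}"
  have N': "negligible N'" unfolding N'_def using N(1) by (simp add: negligible_Un)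
  have m0_nn: "0 \<le> restr a b m x" if "x \<in> {a..b} - N'" for x using N(2)[of x] that by (auto simp: N'_def)
  define J where "J = (\<lambda>x. integral {a..x} (restr a b m))"
  have Jc: "continuous_on {a..b} J" unfolding J_def by (rule indefinite_integral_continuous_1[OF m0i])
  define P where "P = integral {a..b} (restr a b m)"
  have P_pos: "0 < P" using P by (simp add: P_def)
  have J_ends: "J a = 0" "J b = P" by (auto simp: J_def P_def)
  \<comment> \<open>Less than a third of the mass of m lies near each end, so at least a third
    remains in \<open>{a + e..b - e}\<close>.\<close>
  obtain d0 where d0: "0 < d0" "\<And>x. \<lbrakk>x \<in> {a..b}; \<bar>x - a\<bar> < d0\<rbrakk> \<Longrightarrow> \<bar>J x - J a\<bar> < P / 3"
    using Jc[unfolded continuous_on_iff dist_real_def, rule_format, of a "P / 3"] ab P_pos by auto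
  obtain d1 where d1: "0 < d1" "\<And>x. \<lbrakk>x \<in> {a..b}; \<bar>x - b\<bar> < d1\<rbrakk> \<Longrightarrow> \<bar>J x - J b\<bar> < P / 3"
    using Jc[unfolded continuous_on_iff dist_real_def, rule_format, of b "P / 3"] ab P_pos by auto
  define e where "e = min (min d0 d1) (b - a) / 2"
  have e: "0 < e" "e < d0" "e < d1" "a + e \<le> b - e" using d0 d1 ab by (auto simp: e_def min_def field_simps)
  define \<mu> where "\<mu> = P / 3"
  have \<mu>: "0 < \<mu>" using P_pos by (simp add: \<mu>_def)
  have J_mid: "\<mu> \<le> J (b - e) - J (a + e)"
  proof -
    have "\<bar>J (a + e) - J a\<bar> < P / 3" using e ab by (intro d0(2)) auto
    moreover have "\<bar>J (b - e) - J b\<bar> < P / 3" using e ab by (intro d1(2)) auto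
    ultimately show ?thesis using J_ends unfolding \<mu>_def by linarith
  qed
  \<comment> \<open>Either u exceeds 1 somewhere, or the right-hand side is at least m in the
    middle. Then the flux drops there by \<mu>, so it is at least \<mu>/2 in modulus at one side,
    and u climbs to \<open>psi_p p (\<mu> / 2) * e\<close> over the adjacent end zone.\<close>
  define h where "h = min 1 (psi_p p (\<mu> / 2) * e)"
  have h: "0 < h" "h \<le> 1" using \<mu> e(1) p by (auto simp: h_def)
  define k where "k = h / (b - a)"
  have k: "0 < k" using h ab by (simp add: k_def)
  have "k * bdist a b x \<le> u x"
    if sys: "plap_sys p a b u D (\<lambda>x. trunc_rhs a b m \<gamma> k \<epsilon> x (u x))" and u0: "u a = 0" "u b = 0"
      and \<epsilon>: "0 < \<epsilon>" "\<epsilon> \<le> 1" and x: "x \<in> {a..b}" for u D \<epsilon> x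
  proof -
    have fi: "(\<lambda>x. trunc_rhs a b m \<gamma> k \<epsilon> x (u x)) integrable_on {s..t}" if "a \<le> s" "t \<le> b" for s t
      using integrable_on_subinterval[OF plap_sysD(2)[OF sys]] that by auto
    have anti: "D t \<le> D s" if "a \<le> s" "s \<le> t" "t \<le> b" for s t
    proof -
      have "integral {s..t} (\<lambda>x. 0) \<le> integral {s..t} (\<lambda>x. trunc_rhs a b m \<gamma> k \<epsilon> x (u x))"
        using that m0_nn by (intro integral_mono_ae[OF _ fi N']) (auto simp: trunc_rhs_def)
      then show ?thesis using plap_sysD(3)[OF sys that] by simp
    qed
    have "\<exists>y\<in>{a..b}. h \<le> u y"
    proof (cases "\<forall>y\<in>{a..b}. u y \<le> 1")
      case False
      then obtain y where "y \<in> {a..b}" "1 < u y" by (auto simp: not_le)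
      then show ?thesis using h(2) by (intro bexI[of _ y]) auto
    next
      case True
      have "integral {a + e..b - e} (restr a b m) \<le> integral {a + e..b - e} (\<lambda>x. trunc_rhs a b m \<gamma> k \<epsilon> x (u x))"
      proof (rule integral_mono_ae[OF _ fi N'])
        show "restr a b m integrable_on {a + e..b - e}"
          using integrable_on_subinterval[OF m0i] e by auto
        fix y assume y: "y \<in> {a + e..b - e} - N'"
        then have yab: "y \<in> {a..b} - N'" using e by auto
        \<comment> \<open>k \<delta> stays below h \<le> 1, so neither floor pushes the argument of
          the power above 1.\<close>
        have "k * bdist a b y \<le> k * (b - a)" using k yab by (intro mult_left_mono) (auto simp: bdist_def)
        moreover have "k * (b - a) = h" using ab by (simp add: k_def)
        ultimately have "k * bdist a b y \<le> 1" using h by linarith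
        then have "max (max (u y) (k * bdist a b y)) \<epsilon> \<le> 1" using True yab \<epsilon> by auto
        then have "1 powr (- \<gamma>) \<le> max (max (u y) (k * bdist a b y)) \<epsilon> powr (- \<gamma>)"
          using \<gamma> \<epsilon> by (intro powr_uminus_mono) (auto simp: less_max_iff_disj)
        then show "restr a b m y \<le> trunc_rhs a b m \<gamma> k \<epsilon> y (u y)"
          unfolding trunc_rhs_def using m0_nn[OF yab] mult_left_mono[of 1 _ "restr a b m y"] by simp
      qed (use e in auto)
      moreover have "integral {a + e..b - e} (restr a b m) = J (b - e) - J (a + e)"
        unfolding J_def using e integrable_on_subinterval[OF m0i, of a "b - e"]
          Henstock_Kurzweil_Integration.integral_combine[of a "a + e" "b - e" "restr a b m"] by auto
      ultimately have "\<mu> \<le> D (a + e) - D (b - e)"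
        using J_mid plap_sysD(3)[OF sys, of "a + e" "b - e"] e by auto
      then consider "\<mu> / 2 \<le> D (a + e)" | "D (b - e) \<le> - (\<mu> / 2)" by linarith
      then show ?thesis
      proof cases
        case 1
        have "psi_p p (\<mu> / 2) * ((a + e) - a) \<le> u (a + e) - u a"
        proof (rule plap_sys_u_diff_bounds(2)[OF p sys])
          show "\<mu> / 2 \<le> D t" if "t \<in> {a..a + e}" for t using anti[of t "a + e"] 1 that e ab by auto
        qed (use e ab in auto)
        then have "h \<le> u (a + e)" using u0 by (simp add: h_def)
        then show ?thesis using e ab by (intro bexI[of _ "a + e"]) auto
      next
        case 2
        have "u b - u (b - e) \<le> psi_p p (- (\<mu> / 2)) * (b - (b - e))"
        proof (rule plap_sys_u_diff_bounds(1)[OF p sys])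
          show "D t \<le> - (\<mu> / 2)" if "t \<in> {b - e..b}" for t using anti[of "b - e" t] 2 that e ab by auto
        qed (use e ab in auto)
        then have "h \<le> u (b - e)" using u0 by (simp add: h_def)
        then show ?thesis using e ab by (intro bexI[of _ "b - e"]) auto
      qed
    qed
    then obtain y where y: "y \<in> {a..b}" "h \<le> u y" by blast
    show ?thesis
    proof (cases "x \<in> {a<..<b}")
      case True
      show ?thesis unfolding k_def
        by (rule concave_solution_lower_bound[OF p sys u0 anti y _ True]) (use h in auto)
    next
      case False
      then have "x = a \<or> x = b" using x by auto
      then show ?thesis using u0 ab by (auto simp: bdist_def)
    qed
  qed
  with k show thesis by (rule that)
qed

section \<open>Part (ii): the explicit threshold\<close>

lemma AE_lebesgue_negligible:
  assumes "AE x in lebesgue. Q x"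
  obtains N where "negligible N" "\<And>x. x \<notin> N \<Longrightarrow> Q (x::real)"
proof -
  obtain N where "N \<in> null_sets lebesgue" "{x \<in> space lebesgue. \<not> Q x} \<subseteq> N"
    using assms unfolding eventually_ae_filter by blast
  then show thesis by (intro that[of N]) (auto simp: negligible_iff_null_sets)
qed

text \<open>The supremum is meaningful because f is finite on an interval of positive measure, which
  bounds the admissible constants; that it is itself admissible follows by intersecting countably
  many sets of full measure.\<close>

lemma ess_inf_on_AE:
  assumes x01: "x0 < x1" and f: "\<And>x. 0 \<le> f x"
  shows "0 \<le> ess_inf_on {x0<..<x1} f" "AE x in lebesgue_on {x0<..<x1}. ess_inf_on {x0<..<x1} f \<le> f x"
proof -
  let ?M = "lebesgue_on {x0<..<x1}"
  define C where "C = {c. AE x in ?M. c \<le> f x}"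
  have 0: "0 \<in> C" using f by (simp add: C_def)
  have "bdd_above C"
  proof (rule ccontr)
    assume nb: "\<not> bdd_above C"
    have "AE x in ?M. real n \<le> f x" for n
    proof -
      obtain c where "c \<in> C" "real n < c" using nb unfolding bdd_above_def by (auto simp: not_le)
      then show ?thesis by (auto simp: C_def elim!: eventually_mono)
    qed
    then have "AE x in ?M. \<forall>n. real n \<le> f x" by (simp add: AE_all_countable)
    then obtain N where N: "negligible N" "\<forall>x\<in>{x0<..<x1} - N. \<forall>n. real n \<le> f x"
      unfolding AE_lebesgue_on_Ioo_iff by blast
    have "{x0<..<x1} \<subseteq> N"
    proof
      fix x assume x: "x \<in> {x0<..<x1}"
      obtain n where "f x < real n" using reals_Archimedean2 by blast
      then show "x \<in> N" using N(2) x by (force simp: not_le[symmetric])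
    qed
    then have "negligible {x0<..<x1}" using N(1) negligible_subset by blast
    then show False using x01 open_not_negligible[of "{x0<..<x1}"] by auto
  qed
  have eq: "ess_inf_on {x0<..<x1} f = Sup C" by (simp add: ess_inf_on_def C_def)
  show "0 \<le> ess_inf_on {x0<..<x1} f" unfolding eq using 0 \<open>bdd_above C\<close> by (rule cSup_upper)
  have "AE x in ?M. Sup C - 1 / real (Suc n) \<le> f x" for n
  proof -
    have "Sup C - 1 / real (Suc n) < Sup C" by simp
    then obtain c where "c \<in> C" "Sup C - 1 / real (Suc n) < c"
      using less_cSup_iff[OF _ \<open>bdd_above C\<close>] 0 by blast
    then show ?thesis by (auto simp: C_def elim!: eventually_mono)
  qed
  then have "AE x in ?M. \<forall>n. Sup C - 1 / real (Suc n) \<le> f x" by (simp add: AE_all_countable)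
  then show "AE x in ?M. ess_inf_on {x0<..<x1} f \<le> f x"
    unfolding eq
  proof (rule eventually_mono)
    fix x assume le: "\<forall>n. Sup C - 1 / real (Suc n) \<le> f x"
    show "Sup C \<le> f x"
    proof (rule ccontr)
      assume "\<not> Sup C \<le> f x"
      then have "0 < Sup C - f x" by simp
      then obtain n where "1 / real (Suc n) < Sup C - f x" by (metis nat_approx_posE)
      then show False using le by (smt (verit))
    qed
  qed
qed

text \<open>A barrier uniform in \<epsilon> is all that the limit requires. If m^+
  \<delta>^(-\<gamma>) is integrable too, then U \<ge> k \<delta> makes the limit equation
  integrable up to the end points, so U is of class C1 there and the barrier gives the signs of the
  end slopes.\<close>

lemma solution_from_barrier:
  assumes p: "1 < p" and ab: "a < b" and m: "m absolutely_integrable_on {a<..<b}" and \<gamma>: "0 < \<gamma>"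
    and neg: "(\<lambda>x. max (- m x) 0 * bdist a b x powr (- \<gamma>)) absolutely_integrable_on {a<..<b}"
    and k: "0 < k" and \<epsilon>0: "0 < \<epsilon>0"
    and barrier: "\<And>u D \<epsilon> x. \<lbrakk>plap_sys p a b u D (\<lambda>x. trunc_rhs a b m \<gamma> k \<epsilon> x (u x)); u a = 0; u b = 0;
        0 < \<epsilon>; \<epsilon> \<le> \<epsilon>0; x \<in> {a..b}\<rbrakk> \<Longrightarrow> k * bdist a b x \<le> u x"
  shows "\<exists>u. solves_P p a b m \<gamma> u
    \<and> ((\<exists>r>1. Lp_on r {a<..<b} (\<lambda>x. max (m x) 0 * bdist a b x powr (- \<gamma>))) \<longrightarrow> u \<in> P_interior a b)"
proof -
  define \<epsilon> where "\<epsilon> = (\<lambda>n. \<epsilon>0 / real (Suc n))"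
  have \<epsilon>: "0 < \<epsilon> n" "\<epsilon> n \<le> \<epsilon>0" for n
  proof -
    show "0 < \<epsilon> n" using \<epsilon>0 by (simp add: \<epsilon>_def)
    show "\<epsilon> n \<le> \<epsilon>0" unfolding \<epsilon>_def by (rule divide_le_self) (use \<epsilon>0 in auto)
  qed
  have \<epsilon>_lim: "\<epsilon> \<longlonglongrightarrow> 0"
    using lim_const_over_n[THEN LIMSEQ_Suc, of "\<epsilon>0"] by (simp only: \<epsilon>_def)
  have "\<exists>u D. plap_sys p a b u D (\<lambda>x. trunc_rhs a b m \<gamma> k (\<epsilon> n) x (u x)) \<and> u a = 0 \<and> u b = 0" for n
    using truncated_solution_exists[OF p ab m \<gamma> \<epsilon>(1), of k n] by metis
  then obtain u D where sys: "\<And>n. plap_sys p a b (u n) (D n) (\<lambda>x. trunc_rhs a b m \<gamma> k (\<epsilon> n) x (u n x))"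
    and u0: "\<And>n. u n a = 0" "\<And>n. u n b = 0" by metis
  have u_ge: "k * bdist a b x \<le> u n x" if "x \<in> {a..b}" for n x
    using barrier[OF sys u0 \<epsilon> that] .
  obtain U E where loc: "plap_sys_loc p a b U E (\<lambda>x. restr a b m x * U x powr (- \<gamma>))"
    and Uc: "continuous_on {a..b} U" and U0: "U a = 0" "U b = 0"
    and U_ge: "\<And>x. x \<in> {a..b} \<Longrightarrow> k * bdist a b x \<le> U x"
    using truncated_limit[OF p ab m \<gamma> k sys u0 u_ge \<epsilon>(1) \<epsilon>_lim] by blast
  have U_pos: "0 < U x" if "x \<in> {a<..<b}" for x
  proof -
    have "0 < k * bdist a b x" using bdist_pos[OF that] k by simp
    then show ?thesis using U_ge[of x] that by simp
  qed
  have "solves_P p a b m \<gamma> U"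
    by (rule solves_P_I[OF p ab loc _ Uc U_pos U0]) auto
  moreover have "U \<in> P_interior a b"
    if ex: "\<exists>r>1. Lp_on r {a<..<b} (\<lambda>x. max (m x) 0 * bdist a b x powr (- \<gamma>))"
  proof -
    obtain r where r: "1 < r" "Lp_on r {a<..<b} (\<lambda>x. max (m x) 0 * bdist a b x powr (- \<gamma>))" using ex by blast
    then have pos: "(\<lambda>x. max (m x) 0 * bdist a b x powr (- \<gamma>)) absolutely_integrable_on {a<..<b}"
      by (intro Lp_on_absolutely_integrable) auto
    define w where "w = (\<lambda>x. max (m x) 0 * bdist a b x powr (- \<gamma>) + max (- m x) 0 * bdist a b x powr (- \<gamma>))"
    have "w absolutely_integrable_on {a<..<b}" unfolding w_def using pos neg by (rule set_integral_add(1))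
    then have wi: "restr a b w absolutely_integrable_on {a..b}" by (subst absolutely_integrable_restr) auto
    have "(\<lambda>x. restr a b m x * U x powr (- \<gamma>)) absolutely_integrable_on {a..b}"
    proof (rule measurable_bounded_by_integrable_imp_absolutely_integrable)
      have "continuous_on {a<..<b} U" using Uc by (rule continuous_on_subset) auto
      then have "continuous_on {a<..<b} (\<lambda>x. U x powr (- \<gamma>))"
        using U_pos by (intro continuous_intros) (auto simp: less_le)
      then show "(\<lambda>x. restr a b m x * U x powr (- \<gamma>)) \<in> borel_measurable (lebesgue_on {a..b})"
        using m by (intro measurable_restr_mult) (auto simp: absolutely_integrable_measurable)
      show "(\<lambda>x. k powr (- \<gamma>) * \<bar>restr a b w x\<bar>) integrable_on {a..b}"
        using wi by (intro integrable_on_mult_right) (auto simp: absolutely_integrable_on_def)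
      show "norm (restr a b m x * U x powr (- \<gamma>)) \<le> k powr (- \<gamma>) * \<bar>restr a b w x\<bar>" if x: "x \<in> {a..b}" for x
      proof (cases "x \<in> {a<..<b}")
        case True
        note \<delta> = bdist_pos[OF True]
        have "U x powr (- \<gamma>) \<le> (k * bdist a b x) powr (- \<gamma>)"
          using U_ge[OF x] \<delta> k \<gamma> by (intro powr_uminus_mono) auto
        also have "\<dots> = k powr (- \<gamma>) * bdist a b x powr (- \<gamma>)" using k \<delta> by (simp add: powr_mult)
        finally have "\<bar>m x\<bar> * U x powr (- \<gamma>) \<le> \<bar>m x\<bar> * (k powr (- \<gamma>) * bdist a b x powr (- \<gamma>))"
          by (intro mult_left_mono) auto
        also have "\<dots> = k powr (- \<gamma>) * w x" by (cases "0 \<le> m x") (auto simp: w_def)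
        also have "\<dots> \<le> k powr (- \<gamma>) * \<bar>w x\<bar>" by (intro mult_left_mono) auto
        finally show ?thesis using True by (simp add: abs_mult)
      qed (auto simp: restr_def)
    qed simp
    then obtain D' where "plap_sys p a b U D' (\<lambda>x. restr a b m x * U x powr (- \<gamma>))"
      using plap_sys_loc_extend[OF p ab loc _ Uc] by blast
    then show ?thesis by (rule P_interior_I[OF p ab _ U0 k]) (use U_ge in auto)
  qed
  ultimately show ?thesis by blast
qed

text \<open>The slope \<open>k\<close> minimizes \<open>k\<^sup>p\<^sup>-\<^sup>1 + k\<^sup>-\<^sup>\<gamma> M\<close>; the minimal value is where the constant in the
  hypothesis comes from.\<close>

lemma threshold:
  fixes p \<gamma> M :: real
  assumes p: "1 < p" and \<gamma>: "0 < \<gamma>" and M: "0 < M"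
  defines "k \<equiv> (\<gamma> * M / (p - 1)) powr (1 / (p - 1 + \<gamma>))"
  shows "0 < k"
    and "(k powr (p - 1) + k powr (- \<gamma>) * M) powr (p - 1 + \<gamma>)
      = ((p - 1) / \<gamma>) powr \<gamma> * ((p - 1 + \<gamma>) / (p - 1)) powr (p - 1 + \<gamma>) * M powr (p - 1)"
proof -
  define s where "s = p - 1 + \<gamma>"
  define T where "T = \<gamma> * M / (p - 1)"
  define B where "B = s / (p - 1)"
  have s: "0 < s" using p \<gamma> by (simp add: s_def)
  have T: "0 < T" using p \<gamma> M by (simp add: T_def)
  have B: "0 < B" using p s by (simp add: B_def)
  have k_eq: "k = T powr (1 / s)" by (simp add: k_def T_def s_def)
  then show k: "0 < k" using T by simp
  have ks: "k powr s = T" using s T by (simp add: k_eq powr_powr)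
  have "k powr (p - 1) = k powr (- \<gamma>) * k powr s" using powr_add[of k "- \<gamma>" s] by (simp add: s_def)
  then have "k powr (p - 1) + k powr (- \<gamma>) * M = k powr (- \<gamma>) * (T + M)"
    by (simp add: ks distrib_left)
  also have "T + M = M * B" using p by (simp add: T_def B_def s_def field_simps)
  finally have S: "k powr (p - 1) + k powr (- \<gamma>) * M = k powr (- \<gamma>) * (M * B)" .
  have "(k powr (- \<gamma>)) powr s = (k powr s) powr (- \<gamma>)" by (simp add: powr_powr mult.commute)
  also have "\<dots> = (\<gamma> / (p - 1) * M) powr (- \<gamma>)" by (simp add: ks T_def)
  also have "\<dots> = (\<gamma> / (p - 1)) powr (- \<gamma>) * M powr (- \<gamma>)"
    by (rule powr_mult)
  also have "(\<gamma> / (p - 1)) powr (- \<gamma>) = ((p - 1) / \<gamma>) powr \<gamma>"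
    using p \<gamma> by (simp add: powr_minus powr_divide field_simps)
  finally have 1: "(k powr (- \<gamma>)) powr s = ((p - 1) / \<gamma>) powr \<gamma> * M powr (- \<gamma>)" .
  have 2: "M powr (- \<gamma>) * M powr s = M powr (p - 1)" using powr_add[of M "- \<gamma>" s] by (simp add: s_def)
  have "(k powr (- \<gamma>) * (M * B)) powr s = (k powr (- \<gamma>)) powr s * (M powr s * B powr s)"
    using M B by (simp add: powr_mult)
  also have "\<dots> = ((p - 1) / \<gamma>) powr \<gamma> * B powr s * (M powr (- \<gamma>) * M powr s)"
    unfolding 1 by (simp only: mult_ac)
  finally show "(k powr (p - 1) + k powr (- \<gamma>) * M) powr (p - 1 + \<gamma>)
      = ((p - 1) / \<gamma>) powr \<gamma> * ((p - 1 + \<gamma>) / (p - 1)) powr (p - 1 + \<gamma>) * M powr (p - 1)"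
    unfolding S 2 s_def[symmetric] B_def[symmetric] .
qed

text \<open>Read with P the integral of m^+, L = |I|, d = (b - a)/2, J the essential infimum on I
  and S the minimal value from \<open>threshold\<close>. The result says that at height H the
  right-hand side on I is still at least \<lambda> H^(p-1).\<close>

lemma threshold_height:
  fixes p \<gamma> M P L d lam c S J :: real
  assumes p: "1 < p" and \<gamma>: "0 < \<gamma>" and P: "0 < P" and L: "0 < L" "L \<le> 2 * d"
    and lam: "(2 / L) powr p \<le> lam" and c: "0 < c" and S: "0 < S" and J: "0 \<le> J" "J * L \<le> P"
    and hyp: "d powr (\<gamma> * (p - 1)) * (c powr (p - 1) * lam) powr (p - 1 + \<gamma>) * S powr (p - 1 + \<gamma>)
      \<le> J powr (p - 1 + \<gamma>) / P powr \<gamma>"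
  defines "H \<equiv> c * S powr (1 / (p - 1))"
  shows "0 < J" "lam * H powr (p - 1) \<le> J * H powr (- \<gamma>)"
proof -
  define s where "s = p - 1 + \<gamma>"
  have s: "0 < s" using p \<gamma> by (simp add: s_def)
  have d: "0 < d" using L by linarith
  have "0 < (2 / L) powr p" using L by simp
  then have lam_pos: "0 < lam" using lam by linarith
  have H: "0 < H" using c S by (simp add: H_def)
  define X where "X = lam * H powr (p - 1)"
  have X: "0 < X" using lam_pos H by (simp add: X_def)
  have X_eq: "X = c powr (p - 1) * lam * S"
    using p c S by (simp add: X_def H_def powr_mult powr_powr)
  have hyp': "d powr (\<gamma> * (p - 1)) * X powr s \<le> J powr s / P powr \<gamma>"
    using hyp c lam_pos S by (simp add: X_eq s_def[symmetric] powr_mult mult.assoc)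
  have "0 < d powr (\<gamma> * (p - 1)) * X powr s" using d X by simp
  then have "0 < J powr s / P powr \<gamma>" using hyp' by linarith
  then have "J \<noteq> 0" by auto
  then show Jpos: "0 < J" using J by simp
  \<comment> \<open>J L \<le> P trades the integral of m^+ for J L; the resulting factor J^\<gamma>
    then cancels.\<close>
  have "(J * L) powr \<gamma> * (d powr (\<gamma> * (p - 1)) * X powr s) \<le> P powr \<gamma> * (d powr (\<gamma> * (p - 1)) * X powr s)"
    using J L \<gamma> by (intro mult_right_mono powr_mono2) auto
  also have "\<dots> \<le> J powr s" using hyp' P by (simp add: field_simps)
  also have "J powr s = J powr \<gamma> * J powr (p - 1)" using powr_add[of J \<gamma> "p - 1"] by (simp add: s_def add.commute)
  finally have "J powr \<gamma> * (L powr \<gamma> * (d powr (\<gamma> * (p - 1)) * X powr s)) \<le> J powr \<gamma> * J powr (p - 1)"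
    using Jpos L by (simp add: powr_mult mult.assoc)
  then have Jp: "L powr \<gamma> * (d powr (\<gamma> * (p - 1)) * X powr s) \<le> J powr (p - 1)"
    using Jpos by (simp add: mult_le_cancel_left_pos)
  have "L powr \<gamma> * (d powr (\<gamma> * (p - 1)) * X powr s) = (L * d powr (p - 1) * X) powr \<gamma> * X powr (p - 1)"
  proof -
    have "X powr s = X powr \<gamma> * X powr (p - 1)" using powr_add[of X \<gamma> "p - 1"] by (simp add: s_def add.commute)
    moreover have "d powr (\<gamma> * (p - 1)) = (d powr (p - 1)) powr \<gamma>" by (simp add: powr_powr mult.commute)
    ultimately show ?thesis using L d X by (simp add: powr_mult)
  qed
  \<comment> \<open>L/2 \<le> d and the eigenvalue bound give L d^(p-1) \<lambda> \<ge> L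
    (L/2)^(p-1) (2/L)^p = 2. This is what the factor (b - a)/2 in the constant of the hypothesis is
    for.\<close>
  moreover have "H powr (p - 1) \<le> L * d powr (p - 1) * X"
  proof -
    have "(L / 2) powr (p - 1) * (2 / L) powr p = 2 / L"
    proof -
      have "(2 / L) powr (p - 1) * (L / 2) powr (p - 1) = 1"
        unfolding powr_mult[symmetric] using L by simp
      then have "(L / 2) powr (p - 1) = (2 / L) powr (- (p - 1))"
        unfolding powr_minus by (simp add: inverse_unique)
      then show ?thesis using powr_add[of "2 / L" "- (p - 1)" p] L by simp
    qed
    then have "1 \<le> L * ((L / 2) powr (p - 1) * (2 / L) powr p)" using L by simp
    also have "\<dots> \<le> L * (d powr (p - 1) * lam)"
      using L p lam lam_pos by (intro mult_left_mono mult_mono powr_mono2) auto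
    finally have "1 * H powr (p - 1) \<le> L * (d powr (p - 1) * lam) * H powr (p - 1)"
      by (intro mult_right_mono) auto
    then show ?thesis by (simp add: X_def mult.assoc)
  qed
  then have "(H powr (p - 1)) powr \<gamma> * X powr (p - 1) \<le> (L * d powr (p - 1) * X) powr \<gamma> * X powr (p - 1)"
    using \<gamma> by (intro mult_right_mono powr_mono2) auto
  moreover have "(H powr (p - 1)) powr \<gamma> * X powr (p - 1) = (H powr \<gamma> * X) powr (p - 1)"
    using H X by (simp add: powr_mult powr_powr mult.commute)
  ultimately have "(H powr \<gamma> * X) powr (p - 1) \<le> J powr (p - 1)" using Jp by simp
  then have "H powr \<gamma> * X \<le> J"
    using p Jpos powr_less_mono2[of "p - 1" J "H powr \<gamma> * X"] by (smt (verit))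
  then show "lam * H powr (p - 1) \<le> J * H powr (- \<gamma>)"
    unfolding X_def[symmetric] using H by (simp add: powr_minus field_simps)
qed

text \<open>Turns the eigenvalue bound into the two numerical conditions of \<open>barrier\<close>.
  In the second one the factor q^(p-1) of that bound exactly compensates the division by q in the
  growth estimate.\<close>

lemma barrier_constants:
  fixes p L H K q :: real
  assumes p: "1 < p" and L: "0 < L" and H: "0 < H" and q: "q = p / (p - 1)"
    and K: "(2 / L) powr p * q powr (p - 1) * H powr (p - 1) \<le> K"
  shows "(2 * H / L) powr (p - 1) \<le> K * (L / 2)" "H \<le> psi_p p K * ((L / 2) powr q / q)"
proof -
  have q1: "1 < q" using p by (simp add: q field_simps)
  have "1 \<le> q powr (p - 1)" using q1 p by (intro ge_one_powr_ge_zero) auto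
  have "(2 / L) powr p * (L / 2) = (2 / L) powr (p - 1)"
  proof -
    have "(2 / L) powr p = (2 / L) powr (p - 1) * (2 / L)" using powr_quotient(1)[of "2 / L" "2 / L" p] L by simp
    then show ?thesis using L by simp
  qed
  then have "(2 * H / L) powr (p - 1) = (2 / L) powr p * 1 * H powr (p - 1) * (L / 2)"
    using powr_mult[of "2 / L" H "p - 1"] by (simp add: mult.commute mult.left_commute)
  also have "\<dots> \<le> (2 / L) powr p * q powr (p - 1) * H powr (p - 1) * (L / 2)"
    using \<open>1 \<le> q powr (p - 1)\<close> L by (intro mult_right_mono mult_left_mono) auto
  also have "\<dots> \<le> K * (L / 2)" using K L by (intro mult_right_mono) auto
  finally show "(2 * H / L) powr (p - 1) \<le> K * (L / 2)" .
  have "psi_p p ((2 / L) powr p * q powr (p - 1) * H powr (p - 1)) = (2 / L) powr q * q * H"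
  proof -
    have "((2 / L) powr p) powr (1 / (p - 1)) = (2 / L) powr q" by (simp add: powr_powr q)
    moreover have "(q powr (p - 1)) powr (1 / (p - 1)) = q" "(H powr (p - 1)) powr (1 / (p - 1)) = H"
      using p q1 H by (simp_all add: powr_powr)
    ultimately show ?thesis by (simp add: psi_p_nonneg powr_mult)
  qed
  then have le: "(2 / L) powr q * q * H \<le> psi_p p K" using K p by (metis psi_p_le_iff)
  have "(2 / L) powr q * (L / 2) powr q = 1" unfolding powr_mult[symmetric] using L by simp
  then have "H = (2 / L) powr q * q * H * ((L / 2) powr q / q)" using q1 by (simp add: field_simps)
  also have "\<dots> \<le> psi_p p K * ((L / 2) powr q / q)"
    using le q1 by (intro mult_right_mono) auto
  finally show "H \<le> psi_p p K * ((L / 2) powr q / q)" .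
qed

lemma set_integral_eq_integral_restr:
  assumes "f absolutely_integrable_on {a<..<b}" "a \<le> s" "t \<le> b"
  shows "(LINT x:{s<..<t}|lebesgue. f x) = integral {s..t} (restr a b f)"
proof -
  have "f absolutely_integrable_on {s<..<t}"
    by (rule set_integrable_subset[OF assms(1)]) (use assms in auto)
  then have "(LINT x:{s<..<t}|lebesgue. f x) = integral {s<..<t} f"
    by (rule set_lebesgue_integral_eq_integral(2))
  also have "\<dots> = integral {s<..<t} (restr a b f)"
    using assms by (intro Henstock_Kurzweil_Integration.integral_cong) auto
  finally show ?thesis by (simp add: integral_open_interval_real)
qed

lemma set_integral_zero_negligible:
  fixes f :: "real \<Rightarrow> real"
  assumes "f absolutely_integrable_on S" "\<And>x. x \<in> S \<Longrightarrow> 0 \<le> f x" "(LINT x:S|lebesgue. f x) = 0"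
  obtains N where "negligible N" "\<And>x. x \<in> S - N \<Longrightarrow> f x = 0"
proof -
  have "AE x in lebesgue. 0 \<le> indicator S x *\<^sub>R f x"
    using assms(2) by (intro AE_I2) (simp add: indicator_def)
  then have "AE x in lebesgue. indicator S x *\<^sub>R f x = 0"
    using assms(1,3) integral_nonneg_eq_0_iff_AE[of lebesgue "\<lambda>x. indicator S x *\<^sub>R f x"]
    by (simp add: set_integrable_def set_lebesgue_integral_def)
  then obtain N where "negligible N" "\<And>x. x \<notin> N \<Longrightarrow> indicator S x *\<^sub>R f x = 0"
    using AE_lebesgue_negligible[of "\<lambda>x. indicator S x *\<^sub>R f x = 0"] by blast
  then show thesis by (intro that[of N]) (auto simp: indicator_def split: if_splits)
qed

theorem solution_threshold:
  assumes ab: "a < b" and p: "1 < p" and m: "m absolutely_integrable_on {a<..<b}"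
    and \<gamma>: "0 < \<gamma>" and q: "1 < q" "Lp_on q {a<..<b} (\<lambda>x. max (- m x) 0 * bdist a b x powr (- \<gamma>))"
    and I: "a \<le> x0" "x0 < x1" "x1 \<le> b"
    and P: "0 < (LINT x:{a<..<b}|lebesgue. max (m x) 0)"
    and nn: "AE x in lebesgue_on {x0<..<x1}. 0 \<le> m x"
    and hyp: "c_const \<gamma> p a b x0 x1
               * max (LINT x:{a<..<x0}|lebesgue. max (- m x) 0 * bdist a b x powr (- \<gamma>))
                     (LINT x:{x1<..<b}|lebesgue. max (- m x) 0 * bdist a b x powr (- \<gamma>)) powr (p - 1)
      \<le> ess_inf_on {x0<..<x1} (\<lambda>x. max (m x) 0) powr (p - 1 + \<gamma>)
              / (LINT x:{a<..<b}|lebesgue. max (m x) 0) powr \<gamma>"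
  shows "\<exists>u. solves_P p a b m \<gamma> u
    \<and> ((\<exists>r>1. Lp_on r {a<..<b} (\<lambda>x. max (m x) 0 * bdist a b x powr (- \<gamma>))) \<longrightarrow> u \<in> P_interior a b)"
proof -
  define nf where "nf = (\<lambda>x. max (- m x) 0 * bdist a b x powr (- \<gamma>))"
  have nfi: "nf absolutely_integrable_on {a<..<b}"
    unfolding nf_def using q by (intro Lp_on_absolutely_integrable) auto
  have nf_nn: "0 \<le> nf x" for x by (simp add: nf_def)
  define nr where "nr = restr a b nf"
  have nr_nn: "0 \<le> nr x" for x using nf_nn by (simp add: nr_def restr_def)
  have "nr absolutely_integrable_on {a..b}" unfolding nr_def using nfi by (subst absolutely_integrable_restr) auto
  then have "nr integrable_on {a..b}" by (rule set_lebesgue_integral_eq_integral(1))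
  then have nri: "nr integrable_on {s..t}" if "a \<le> s" "t \<le> b" for s t
    using integrable_on_subinterval that by (metis atLeastatMost_subset_iff)
  have m0: "restr a b m absolutely_integrable_on {a..b}" using m by (subst absolutely_integrable_restr) auto
  define Ml where "Ml = (LINT x:{a<..<x0}|lebesgue. nf x)"
  define Mr where "Mr = (LINT x:{x1<..<b}|lebesgue. nf x)"
  define M where "M = max Ml Mr"
  have Ml_eq: "Ml = integral {a..x0} nr" unfolding Ml_def nr_def
    by (rule set_integral_eq_integral_restr[OF nfi]) (use I in auto)
  have Mr_eq: "Mr = integral {x1..b} nr" unfolding Mr_def nr_def
    by (rule set_integral_eq_integral_restr[OF nfi]) (use I in auto)
  have M_nn: "0 \<le> Ml" "0 \<le> Mr" unfolding Ml_eq Mr_eq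
    using I nr_nn by (auto intro!: Henstock_Kurzweil_Integration.integral_nonneg nri)
  define J where "J = ess_inf_on {x0<..<x1} (\<lambda>x. max (m x) 0)"
  have J: "0 \<le> J" "AE x in lebesgue_on {x0<..<x1}. J \<le> max (m x) 0"
    unfolding J_def by (rule ess_inf_on_AE[OF I(2)]; simp)+
  from nn J(2) have "AE x in lebesgue_on {x0<..<x1}. 0 \<le> m x \<and> J \<le> m x"
    by eventually_elim auto
  then obtain N1 where N1: "negligible N1" "\<And>x. x \<in> {x0<..<x1} - N1 \<Longrightarrow> 0 \<le> m x \<and> J \<le> m x"
    unfolding AE_lebesgue_on_Ioo_iff by blast
  define mp where "mp = (\<lambda>x. max (m x) 0)"
  have mpi: "mp absolutely_integrable_on {a<..<b}"
    unfolding mp_def by (intro absolutely_integrable_max_1 m) simp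
  define PP where "PP = (LINT x:{a<..<b}|lebesgue. mp x)"
  have PP_pos: "0 < PP" using P by (simp add: PP_def mp_def)
  have PP_eq: "PP = integral {a..b} (restr a b mp)"
    unfolding PP_def by (rule set_integral_eq_integral_restr[OF mpi]) auto
  have barrier_imp: ?thesis if "0 < k" "0 < \<epsilon>0"
    and bar: "\<And>u D \<epsilon> x. \<lbrakk>plap_sys p a b u D (\<lambda>x. trunc_rhs a b m \<gamma> k \<epsilon> x (u x)); u a = 0; u b = 0;
        0 < \<epsilon>; \<epsilon> \<le> \<epsilon>0; x \<in> {a..b}\<rbrakk> \<Longrightarrow> k * bdist a b x \<le> u x" for k \<epsilon>0
  proof (rule solution_from_barrier[OF p ab m \<gamma> _ \<open>0 < k\<close> \<open>0 < \<epsilon>0\<close>])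
    show "(\<lambda>x. max (- m x) 0 * bdist a b x powr (- \<gamma>)) absolutely_integrable_on {a<..<b}"
      using nfi by (simp only: nf_def)
  qed (rule bar)
  show ?thesis
  proof (cases "0 < M")
    \<comment> \<open>With M = 0 the threshold inequality holds trivially and yields no slope k.
      Here m is nonnegative a.e.: outside I because the weighted integrals vanish, inside I by
      assumption.\<close>
    case False
    then have M0: "Ml = 0" "Mr = 0" using M_nn by (auto simp: M_def)
    have "nf absolutely_integrable_on {a<..<x0}"
      by (rule set_integrable_subset[OF nfi]) (use I in auto)
    then obtain N2 where N2: "negligible N2" "\<And>x. x \<in> {a<..<x0} - N2 \<Longrightarrow> nf x = 0"
      using set_integral_zero_negligible[OF _ nf_nn M0(1)[unfolded Ml_def]] by blast
    have "nf absolutely_integrable_on {x1<..<b}"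
      by (rule set_integrable_subset[OF nfi]) (use I in auto)
    then obtain N3 where N3: "negligible N3" "\<And>x. x \<in> {x1<..<b} - N3 \<Longrightarrow> nf x = 0"
      using set_integral_zero_negligible[OF _ nf_nn M0(2)[unfolded Mr_def]] by blast
    define N where "N = N1 \<union> N2 \<union> N3 \<union> {x0, x1}"
    have N: "negligible N" unfolding N_def using N1 N2 N3 by (simp add: negligible_Un)
    have m_nn: "0 \<le> m x" if x: "x \<in> {a<..<b} - N" for x
    proof -
      consider "x \<in> {x0<..<x1}" | "nf x = 0" using x N2(2)[of x] N3(2)[of x] by (fastforce simp: N_def)
      then show ?thesis
      proof cases
        case 1
        then show ?thesis using N1(2)[of x] x by (auto simp: N_def)
      next
        case 2
        then show ?thesis using bdist_pos[of x a b] x by (auto simp: nf_def)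
      qed
    qed
    have "integral {a..b} (restr a b mp) = integral {a..b} (restr a b m)"
    proof (rule integral_spike[OF N])
      show "restr a b m x = restr a b mp x" if "x \<in> {a..b} - N" for x
        using m_nn[of x] that by (auto simp: restr_def mp_def)
    qed
    then have "0 < integral {a..b} (restr a b m)" using PP_pos PP_eq by simp
    then obtain k where k: "0 < k"
      "\<And>u D \<epsilon> x. \<lbrakk>plap_sys p a b u D (\<lambda>x. trunc_rhs a b m \<gamma> k \<epsilon> x (u x)); u a = 0; u b = 0; 0 < \<epsilon>; \<epsilon> \<le> 1; x \<in> {a..b}\<rbrakk>
        \<Longrightarrow> k * bdist a b x \<le> u x"
      using barrier_nonneg[OF p ab m \<gamma> N m_nn] by blast
    show ?thesis by (rule barrier_imp[OF k(1) zero_less_one]) (rule k(2))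
  next
    case True
    \<comment> \<open>The minimizing slope of \<open>threshold\<close>; \<open>B\<close> is then the
      largest possible flux gain outside I, and \<open>S\<close> the minimal value.\<close>
    define k where "k = (\<gamma> * M / (p - 1)) powr (1 / (p - 1 + \<gamma>))"
    define B where "B = k powr (- \<gamma>) * M"
    define S where "S = k powr (p - 1) + B"
    have k: "0 < k" unfolding k_def by (rule threshold(1)[OF p \<gamma> True])
    have B: "0 < B" using k True by (simp add: B_def)
    have S: "0 < S" using B by (simp add: S_def add_nonneg_pos)
    define L where "L = x1 - x0"
    define c where "c = (x0 + x1) / 2"
    define cI where "cI = c_I a b x0 x1"
    define lam where "lam = lambda1 p x0 x1"
    define qq where "qq = p / (p - 1)"
    have L: "0 < L" "L \<le> 2 * ((b - a) / 2)" using I by (auto simp: L_def)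
    have cI: "c - a \<le> cI" "b - c \<le> cI" by (auto simp: cI_def c_I_def c_def)
    have cI_pos: "(b - a) / 2 \<le> cI" "L / 2 \<le> cI" "0 < cI" using cI I ab by (auto simp: L_def)
    have qq: "1 < qq" using p by (simp add: qq_def field_simps)
    have lam: "(2 / L) powr p * qq powr (p - 1) \<le> lam"
      unfolding L_def qq_def lam_def by (rule lambda1_ge[OF p I(2)])
    have "(2 / L) powr p * 1 \<le> (2 / L) powr p * qq powr (p - 1)"
      using qq p by (intro mult_left_mono ge_one_powr_ge_zero) auto
    then have lam': "(2 / L) powr p \<le> lam" using lam by simp
    \<comment> \<open>m^+ is at least J on I, whose length is L.\<close>
    have JL: "J * L \<le> PP"
    proof -
      have mpr: "restr a b mp integrable_on {a..b}"
        using mpi by (intro set_lebesgue_integral_eq_integral(1)) (subst absolutely_integrable_restr, auto)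
      have sub: "{x0..x1} \<subseteq> {a..b}" using I by auto
      have "integral {x0..x1} (\<lambda>x. J) \<le> integral {x0..x1} (restr a b mp)"
      proof (rule integral_mono_ae)
        show "restr a b mp integrable_on {x0..x1}" by (rule integrable_on_subinterval[OF mpr sub])
        show "negligible (N1 \<union> {x0, x1})" using N1 by (simp add: negligible_Un)
        show "J \<le> restr a b mp x" if "x \<in> {x0..x1} - (N1 \<union> {x0, x1})" for x
          using that I N1(2)[of x] by (auto simp: mp_def restr_def)
      qed (rule integrable_const_ivl)
      also have "\<dots> \<le> integral {a..b} (restr a b mp)"
        by (rule integral_subset_le[OF sub integrable_on_subinterval[OF mpr sub] mpr]) (simp add: restr_def mp_def)
      finally show ?thesis using I by (simp add: PP_eq L_def mult.commute)
    qed
    have hyp': "((b - a) / 2) powr (\<gamma> * (p - 1)) * (cI powr (p - 1) * lam) powr (p - 1 + \<gamma>) * S powr (p - 1 + \<gamma>)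
        \<le> J powr (p - 1 + \<gamma>) / PP powr \<gamma>"
    proof -
      have "S powr (p - 1 + \<gamma>) = ((p - 1) / \<gamma>) powr \<gamma> * ((p - 1 + \<gamma>) / (p - 1)) powr (p - 1 + \<gamma>) * M powr (p - 1)"
        unfolding S_def B_def k_def by (rule threshold(2)[OF p \<gamma> True])
      then have "((b - a) / 2) powr (\<gamma> * (p - 1)) * (cI powr (p - 1) * lam) powr (p - 1 + \<gamma>) * S powr (p - 1 + \<gamma>)
          = c_const \<gamma> p a b x0 x1 * M powr (p - 1)"
        by (simp add: c_const_def cI_def lam_def)
      also have "\<dots> \<le> J powr (p - 1 + \<gamma>) / PP powr \<gamma>"
        using hyp unfolding M_def Ml_def Mr_def nf_def J_def PP_def mp_def .
      finally show ?thesis .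
    qed
    define \<sigma> where "\<sigma> = S powr (1 / (p - 1))"
    define H where "H = cI * \<sigma>"
    define K where "K = J * H powr (- \<gamma>)"
    have \<sigma>: "0 < \<sigma>" using S by (simp add: \<sigma>_def)
    have H: "0 < H" using \<sigma> cI_pos by (simp add: H_def)
    note th = threshold_height[OF p \<gamma> PP_pos L lam' cI_pos(3) S J(1) JL hyp', folded \<sigma>_def H_def]
    have phi\<sigma>: "phi_p p \<sigma> = S" using \<sigma> S p by (simp add: phi_p_nonneg \<sigma>_def powr_powr)
    then have \<sigma>_eq: "phi_p p \<sigma> = phi_p p k + B" using k by (simp add: phi_p_nonneg S_def)
    have "(2 / L) powr p * qq powr (p - 1) * H powr (p - 1) \<le> lam * H powr (p - 1)"
      using lam by (intro mult_right_mono) auto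
    also have "\<dots> \<le> K" using th(2) by (simp add: K_def)
    finally have K_ge: "(2 / L) powr p * qq powr (p - 1) * H powr (p - 1) \<le> K" .
    have K: "0 \<le> K" using th(1) by (simp add: K_def)
    note cons = barrier_constants[OF p L(1) H qq_def K_ge]
    \<comment> \<open>c_I is at least L/2, so B \<le> S = \<sigma>^(p-1) \<le> (2 H /
      L)^(p-1).\<close>
    have KB: "B \<le> K * (L / 2)"
    proof -
      have "L / 2 * \<sigma> \<le> H" unfolding H_def using cI_pos \<sigma> by (intro mult_right_mono) auto
      then have "\<sigma> \<le> 2 * H / L" using L by (simp add: field_simps)
      then have "\<sigma> powr (p - 1) \<le> (2 * H / L) powr (p - 1)" using \<sigma> p by (intro powr_mono2) auto
      moreover have "\<sigma> powr (p - 1) = S" using phi\<sigma> \<sigma> by (simp add: phi_p_nonneg)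
      moreover have "B \<le> S" by (simp add: S_def)
      ultimately show ?thesis using cons(1) by linarith
    qed
    have k\<sigma>: "k \<le> \<sigma>" using \<sigma>_eq B phi_p_le_iff[OF p, of k \<sigma>] by simp
    show ?thesis
    \<comment> \<open>Restricting \<epsilon> to at most H keeps the constant floor from spoiling the
      lower bound K on the right-hand side.\<close>
    proof (rule barrier_imp[OF k H])
      fix u D \<epsilon> x
      assume sys: "plap_sys p a b u D (\<lambda>x. trunc_rhs a b m \<gamma> k \<epsilon> x (u x))" and u0: "u a = 0" "u b = 0"
        and \<epsilon>: "0 < \<epsilon>" "\<epsilon> \<le> H" and x: "x \<in> {a..b}"
      let ?f = "\<lambda>x. trunc_rhs a b m \<gamma> k \<epsilon> x (u x)"
      have fi: "?f integrable_on {s..t}" if "a \<le> s" "t \<le> b" for s t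
        using integrable_on_subinterval[OF plap_sysD(2)[OF sys]] that by auto
      \<comment> \<open>Only the negative part of m can increase the flux, and there the floor k
        \<delta> bounds the singular factor.\<close>
      have f_lower: "- ?f t \<le> k powr (- \<gamma>) * nr t" for t
      proof (cases "t \<in> {a<..<b}")
        case True
        define \<delta> where "\<delta> = bdist a b t"
        define R where "R = max (max (u t) (k * \<delta>)) \<epsilon>"
        have \<delta>: "0 < \<delta>" using bdist_pos[OF True] by (simp add: \<delta>_def)
        have "R powr (- \<gamma>) \<le> (k * \<delta>) powr (- \<gamma>)"
          using k \<delta> \<gamma> by (intro powr_uminus_mono) (auto simp: R_def)
        then have "R powr (- \<gamma>) \<le> k powr (- \<gamma>) * \<delta> powr (- \<gamma>)" by (simp add: powr_mult)
        then have "max (- m t) 0 * R powr (- \<gamma>) \<le> max (- m t) 0 * (k powr (- \<gamma>) * \<delta> powr (- \<gamma>))"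
          by (intro mult_left_mono) auto
        moreover have "- m t * R powr (- \<gamma>) \<le> max (- m t) 0 * R powr (- \<gamma>)"
          by (intro mult_right_mono) auto
        ultimately have "- m t * R powr (- \<gamma>) \<le> max (- m t) 0 * (k powr (- \<gamma>) * \<delta> powr (- \<gamma>))" by linarith
        then show ?thesis
          using True by (simp add: trunc_rhs_def nr_def nf_def R_def \<delta>_def mult.left_commute)
      qed (auto simp: trunc_rhs_def nr_def restr_def)
      show "k * bdist a b x \<le> u x"
      proof (rule barrier[OF p sys u0 I c_def k _ \<sigma>_eq _ _ K _ _ _ _ _ x])
        show "0 \<le> B" using B by simp
        show "D t - D s \<le> B" if st: "a \<le> s" "s \<le> t" "t \<le> x0 \<or> x1 \<le> s" "t \<le> b" for s t
        proof -
          have "D t - D s = integral {s..t} (\<lambda>x. - ?f x)"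
            using plap_sysD(3)[OF sys, of s t] st by (simp add: Henstock_Kurzweil_Integration.integral_neg)
          also have "\<dots> \<le> integral {s..t} (\<lambda>t. k powr (- \<gamma>) * nr t)"
            using f_lower st by (intro integral_le integrable_on_mult_right nri) (auto simp: integrable_neg_iff fi)
          also have "\<dots> = k powr (- \<gamma>) * integral {s..t} nr" by simp
          also have "integral {s..t} nr \<le> M"
          proof (cases "t \<le> x0")
            case True
            have "integral {s..t} nr \<le> integral {a..x0} nr"
              using st True I nr_nn by (intro integral_subset_le nri) auto
            then show ?thesis by (simp add: M_def Ml_eq)
          next
            case False
            have "integral {s..t} nr \<le> integral {x1..b} nr"
              using st False I nr_nn by (intro integral_subset_le nri) auto
            then show ?thesis by (simp add: M_def Mr_eq)
          qed
          finally show ?thesis by (simp add: B_def mult_left_mono)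
        qed
        have N: "negligible (N1 \<union> {x0, x1})" using N1 by (simp add: negligible_Un)
        show "D t \<le> D s" if st: "x0 \<le> s" "s \<le> t" "t \<le> x1" for s t
        proof -
          have "integral {s..t} (\<lambda>x. 0) \<le> integral {s..t} ?f"
          proof (rule integral_mono_ae[OF _ fi N])
            show "0 \<le> ?f r" if "r \<in> {s..t} - (N1 \<union> {x0, x1})" for r
              using that st N1(2)[of r] by (auto simp: trunc_rhs_def restr_def)
          qed (use st I in auto)
          then show ?thesis using plap_sysD(3)[OF sys, of s t] st I by simp
        qed
        show "K * (t - s) \<le> D s - D t"
          if st: "x0 \<le> s" "s \<le> t" "t \<le> x1" and uH: "\<And>r. r \<in> {s..t} \<Longrightarrow> u r \<le> H" for s t
        proof -
          have "integral {s..t} (\<lambda>x. K) \<le> integral {s..t} ?f"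
          proof (rule integral_mono_ae[OF _ fi N])
            fix r assume r: "r \<in> {s..t} - (N1 \<union> {x0, x1})"
            then have rI: "r \<in> {x0<..<x1} - N1" "a < r" "r < b" using st I by auto
            \<comment> \<open>The floor k \<delta> does not exceed H either, since k \<le> \<sigma>
              and \<delta> \<le> (b - a)/2 \<le> c_I; so wherever u \<le> H the whole truncated
              argument is at most H.\<close>
            have "k * bdist a b r \<le> \<sigma> * cI"
            proof (rule mult_mono)
              have "bdist a b r \<le> (b - a) / 2" by (auto simp: bdist_def min_def)
              then show "bdist a b r \<le> cI" using cI_pos by simp
              show "0 \<le> bdist a b r" using rI by (intro bdist_nonneg) auto
            qed (use k\<sigma> \<sigma> in auto)
            then have "max (max (u r) (k * bdist a b r)) \<epsilon> \<le> H"
              using uH[of r] r \<epsilon> by (simp add: H_def mult.commute)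
            then have "H powr (- \<gamma>) \<le> max (max (u r) (k * bdist a b r)) \<epsilon> powr (- \<gamma>)"
              using \<epsilon> \<gamma> by (intro powr_uminus_mono) (auto simp: less_max_iff_disj)
            then have "J * H powr (- \<gamma>) \<le> m r * max (max (u r) (k * bdist a b r)) \<epsilon> powr (- \<gamma>)"
              using N1(2)[OF rI(1)] by (intro mult_mono) auto
            then show "K \<le> ?f r" using rI by (simp add: K_def trunc_rhs_def)
          qed (use st I in auto)
          then show ?thesis using plap_sysD(3)[OF sys, of s t] st I by (simp add: mult.commute)
        qed
        show "B \<le> K * ((x1 - x0) / 2)" using KB by (simp add: L_def)
        show "H \<le> psi_p p K * (((x1 - x0) / 2) powr (p / (p - 1)) / (p / (p - 1)))"
          using cons(2) unfolding L_def qq_def .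
        show "(c - a) * \<sigma> \<le> H" "(b - c) * \<sigma> \<le> H"
          unfolding H_def using cI \<sigma> by (auto intro: mult_right_mono)
      qed
    qed
  qed
qed

theorem theorem3p1:
  fixes a b p :: real and m :: "real \<Rightarrow> real"
  assumes "a < b" and "1 < p" and "Lp_on (p / (p - 1)) {a<..<b} m"
  shows "(sol_op p a b m \<in> P_interior a b \<longrightarrow>
            (\<exists>\<gamma>0>0. \<forall>\<gamma>. 0 < \<gamma> \<and> \<gamma> \<le> \<gamma>0 \<longrightarrow>
               (\<exists>u. solves_P p a b m \<gamma> u \<and> u \<in> P_interior a b)))
       \<and> (\<forall>\<gamma> q x0 x1.
            0 < \<gamma> \<longrightarrow> 1 < q \<longrightarrow>
            Lp_on q {a<..<b} (\<lambda>x. max (- m x) 0 * bdist a b x powr (- \<gamma>)) \<longrightarrow>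
            a \<le> x0 \<longrightarrow> x0 < x1 \<longrightarrow> x1 \<le> b \<longrightarrow>
            (LINT x:{a<..<b}|lebesgue. max (m x) 0) > 0 \<longrightarrow>
            (AE x in lebesgue_on {x0<..<x1}. m x \<ge> 0) \<longrightarrow>
            ess_inf_on {x0<..<x1} (\<lambda>x. max (m x) 0) powr (p - 1 + \<gamma>)
              / (LINT x:{a<..<b}|lebesgue. max (m x) 0) powr \<gamma>
            \<ge> c_const \<gamma> p a b x0 x1
               * max (LINT x:{a<..<x0}|lebesgue. max (- m x) 0 * bdist a b x powr (- \<gamma>))
                     (LINT x:{x1<..<b}|lebesgue. max (- m x) 0 * bdist a b x powr (- \<gamma>))
                 powr (p - 1) \<longrightarrow>
            (\<exists>u. solves_P p a b m \<gamma> u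
               \<and> ((\<exists>r>1. Lp_on r {a<..<b} (\<lambda>x. max (m x) 0 * bdist a b x powr (- \<gamma>)))
                    \<longrightarrow> u \<in> P_interior a b)))"
proof -
  have "1 \<le> p / (p - 1)" using assms(2) by (simp add: field_simps)
  then have m: "m absolutely_integrable_on {a<..<b}" using assms(3) by (rule Lp_on_absolutely_integrable)
  show ?thesis
    using solution_small_gamma[OF assms] solution_threshold[OF assms(1,2) m] by blast
qed

end
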